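(* Let $(\overline{\widehat{K}(X)}|K,v)$ be an extension of valued fields, where $\widehat{K}$ is the completion of $(K,v)$. Assume that $(K(X)|K,v)$ is not valuation algebraic of type II. Then $$\widehat{K}^h\,.\,IC(K(X)|K,v)=IC(\widehat{K}(X)|\widehat{K},v),$$ where the left-hand side is the compositum of $\widehat{K}^h$ and $IC(K(X)|K,v)$.
   Context: Valuations are Krull valuations written additively; $vL$, $Lv$ denote value group and residue field. $(K,v)$ is dense in $(L,v)$ if for every $a\in L$, $\gamma\in vL$ there is $b\in K$ with $v(a-b)>\gamma$; the completion $(\widehat{K},v)$ is the maximal extension in which $(K,v)$ is dense. "An extension of valued fields $(\overline{\widehat{K}(X)}|K,v)$" means a valuation $v$ on the algebraic closure $\overline{\widehat{K}(X)}$ of $\widehat{K}(X)$ whose restriction to $\widehat{K}$ is the valuation of the completion; all subfields, in particular the algebraic closures of $K$, $\widehat{K}$, $K(X)$ taken inside it, carry the restricted valuation. For a subfield $F$ of $\overline{\widehat{K}(X)}$, $F^h$ denotes the henselization of $(F,v)$ inside $\overline{F}$ with respect to $v$. The implicit constant field of $(F(X)|F,v)$ is $IC(F(X)|F,v):=\overline{F}\cap F(X)^h$. $(K(X)|K,v)$ is value transcendental if $\dim_{\mathbb{Q}}\big((vK(X)/vK)\otimes\mathbb{Q}\big)=1$, residue transcendental if $\mathrm{trdeg}[K(X)v:Kv]=1$, valuation transcendental if it is one of these, and valuation algebraic otherwise. A sequence $\{z_\nu\}_{\nu<\lambda}$ ($\lambda$ a limit ordinal) in a valued field is a pseudo-Cauchy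 sequence (pCs) if $v(z_{\nu_1}-z_{\nu_2})<v(z_{\nu_2}-z_{\nu_3})$ for all $\nu_1<\nu_2<\nu_3<\lambda$. A pCs in $(F,v)$ is of transcendental type in $(F,v)$ if for every polynomial $h$ over $F$ the sequence $\{vh(z_\nu)\}$ is ultimately constant, and of algebraic type otherwise. Suppose $(K(X)|K,v)$ is valuation algebraic. Take a strictly increasing cofinal sequence $\{\gamma_\nu\}_{\nu<\lambda}$ in $\{v(X-c)\mid c\in\overline{K}\}$ ($\lambda$ a limit ordinal) and $a_\nu\in\overline{K}$ with $v(X-a_\nu)=\gamma_\nu$; then $\{a_\nu\}$ is a pCs. $(K(X)|K,v)$ is valuation algebraic of type I if $\{a_\nu\}$ is of transcendental type in $(\overline{\widehat{K}},v)$, and of type II otherwise (independent of the choices). *)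

theory Defs
  imports
    "HOL-Algebra.Algebraic_Closure_Type"
    "HOL-Algebra.Generated_Fields"
    "HOL-Library.Extended"
    "HOL-Library.Poly_Mapping"
begin

(* X is used as a variable below *)
no_notation var (\<open>X\<index>\<close>)

section \<open>Valued fields\<close>

text \<open>
  The ambient field is a type \<open>'a\<close> of class \<^class>\<open>field\<close>, regarded as the
  HOL-Algebra structure \<open>\<Omega>\<close>; its subfields are carrier sets.
  The abstract extensions in the definition of the completion need not live inside \<open>'a\<close>, so the
  basic notions are stated for arbitrary ring structures.
\<close>

abbreviation Amb :: "'a::field ring"  (\<open>\<Omega>\<close>)
  where "\<Omega> \<equiv> ring_of_type_algebra"

text \<open>
  Krull valuations, written additively. The element \<^const>\<open>Pinf\<close> of
  \<^typ>\<open>'g extended\<close> is the value of zero; \<^const>\<open>Minf\<close> is never attained.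
\<close>

definition valuation ::
    "('a, 'm) ring_scheme \<Rightarrow> ('a \<Rightarrow> 'g::linordered_ab_group_add extended) \<Rightarrow> bool"
  where "valuation R v \<longleftrightarrow>
    (\<forall>x\<in>carrier R. v x \<noteq> Minf \<and> (v x = Pinf \<longleftrightarrow> x = \<zero>\<^bsub>R\<^esub>)) \<and>
    (\<forall>x\<in>carrier R. \<forall>y\<in>carrier R.
       v (x \<otimes>\<^bsub>R\<^esub> y) = v x + v y \<and> min (v x) (v y) \<le> v (x \<oplus>\<^bsub>R\<^esub> y))"

definition value_group :: "('a \<Rightarrow> 'g extended) \<Rightarrow> 'a set \<Rightarrow> 'g set"
  where "value_group v L = {\<gamma>. Fin \<gamma> \<in> v ` L}"

definition dense_in ::
    "('a, 'm) ring_scheme \<Rightarrow> ('a \<Rightarrow> 'g::linordered_ab_group_add extended) \<Rightarrow>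
     'a set \<Rightarrow> 'a set \<Rightarrow> bool"
  where "dense_in R v K L \<longleftrightarrow>
    (\<forall>a\<in>L. \<forall>\<gamma>\<in>value_group v L. \<exists>b\<in>K. Fin \<gamma> < v (a \<ominus>\<^bsub>R\<^esub> b))"

text \<open>
  \<open>Khat\<close> is a maximal extension of \<open>K\<close> in which \<open>K\<close> is dense.
  Maximality ranges over all valued fields \<open>(L, w)\<close> with a valuation preserving embedding
  \<open>\<phi>\<close> of \<open>Khat\<close> such that the image of \<open>K\<close> is dense. Restricting to carriers in the type
  \<^typ>\<open>'a set\<close> and values in \<^typ>\<open>'g\<close> loses nothing:
  density forces the value group of \<open>L\<close> to equal that of \<open>K\<close>, and an element \<open>x\<close> of \<open>L\<close> is
  determined by the set of pairs \<open>(b, c)\<close> of elements of \<open>K\<close> with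
  \<open>v c < w (x - \<phi> b)\<close>, so \<open>L\<close> has at most as many elements as there are subsets of
  \<open>K \<times> K\<close> (and \<open>L = \<phi> K\<close> if \<open>K\<close> is finite, its valuation being trivial).
\<close>

definition is_completion ::
    "('a::field \<Rightarrow> 'g::linordered_ab_group_add extended) \<Rightarrow> 'a set \<Rightarrow> 'a set \<Rightarrow> bool"
  where "is_completion v K Khat \<longleftrightarrow>
    subfield K \<Omega> \<and> subfield Khat \<Omega> \<and> K \<subseteq> Khat \<and> dense_in \<Omega> v K Khat \<and>
    (\<forall>(L :: 'a set ring) (w :: 'a set \<Rightarrow> 'g extended) \<phi>.
       field L \<and> valuation L w \<and>
       \<phi> \<in> ring_hom (\<Omega>\<lparr>carrier := Khat\<rparr>) L \<and> (\<forall>x\<in>Khat. w (\<phi> x) = v x) \<and>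
       dense_in L w (\<phi> ` K) (carrier L)
       \<longrightarrow> \<phi> ` Khat = carrier L)"


section \<open>Henselization and implicit constant field\<close>

definition alg_cl :: "'a::field set \<Rightarrow> 'a set"
  where "alg_cl F = {y. \<not> ring.transcendental \<Omega> F y}"

abbreviation adjoin :: "'a::field set \<Rightarrow> 'a \<Rightarrow> 'a set"
  where "adjoin F X \<equiv> generate_field \<Omega> (insert X F)"

definition poly_over :: "'a::field set \<Rightarrow> 'a poly \<Rightarrow> bool"
  where "poly_over F f \<longleftrightarrow> (\<forall>i. coeff f i \<in> F)"

text \<open>A valued field is henselian if it satisfies Hensel's Lemma.\<close>

definition henselian ::
    "('a::field \<Rightarrow> 'g::linordered_ab_group_add extended) \<Rightarrow> 'a set \<Rightarrow> bool"
  where "henselian v L \<longleftrightarrow>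
    (\<forall>f a. poly_over {x\<in>L. 0 \<le> v x} f \<and> a \<in> L \<and> 0 \<le> v a \<and>
           0 < v (poly f a) \<and> v (poly (pderiv f) a) = 0
       \<longrightarrow> (\<exists>b\<in>L. poly f b = 0 \<and> 0 < v (b - a)))"

text \<open>
  The henselization of \<open>F\<close> inside its algebraic closure, with respect to the valuation given
  there: the least henselian field between the two. (The root provided by Hensel's Lemma
  is unique, so an intersection of henselian fields is again henselian.)
\<close>

definition henselization ::
    "('a::field \<Rightarrow> 'g::linordered_ab_group_add extended) \<Rightarrow> 'a set \<Rightarrow> 'a set"
  where "henselization v F =
    \<Inter> {L. subfield L \<Omega> \<and> F \<subseteq> L \<and> L \<subseteq> alg_cl F \<and> henselian v L}"

definition IC ::
    "('a::field \<Rightarrow> 'g::linordered_ab_group_add extended) \<Rightarrow> 'a set \<Rightarrow> 'a \<Rightarrow> 'a set"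
  where "IC v F X = alg_cl F \<inter> henselization v (adjoin F X)"


section \<open>Value transcendental extensions\<close>

text \<open>
  For an abelian group \<open>A\<close> (written as a monoid structure), the rational vector space
  \<open>A \<otimes> \<rat>\<close> is the free one on the symbols \<open>a \<otimes> 1\<close>, \<open>a \<in> A\<close>,
  modulo the subspace generated by the additivity relations in \<open>a\<close>.
\<close>

definition rat_scale :: "rat \<Rightarrow> ('b \<Rightarrow>\<^sub>0 rat) \<Rightarrow> ('b \<Rightarrow>\<^sub>0 rat)"
  where "rat_scale q = Poly_Mapping.map ((*) q)"

lemma vector_space_rat_scale: "vector_space rat_scale"
proof
  have l: "Poly_Mapping.lookup (rat_scale q p) k = q * Poly_Mapping.lookup p k"
    for q and p :: "'b \<Rightarrow>\<^sub>0 rat" and k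
    by (simp add: rat_scale_def Poly_Mapping.map.rep_eq when_def)
  fix q q' :: rat and p p' :: "'b \<Rightarrow>\<^sub>0 rat"
  show "rat_scale q (p + p') = rat_scale q p + rat_scale q p'"
    "rat_scale (q + q') p = rat_scale q p + rat_scale q' p"
    "rat_scale q (rat_scale q' p) = rat_scale (q * q') p"
    "rat_scale 1 p = p"
    by (auto intro!: poly_mapping_eqI simp: l lookup_add algebra_simps)
qed

definition tensor_gens :: "('b, 'm) monoid_scheme \<Rightarrow> ('b \<Rightarrow>\<^sub>0 rat) set"
  where "tensor_gens A = (\<lambda>a. Poly_Mapping.single a 1) ` carrier A"

definition tensor_rels :: "('b, 'm) monoid_scheme \<Rightarrow> ('b \<Rightarrow>\<^sub>0 rat) set"
  where "tensor_rels A =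
    {Poly_Mapping.single (a \<otimes>\<^bsub>A\<^esub> b) 1 - Poly_Mapping.single a 1 - Poly_Mapping.single b 1
      | a b. a \<in> carrier A \<and> b \<in> carrier A}"

text \<open>
  \<open>A \<otimes> \<rat>\<close> has dimension \<open>n\<close>: some \<open>n\<close> vectors form a basis modulo the relations.
\<close>

definition tensor_rat_dim :: "('b, 'm) monoid_scheme \<Rightarrow> nat \<Rightarrow> bool"
  where "tensor_rat_dim A n \<longleftrightarrow>
    (\<exists>B \<subseteq> module.span rat_scale (tensor_gens A).
       finite B \<and> card B = n \<and>
       tensor_gens A \<subseteq> module.span rat_scale (B \<union> tensor_rels A) \<and>
       (\<forall>c. (\<Sum>b\<in>B. rat_scale (c b) b) \<in> module.span rat_scale (tensor_rels A)
          \<longrightarrow> (\<forall>b\<in>B. c b = 0)))"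

definition value_group_monoid :: "('a \<Rightarrow> 'g::ab_group_add extended) \<Rightarrow> 'a set \<Rightarrow> 'g monoid"
  where "value_group_monoid v L = \<lparr>carrier = value_group v L, monoid.mult = (+), one = 0\<rparr>"

definition value_transcendental ::
    "('a::field \<Rightarrow> 'g::linordered_ab_group_add extended) \<Rightarrow> 'a set \<Rightarrow> 'a \<Rightarrow> bool"
  where "value_transcendental v K X \<longleftrightarrow>
    tensor_rat_dim (value_group_monoid v (adjoin K X) Mod value_group v K) 1"


section \<open>Residue transcendental extensions\<close>

definition val_ring :: "('a::field \<Rightarrow> 'g::linordered_ab_group_add extended) \<Rightarrow> 'a set \<Rightarrow> 'a ring"
  where "val_ring v L = \<Omega>\<lparr>carrier := {x\<in>L. 0 \<le> v x}\<rparr>"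

definition max_ideal :: "('a::field \<Rightarrow> 'g::linordered_ab_group_add extended) \<Rightarrow> 'a set \<Rightarrow> 'a set"
  where "max_ideal v L = {x\<in>L. 0 < v x}"

definition residue_field ::
    "('a::field \<Rightarrow> 'g::linordered_ab_group_add extended) \<Rightarrow> 'a set \<Rightarrow> 'a set ring"
  where "residue_field v L = val_ring v L Quot max_ideal v L"

text \<open>The residue field of a subfield \<open>K\<close> of \<open>L\<close>, as a subfield of the residue field of \<open>L\<close>.\<close>

definition residue_subfield ::
    "('a::field \<Rightarrow> 'g::linordered_ab_group_add extended) \<Rightarrow> 'a set \<Rightarrow> 'a set \<Rightarrow> 'a set set"
  where "residue_subfield v L K =
    (\<lambda>x. max_ideal v L +>\<^bsub>val_ring v L\<^esub> x) ` {x\<in>K. 0 \<le> v x}"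

text \<open>Transcendence degree one: there is a transcendence basis with a single element.\<close>

definition trdeg_one :: "('b, 'm) ring_scheme \<Rightarrow> 'b set \<Rightarrow> bool"
  where "trdeg_one R k \<longleftrightarrow>
    (\<exists>t\<in>carrier R. ring.transcendental R k t \<and>
       (\<forall>y\<in>carrier R. \<not> ring.transcendental R (generate_field R (insert t k)) y))"

definition residue_transcendental ::
    "('a::field \<Rightarrow> 'g::linordered_ab_group_add extended) \<Rightarrow> 'a set \<Rightarrow> 'a \<Rightarrow> bool"
  where "residue_transcendental v K X \<longleftrightarrow>
    trdeg_one (residue_field v (adjoin K X)) (residue_subfield v (adjoin K X) K)"


section \<open>Valuation algebraic extensions\<close>

definition valuation_algebraic ::
    "('a::field \<Rightarrow> 'g::linordered_ab_group_add extended) \<Rightarrow> 'a set \<Rightarrow> 'a \<Rightarrow> bool"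
  where "valuation_algebraic v K X \<longleftrightarrow>
    \<not> (value_transcendental v K X \<or> residue_transcendental v K X)"

text \<open>
  Sequences indexed by a limit ordinal are families indexed by the field of a nonempty
  well-order without last element.
\<close>

definition limit_order :: "'i rel \<Rightarrow> bool"
  where "limit_order r \<longleftrightarrow> Well_order r \<and> Field r \<noteq> {} \<and>
    (\<forall>i\<in>Field r. \<exists>j. (i, j) \<in> r \<and> i \<noteq> j)"

definition pseudo_cauchy ::
    "'i rel \<Rightarrow> ('a::field \<Rightarrow> 'g::linordered_ab_group_add extended) \<Rightarrow> 'a set \<Rightarrow> ('i \<Rightarrow> 'a) \<Rightarrow> bool"
  where "pseudo_cauchy r v F z \<longleftrightarrow>
    limit_order r \<and> (\<forall>i\<in>Field r. z i \<in> F) \<and>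
    (\<forall>i j k. (i, j) \<in> r \<and> i \<noteq> j \<and> (j, k) \<in> r \<and> j \<noteq> k \<longrightarrow> v (z i - z j) < v (z j - z k))"

definition transcendental_type ::
    "'i rel \<Rightarrow> ('a::field \<Rightarrow> 'g::linordered_ab_group_add extended) \<Rightarrow> 'a set \<Rightarrow> ('i \<Rightarrow> 'a) \<Rightarrow> bool"
  where "transcendental_type r v F z \<longleftrightarrow>
    pseudo_cauchy r v F z \<and>
    (\<forall>h. poly_over F h \<longrightarrow>
       (\<exists>i\<in>Field r. \<forall>j. (i, j) \<in> r \<longrightarrow> v (poly h (z j)) = v (poly h (z i))))"

text \<open>
  A choice of elements \<open>a i\<close> in the algebraic closure of \<open>K\<close> such that the values
  \<open>v (X - a i)\<close> are strictly increasing and cofinal among all values \<open>v (X - c)\<close>.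
\<close>

definition approximating ::
    "'i rel \<Rightarrow> ('a::field \<Rightarrow> 'g::linordered_ab_group_add extended) \<Rightarrow> 'a set \<Rightarrow> 'a \<Rightarrow>
     ('i \<Rightarrow> 'a) \<Rightarrow> bool"
  where "approximating r v K X a \<longleftrightarrow>
    limit_order r \<and> (\<forall>i\<in>Field r. a i \<in> alg_cl K) \<and>
    (\<forall>i j. (i, j) \<in> r \<and> i \<noteq> j \<longrightarrow> v (X - a i) < v (X - a j)) \<and>
    (\<forall>c\<in>alg_cl K. \<exists>i\<in>Field r. v (X - c) \<le> v (X - a i))"

text \<open>
  Since \<open>X\<close> is transcendental, the values \<open>v (X - a i)\<close> are finite, so strictly increasing
  families of such values can always be indexed by well-orders on subsets of \<^typ>\<open>'g\<close>.
\<close>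

definition valuation_algebraic_type_I ::
    "('a::field \<Rightarrow> 'g::linordered_ab_group_add extended) \<Rightarrow> 'a set \<Rightarrow> 'a set \<Rightarrow> 'a \<Rightarrow> bool"
  where "valuation_algebraic_type_I v K Khat X \<longleftrightarrow>
    valuation_algebraic v K X \<and>
    (\<exists>(r :: 'g rel) a. approximating r v K X a \<and> transcendental_type r v (alg_cl Khat) a)"

definition valuation_algebraic_type_II ::
    "('a::field \<Rightarrow> 'g::linordered_ab_group_add extended) \<Rightarrow> 'a set \<Rightarrow> 'a set \<Rightarrow> 'a \<Rightarrow> bool"
  where "valuation_algebraic_type_II v K Khat X \<longleftrightarrow>
    valuation_algebraic v K X \<and> \<not> valuation_algebraic_type_I v K Khat X"

end

theory Submission
  imports Defs
begin

text \<open>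
  Write \<open>F\<close> for the completion, \<open>C\<close> for its algebraic closure and \<open>G\<^sup>h\<close> for the henselization of
  \<open>G\<close>. Up to a power of Frobenius, an element \<open>b\<close> of \<open>C \<inter> F(X)\<^sup>h\<close> is a simple root of a polynomial over
  \<open>F\<close>. A nearby polynomial over \<open>K\<close> has a root \<open>b0\<close> close to \<open>b\<close>, and Krasner's Lemma puts \<open>b0\<close> into
  \<open>F(X)\<^sup>h\<close> and \<open>b\<close> into the compositum of \<open>F\<^sup>h\<close> and \<open>K(b0)\<close>. It remains to see that \<open>K(X)\<^sup>h\<close> approximates
  \<open>b0\<close> up to every value in \<open>vK\<close>, for then \<open>b0\<close> lies in \<open>K(X)\<^sup>h\<close>, again by Krasner. If \<open>vK\<close> is cofinal in
  \<open>vF(X)\<close>, this holds because the elements that \<open>K(X)\<^sup>h\<close> approximates form a henselian field containing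
  \<open>F(X)\<close>. Otherwise \<open>X\<close> or its inverse is infinitesimally close to an element of \<open>C\<close>, and one applies
  the same argument to the residues modulo infinitesimals, which form a subfield of \<open>C\<close>. All of this
  determines elements only up to purely inseparable extensions; these are removed at the end, since
  henselizations are separable.
\<close>

text \<open>The henselization is available only as the least henselian field. So every upper bound
  for it comes from exhibiting a henselian field above the ground field: a closure with respect to
  the valuation, or a maximal field avoiding a given element. Membership goes through the equality
  of values of conjugates over a henselian field: an element that is alone among its conjugates in a
  ball has no other conjugate, hence is purely inseparable.

  The detour through b0 is forced: an element of the completion may be transcendental over K, so
  Krasner's Lemma over the henselization of K(X) cannot be applied to b itself.

  Density controls precision only up to the values of K. Unless v is trivial on K (and then F = K),
  these are cofinal in the values of the algebraic closure of F, but not always in those of F(X).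
  This is the origin of the case distinction and of the notion \<open>small\<close> of an
  infinitesimal.

  Conjugacy is expressed by polynomials, and automorphisms are replaced by embeddings defined on
  finitely many prescribed elements.\<close>

lemma Amb_simps [simp]:
  "carrier (\<Omega> :: 'a::field ring) = UNIV" "x \<otimes>\<^bsub>\<Omega>\<^esub> y = x * y" "x \<oplus>\<^bsub>\<Omega>\<^esub> y = x + y"
  "\<one>\<^bsub>\<Omega>\<^esub> = (1 :: 'a)" "\<zero>\<^bsub>\<Omega>\<^esub> = (0 :: 'a)"
  by (simp_all add: ring_of_type_algebra_def)

lemma Amb_field: "Ring.field (\<Omega> :: 'a::field ring)"
  and Amb_domain: "Ring.domain (\<Omega> :: 'a::field ring)"
  and Amb_cring: "Ring.cring (\<Omega> :: 'a::field ring)"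
  and Amb_ring: "Ring.ring (\<Omega> :: 'a::field ring)"
  using field_from_type_algebra Ring.field.axioms(1) domain.axioms(1) cring.axioms(1) by blast+

lemma Amb_uminus [simp]: "\<ominus>\<^bsub>\<Omega>\<^esub> x = - (x :: 'a::field)"
  by (rule abelian_group.minus_equality[OF ring.is_abelian_group[OF Amb_ring]]) auto

lemma Amb_minus [simp]: "x \<ominus>\<^bsub>\<Omega>\<^esub> y = x - (y :: 'a::field)"
  by (simp add: a_minus_def)

lemma Amb_inv [simp]: "x \<noteq> 0 \<Longrightarrow> inv\<^bsub>\<Omega>\<^esub> x = inverse (x :: 'a::field)"
  by (rule comm_monoid.comm_inv_char[OF cring.axioms(2)[OF Amb_cring]]) auto

section \<open>Subfields of the ambient field and generated subfields\<close>

lemma subfieldI_Amb: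
  fixes K :: "'a::field set"
  assumes "1 \<in> K" "\<And>x y. x \<in> K \<Longrightarrow> y \<in> K \<Longrightarrow> x - y \<in> K"
    "\<And>x y. x \<in> K \<Longrightarrow> y \<in> K \<Longrightarrow> x * y \<in> K" "\<And>x. x \<in> K \<Longrightarrow> x \<noteq> 0 \<Longrightarrow> inverse x \<in> K"
  shows "subfield K \<Omega>"
proof -
  have z: "0 \<in> K" using assms(2)[OF assms(1,1)] by simp
  have m: "- x \<in> K" if "x \<in> K" for x using assms(2)[OF z that] by simp
  have p: "x + y \<in> K" if "x \<in> K" "y \<in> K" for x y using assms(2)[OF that(1) m[OF that(2)]] by simp
  show ?thesis
    by (intro field.subfieldI'[OF Amb_field] ring.subringI[OF Amb_ring]) (auto simp: assms m p)
qed

lemma subfield_closed: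
  fixes K :: "'a::field set"
  assumes "subfield K \<Omega>"
  shows subfield_0: "0 \<in> K" and subfield_1: "1 \<in> K"
    and subfield_add: "x \<in> K \<Longrightarrow> y \<in> K \<Longrightarrow> x + y \<in> K"
    and subfield_minus: "x \<in> K \<Longrightarrow> - x \<in> K"
    and subfield_diff: "x \<in> K \<Longrightarrow> y \<in> K \<Longrightarrow> x - y \<in> K"
    and subfield_mult: "x \<in> K \<Longrightarrow> y \<in> K \<Longrightarrow> x * y \<in> K"
    and subfield_inverse: "x \<in> K \<Longrightarrow> inverse x \<in> K"
    and subfield_divide: "x \<in> K \<Longrightarrow> y \<in> K \<Longrightarrow> x / y \<in> K"
    and subfield_power: "x \<in> K \<Longrightarrow> x ^ n \<in> K"
    and subfield_of_nat: "of_nat n \<in> K"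
proof -
  note r = subringE[OF subfieldE(1)[OF assms]]
  show z: "0 \<in> K" and o: "1 \<in> K" using r by auto
  show a: "x \<in> K \<Longrightarrow> y \<in> K \<Longrightarrow> x + y \<in> K" for x y using r(7)[of x y] by simp
  show m: "x \<in> K \<Longrightarrow> - x \<in> K" for x using r(5)[of x] by simp
  show "x \<in> K \<Longrightarrow> y \<in> K \<Longrightarrow> x - y \<in> K" using a[OF _ m, of x y] by simp
  show t: "x \<in> K \<Longrightarrow> y \<in> K \<Longrightarrow> x * y \<in> K" for x y using r(6)[of x y] by simp
  show i: "x \<in> K \<Longrightarrow> inverse x \<in> K" for x
    using ring.subfield_m_inv(1)[OF Amb_ring assms, of x] z by (cases "x = 0") auto
  show "x \<in> K \<Longrightarrow> y \<in> K \<Longrightarrow> x / y \<in> K" using t[OF _ i] by (simp add: divide_inverse)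
  show "x \<in> K \<Longrightarrow> x ^ n \<in> K" by (induction n) (auto intro: o t)
  show "of_nat n \<in> K" by (induction n) (auto intro: o z a)
qed

lemma subfield_sum:
  "subfield K \<Omega> \<Longrightarrow> (\<And>i. i \<in> I \<Longrightarrow> f i \<in> K) \<Longrightarrow> sum f I \<in> (K :: 'a::field set)"
  by (induction I rule: infinite_finite_induct) (auto intro: subfield_closed)

lemma subfield_UNIV: "subfield (UNIV :: 'a::field set) \<Omega>"
  by (rule subfieldI_Amb) auto

lemma subfield_Inter:
  fixes S :: "'a::field set set"
  assumes "\<And>K. K \<in> S \<Longrightarrow> subfield K \<Omega>"
  shows "subfield (\<Inter>S) \<Omega>"
  using assms by (intro subfieldI_Amb) (auto intro: subfield_closed)

lemma subfield_Int:
  fixes K L :: "'a::field set"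
  assumes "subfield K \<Omega>" "subfield L \<Omega>"
  shows "subfield (K \<inter> L) \<Omega>"
  using subfield_Inter[of "{K, L}"] assms by auto

abbreviation gen :: "'a::field set \<Rightarrow> 'a set" where "gen \<equiv> generate_field \<Omega>"

lemma subfield_gen: "subfield (gen S) \<Omega>"
  by (rule field.generate_field_is_subfield[OF Amb_field]) simp

lemma subset_gen: "S \<subseteq> gen S"
  by (auto intro: generate_field.incl)

lemma gen_least: "subfield L \<Omega> \<Longrightarrow> S \<subseteq> L \<Longrightarrow> gen S \<subseteq> L"
  by (rule field.generate_field_min_subfield1[OF Amb_field]) auto

lemma gen_mono: "S \<subseteq> T \<Longrightarrow> gen S \<subseteq> gen T"
  by (meson gen_least subfield_gen subset_gen subset_trans)

lemma X_in_adjoin: "X \<in> adjoin K X" and subset_adjoin: "K \<subseteq> adjoin K X"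
  using subset_gen[of "insert X K"] by auto

lemma adjoin_least: "subfield L \<Omega> \<Longrightarrow> K \<subseteq> L \<Longrightarrow> X \<in> L \<Longrightarrow> adjoin K X \<subseteq> L"
  by (intro gen_least) auto

lemma adjoin_mono: "K \<subseteq> L \<Longrightarrow> adjoin K X \<subseteq> adjoin L X"
  by (intro gen_mono) auto

section \<open>Polynomials over a subfield\<close>

context
  fixes K :: "'a::field set"
  assumes K: "subfield K \<Omega>"
begin

lemma poly_over_0 [simp]: "poly_over K 0" and poly_over_1 [simp]: "poly_over K 1"
  by (auto simp: poly_over_def coeff_1 subfield_closed[OF K])

lemma poly_over_pCons [simp]: "poly_over K (pCons a p) \<longleftrightarrow> a \<in> K \<and> poly_over K p"
  unfolding poly_over_def by (metis coeff_pCons_0 coeff_pCons_Suc not0_implies_Suc)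

lemma poly_over_add: "poly_over K p \<Longrightarrow> poly_over K q \<Longrightarrow> poly_over K (p + q)"
  and poly_over_diff: "poly_over K p \<Longrightarrow> poly_over K q \<Longrightarrow> poly_over K (p - q)"
  and poly_over_minus: "poly_over K p \<Longrightarrow> poly_over K (- p)"
  and poly_over_smult: "a \<in> K \<Longrightarrow> poly_over K p \<Longrightarrow> poly_over K (smult a p)"
  and poly_over_mult: "poly_over K p \<Longrightarrow> poly_over K q \<Longrightarrow> poly_over K (p * q)"
  and poly_over_pderiv: "poly_over K p \<Longrightarrow> poly_over K (pderiv p)"
  by (auto simp: poly_over_def coeff_mult coeff_pderiv
      intro!: subfield_sum[OF K] subfield_closed[OF K] simp del: of_nat_Suc)

lemma poly_over_power: "poly_over K p \<Longrightarrow> poly_over K (p ^ n)"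
  by (induction n) (auto intro: poly_over_mult)

lemma poly_over_pcompose: "poly_over K p \<Longrightarrow> poly_over K q \<Longrightarrow> poly_over K (pcompose p q)"
  by (induction p) (auto simp: pcompose_pCons intro!: poly_over_add poly_over_mult)

lemma poly_closed: "poly_over K p \<Longrightarrow> a \<in> K \<Longrightarrow> poly p a \<in> K"
  by (induction p) (auto intro: subfield_closed[OF K])

text \<open>Induction on the dividend performs long division one coefficient at a time, which shows
  that quotient and remainder stay over \<open>K\<close>.\<close>

lemma poly_over_division:
  assumes "poly_over K g" "poly_over K p" "g \<noteq> 0"
  obtains s r where "poly_over K s" "poly_over K r" "p = s * g + r"
    "r = 0 \<or> Polynomial.degree r < Polynomial.degree g"
proof -
  have "\<exists>s r. poly_over K s \<and> poly_over K r \<and> p = s * g + r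
    \<and> (r = 0 \<or> Polynomial.degree r < Polynomial.degree g)" using assms(2)
  proof (induction p)
    case 0
    then show ?case by (intro exI[of _ 0]) auto
  next
    case (pCons a p)
    then obtain s r where sr: "poly_over K s" "poly_over K r" "p = s * g + r"
      "r = 0 \<or> Polynomial.degree r < Polynomial.degree g" and a: "a \<in> K" by auto
    \<comment> \<open>\<open>c\<close> is 0 unless the shifted remainder has reached the degree of
      \<open>g\<close>.\<close>
    define c where "c = coeff (pCons a r) (Polynomial.degree g) / coeff g (Polynomial.degree g)"
    have c: "c \<in> K" unfolding c_def
      using sr(2) a assms(1)
      by (intro subfield_divide[OF K]) (use poly_over_pCons[of a r] in \<open>auto simp: poly_over_def\<close>)
    define r' where "r' = pCons a r - smult c g"
    have 1: "pCons a p = pCons c s * g + r'"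
      by (simp add: sr(3) r'_def algebra_simps)
    have d: "Polynomial.degree (pCons a r) \<le> Polynomial.degree g"
      using sr(4) by (cases "r = 0") auto
    have "Polynomial.degree r' \<le> Polynomial.degree g" unfolding r'_def
      by (intro degree_diff_le) (use d in \<open>auto intro: degree_smult_le\<close>)
    moreover have "coeff r' (Polynomial.degree g) = 0"
      using assms(3) by (simp add: r'_def c_def)
    ultimately have "r' = 0 \<or> Polynomial.degree r' < Polynomial.degree g"
      by (metis le_neq_implies_less leading_coeff_0_iff)
    moreover have "poly_over K r'" "poly_over K (pCons c s)"
      unfolding r'_def using c sr a assms(1)
      by (auto intro!: poly_over_diff poly_over_smult)
    ultimately show ?case using 1 by blast
  qed
  then show ?thesis using that by blast
qed

end

lemma poly_over_mono: "poly_over K p \<Longrightarrow> K \<subseteq> L \<Longrightarrow> poly_over L p"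
  by (auto simp: poly_over_def)

section \<open>Algebraic elements\<close>

text \<open>HOL-Algebra lists coefficients from the leading one downwards, \<open>Poly\<close> from
  the constant one upwards; hence the reversal.\<close>

lemma Polynomials_eval_eq_poly:
  "ring.eval \<Omega> xs x = poly (Poly (rev xs)) (x :: 'a::field)"
proof (induction xs)
  case (Cons a xs)
  have p: "x [^]\<^bsub>\<Omega>\<^esub> n = x ^ n" for n :: nat and x :: 'a
    by (induction n) (auto simp: mult.commute)
  show ?case using Cons by (simp add: p ring.eval.simps[OF Amb_ring] Poly_append poly_monom mult.commute)
qed (simp add: ring.eval.simps[OF Amb_ring])

lemma transcendental_iff_poly:
  fixes K :: "'a::field set"
  assumes K: "subfield K \<Omega>"
  shows "ring.transcendental \<Omega> K x \<longleftrightarrow> (\<forall>p. poly_over K p \<longrightarrow> poly p x = 0 \<longrightarrow> p = 0)"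
proof
  assume t: "ring.transcendental \<Omega> K x"
  show "\<forall>p. poly_over K p \<longrightarrow> poly p x = 0 \<longrightarrow> p = 0"
  proof (intro allI impI)
    fix p assume p: "poly_over K p" "poly p x = 0"
    have "rev (coeffs p) \<in> carrier (univ_poly \<Omega> K)"
      using p(1) subfield_0[OF K]
      by (cases "p = 0") (auto simp: univ_poly_def polynomial_def hd_rev last_coeffs_eq_coeff_degree coeffs_def
          poly_over_def)
    moreover have "ring.eval \<Omega> (rev (coeffs p)) x = \<zero>\<^bsub>\<Omega>\<^esub>"
      using p(2) by (simp add: Polynomials_eval_eq_poly)
    ultimately have "rev (coeffs p) = []"
      using ring.eval_transcendental[OF Amb_ring, of K x "rev (coeffs p)"] t by (simp add: over_def)
    then show "p = 0" by simp
  qed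
next
  assume *: "\<forall>p. poly_over K p \<longrightarrow> poly p x = 0 \<longrightarrow> p = 0"
  show "ring.transcendental \<Omega> K x"
  proof (rule ccontr)
    assume "\<not> ring.transcendental \<Omega> K x"
    then obtain xs where xs: "xs \<in> carrier (univ_poly \<Omega> K)" "xs \<noteq> []" "ring.eval \<Omega> xs x = 0"
      using domain.algebraicE[OF Amb_domain subfieldE(1)[OF K], of x] by (auto simp: over_def)
    have l: "hd xs \<noteq> 0" "set xs \<subseteq> K" using xs by (auto simp: univ_poly_def polynomial_def)
    have "Poly (rev xs) = 0"
      using * xs(3) l(2) subfield_0[OF K]
      by (auto simp: Polynomials_eval_eq_poly poly_over_def coeff_Poly_eq nth_default_def rev_nth subset_iff)
    then have "coeff (Poly (rev xs)) (length xs - 1) = 0" by simp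
    then show False using l(1) xs(2)
      by (auto simp: coeff_Poly_eq nth_default_def rev_nth hd_conv_nth split: if_splits)
  qed
qed

lemma alg_cl_iff:
  fixes K :: "'a::field set"
  assumes "subfield K \<Omega>"
  shows "x \<in> alg_cl K \<longleftrightarrow> (\<exists>p. poly_over K p \<and> p \<noteq> 0 \<and> poly p x = 0)"
  using transcendental_iff_poly[OF assms, of x] by (auto simp: alg_cl_def)

lemma subfield_alg_cl: "subfield K \<Omega> \<Longrightarrow> subfield (alg_cl K) \<Omega>"
  using field.subfield_of_algebraics[OF Amb_field, of K] by (simp add: alg_cl_def over_def)

lemma subset_alg_cl: "subfield K \<Omega> \<Longrightarrow> K \<subseteq> alg_cl K"
  using domain.algebraic_self[OF Amb_domain subfieldE(1)] by (auto simp: alg_cl_def over_def)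

lemma alg_cl_mono: "K \<subseteq> L \<Longrightarrow> alg_cl K \<subseteq> alg_cl L"
  using ring.transcendental_mono[OF Amb_ring, of K L] by (auto simp: alg_cl_def over_def)

text \<open>The coefficients of an annihilating polynomial generate a finite extension
  \<open>E\<close> of \<open>K\<close>, and \<open>y\<close> generates a finite extension of
  \<open>E\<close>; the tower law makes the latter finite over \<open>K\<close>.\<close>

lemma alg_cl_alg_cl:
  fixes K :: "'a::field set"
  assumes K: "subfield K \<Omega>"
  shows "alg_cl (alg_cl K) = alg_cl K"
proof
  note C = subfield_alg_cl[OF K]
  show "alg_cl K \<subseteq> alg_cl (alg_cl K)" by (rule subset_alg_cl[OF C])
  show "alg_cl (alg_cl K) \<subseteq> alg_cl K"
  proof
    fix y assume "y \<in> alg_cl (alg_cl K)"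
    then obtain p where p: "poly_over (alg_cl K) p" "p \<noteq> 0" "poly p y = 0"
      using alg_cl_iff[OF C] by blast
    define E where "E = ring.finite_extension \<Omega> K (coeffs p)"
    have a: "(ring.algebraic \<Omega> over K) x" if "x \<in> set (coeffs p)" for x
      using that p(1) subfield_0[OF C] by (auto simp: coeffs_def poly_over_def alg_cl_def over_def split: if_splits)
    have E: "subfield E \<Omega>" unfolding E_def
      using domain.finite_extension_is_subfield[OF Amb_domain K, of "coeffs p"] a by simp
    have "set (coeffs p) \<subseteq> E" unfolding E_def
      using domain.finite_extension_mem[OF Amb_domain subfieldE(1)[OF K], of "coeffs p"] by auto
    then have "coeff p i \<in> E" for i
      using subfield_0[OF E] p(2) coeff_in_coeffs[of p i]
      by (cases "i \<le> Polynomial.degree p") (auto simp: coeff_eq_0)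
    then have "y \<in> alg_cl E" using p alg_cl_iff[OF E] unfolding poly_over_def by blast
    then have yE: "(ring.algebraic \<Omega> over E) y" by (simp add: alg_cl_def over_def)
    have fE: "ring.finite_dimension \<Omega> K E" unfolding E_def
      using domain.finite_extension_finite_dimension(1)[OF Amb_domain K, of "coeffs p"] a by simp
    let ?S = "ring.simple_extension \<Omega> E y"
    have fS: "ring.finite_dimension \<Omega> E ?S"
      using domain.finite_dimension_simple_extension[OF Amb_domain E, of y] yE by simp
    have "ring.finite_dimension \<Omega> K ?S"
      by (rule ring.telescopic_base_dim(1)[OF Amb_ring K E fE fS])
    moreover have "subring ?S \<Omega>" "y \<in> ?S"
      using domain.simple_extension_is_subring[OF Amb_domain subfieldE(1)[OF E], of y]
        ring.simple_extension_mem[OF Amb_ring subfieldE(1)[OF E], of y] by auto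
    ultimately show "y \<in> alg_cl K"
      using ring.finite_dimension_imp_algebraic[OF Amb_ring K] by (auto simp: alg_cl_def over_def)
  qed
qed

lemma alg_cl_root:
  fixes K :: "'a::field set"
  assumes "subfield K \<Omega>" "poly_over (alg_cl K) p" "p \<noteq> 0" "poly p y = 0"
  shows "y \<in> alg_cl K"
  using alg_cl_iff[OF subfield_alg_cl[OF assms(1)], of y] alg_cl_alg_cl[OF assms(1)] assms by auto

definition is_minpoly :: "'a::field set \<Rightarrow> 'a \<Rightarrow> 'a poly \<Rightarrow> bool"
  where "is_minpoly L y g \<longleftrightarrow> poly_over L g \<and> Polynomial.lead_coeff g = 1 \<and> poly g y = 0 \<and>
    (\<forall>p. poly_over L p \<longrightarrow> p \<noteq> 0 \<longrightarrow> poly p y = 0 \<longrightarrow> Polynomial.degree g \<le> Polynomial.degree p)"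

text \<open>Phrased by vanishing polynomials, so that no automorphism has to be constructed. For
  algebraic \<open>y\<close> the conjugates are the roots of the minimal polynomial, and the
  relation is symmetric on them.\<close>

definition conjugate :: "'a::field set \<Rightarrow> 'a \<Rightarrow> 'a \<Rightarrow> bool"
  where "conjugate L y z \<longleftrightarrow> (\<forall>p. poly_over L p \<longrightarrow> poly p y = 0 \<longrightarrow> poly p z = 0)"

lemma is_minpoly_nonzero: "is_minpoly L y g \<Longrightarrow> g \<noteq> 0"
  by (auto simp: is_minpoly_def)

lemma is_minpoly_degree: "is_minpoly L y g \<Longrightarrow> Polynomial.degree g > 0"
  by (rule ccontr) (auto simp: is_minpoly_def elim!: degree_eq_zeroE)

lemma minpoly_exists:
  fixes L :: "'a::field set"
  assumes L: "subfield L \<Omega>" and y: "y \<in> alg_cl L"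
  obtains g where "is_minpoly L y g"
proof -
  define P where "P p \<longleftrightarrow> poly_over L p \<and> p \<noteq> 0 \<and> poly p y = 0" for p
  obtain p0 where "P p0" using y alg_cl_iff[OF L] by (auto simp: P_def)
  then obtain p where p: "P p" "\<And>p'. P p' \<Longrightarrow> Polynomial.degree p \<le> Polynomial.degree p'"
    using ex_has_least_nat[of P p0 Polynomial.degree] by blast
  define g where "g = smult (inverse (Polynomial.lead_coeff p)) p"
  have "is_minpoly L y g"
    using p poly_over_smult[OF L, of "inverse (Polynomial.lead_coeff p)" p] subfield_inverse[OF L]
    by (auto simp: is_minpoly_def g_def P_def poly_over_def)
  then show ?thesis by (rule that)
qed

lemma is_minpoly_dvd:
  fixes L :: "'a::field set"
  assumes L: "subfield L \<Omega>" and g: "is_minpoly L y g" and p: "poly_over L p" "poly p y = 0"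
  obtains s where "poly_over L s" "p = s * g"
proof -
  obtain s r where sr: "poly_over L s" "poly_over L r" "p = s * g + r"
    "r = 0 \<or> Polynomial.degree r < Polynomial.degree g"
    using poly_over_division[OF L _ p(1) is_minpoly_nonzero[OF g]] g by (auto simp: is_minpoly_def)
  have "poly r y = 0" using sr(3) p(2) g by (auto simp: is_minpoly_def)
  then have "r = 0" using sr(2,4) g unfolding is_minpoly_def by (metis not_less)
  then show ?thesis using sr that by auto
qed

text \<open>The minimal polynomial \<open>d\<close> of \<open>z\<close> divides \<open>g\<close>,
  say \<open>g = s * d\<close>. One of \<open>s\<close> and \<open>d\<close> vanishes at
  \<open>y\<close>, and the minimality of \<open>g\<close> then leaves no room for \<open>d\<close>
  to have smaller degree.\<close>

lemma is_minpoly_root: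
  fixes L :: "'a::field set"
  assumes L: "subfield L \<Omega>" and g: "is_minpoly L y g" and z: "poly g z = 0"
  shows "is_minpoly L z g"
proof -
  have "z \<in> alg_cl L" using alg_cl_iff[OF L] g z is_minpoly_nonzero[OF g] by (auto simp: is_minpoly_def)
  then obtain d where d: "is_minpoly L z d" using minpoly_exists[OF L] by blast
  obtain s where s: "poly_over L s" "g = s * d"
    using is_minpoly_dvd[OF L d _ z] g by (auto simp: is_minpoly_def)
  have nz: "s \<noteq> 0" "d \<noteq> 0" using s is_minpoly_nonzero[OF g] by auto
  have dg: "Polynomial.degree g = Polynomial.degree s + Polynomial.degree d"
    using s nz by (simp add: degree_mult_eq)
  have "poly s y = 0 \<or> poly d y = 0" using g s by (auto simp: is_minpoly_def)
  then have "Polynomial.degree g \<le> Polynomial.degree d"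
  proof
    assume "poly s y = 0"
    then have "Polynomial.degree g \<le> Polynomial.degree s" using g s(1) nz by (auto simp: is_minpoly_def)
    then show ?thesis using dg is_minpoly_degree[OF d] by simp
  qed (use g d nz in \<open>auto simp: is_minpoly_def\<close>)
  then show ?thesis using d g z unfolding is_minpoly_def by (meson order_trans)
qed

lemma conjugate_iff_minpoly_root:
  fixes L :: "'a::field set"
  assumes L: "subfield L \<Omega>" and g: "is_minpoly L y g"
  shows "conjugate L y z \<longleftrightarrow> poly g z = 0"
proof
  show "conjugate L y z \<Longrightarrow> poly g z = 0" using g by (auto simp: conjugate_def is_minpoly_def)
next
  assume z: "poly g z = 0"
  show "conjugate L y z" unfolding conjugate_def
  proof (intro allI impI)
    fix p assume "poly_over L p" "poly p y = 0"
    then obtain s where "p = s * g" using is_minpoly_dvd[OF L g] by blast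
    then show "poly p z = 0" using z by simp
  qed
qed

lemma conjugate_mono: "K \<subseteq> L \<Longrightarrow> conjugate L x y \<Longrightarrow> conjugate K x y"
  unfolding conjugate_def using poly_over_mono by blast

lemma conjugate_alg_cl:
  fixes L :: "'a::field set"
  assumes "subfield L \<Omega>" "y \<in> alg_cl L" "conjugate L y z"
  shows "z \<in> alg_cl L"
  using assms by (auto simp: alg_cl_iff[OF assms(1)] conjugate_def)

lemma conjugate_diff:
  fixes L :: "'a::field set"
  assumes L: "subfield L \<Omega>" and c: "conjugate L y z" and a: "a \<in> L"
  shows "conjugate L (y - a) (z - a)"
  unfolding conjugate_def
proof (intro allI impI)
  fix p assume p: "poly_over L p" "poly p (y - a) = 0"
  have "poly_over L (pcompose p [:- a, 1:])"
    using p a by (intro poly_over_pcompose[OF L]) (auto intro: subfield_closed[OF L] simp: poly_over_pCons[OF L] poly_over_0[OF L])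
  then show "poly p (z - a) = 0"
    using c p(2) unfolding conjugate_def by (auto simp: poly_pcompose dest!: spec[of _ "pcompose p [:- a, 1:]"])
qed

lemma conjugate_mult:
  fixes L :: "'a::field set"
  assumes L: "subfield L \<Omega>" and c: "conjugate L y z" and a: "a \<in> L"
  shows "conjugate L (a * y) (a * z)"
  unfolding conjugate_def
proof (intro allI impI)
  fix p assume p: "poly_over L p" "poly p (a * y) = 0"
  have "poly_over L (pcompose p [:0, a:])"
    using p a by (intro poly_over_pcompose[OF L]) (auto intro: subfield_closed[OF L] simp: poly_over_pCons[OF L] poly_over_0[OF L])
  moreover have "poly (pcompose p [:0, a:]) y = 0" using p(2) by (simp add: poly_pcompose mult.commute)
  ultimately have "poly (pcompose p [:0, a:]) z = 0" using c by (auto simp: conjugate_def)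
  then show "poly p (a * z) = 0" by (simp add: poly_pcompose mult.commute)
qed

text \<open>A simple root of some \<open>h\<close> at \<open>y\<close> forces
  \<open>pderiv g\<close> to be nonzero. Its degree is below that of \<open>g\<close>, which is
  minimal for every conjugate, so it vanishes at none of them.\<close>

lemma is_minpoly_simple:
  fixes L :: "'a::field set"
  assumes L: "subfield L \<Omega>" and g: "is_minpoly L y g"
    and h: "poly_over L h" "poly h y = 0" "poly (pderiv h) y \<noteq> 0"
    and z: "poly g z = 0"
  shows "poly (pderiv g) z \<noteq> 0"
proof
  obtain s where s: "h = s * g" using is_minpoly_dvd[OF L g h(1,2)] .
  have "poly (pderiv g) y \<noteq> 0"
    using h(3) g by (auto simp: s pderiv_mult is_minpoly_def)
  then have nz: "pderiv g \<noteq> 0" by auto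
  assume "poly (pderiv g) z = 0"
  moreover have "poly_over L (pderiv g)" using g by (auto simp: is_minpoly_def intro: poly_over_pderiv[OF L])
  ultimately have "Polynomial.degree g \<le> Polynomial.degree (pderiv g)"
    using is_minpoly_root[OF L g z] nz by (auto simp: is_minpoly_def)
  also have "\<dots> \<le> Polynomial.degree g - 1"
    by (intro degree_le) (auto simp: coeff_pderiv coeff_eq_0 simp del: of_nat_Suc)
  finally show False using is_minpoly_degree[OF g] by simp
qed

section \<open>Embeddings\<close>

text \<open>A partial homomorphism: values outside \<open>M\<close> are arbitrary, so an extension
  is a new function that agrees on \<open>M\<close>.\<close>

definition hom_on :: "'a::field set \<Rightarrow> ('a \<Rightarrow> 'a) \<Rightarrow> bool"
  where "hom_on M \<tau> \<longleftrightarrow> \<tau> 1 = 1 \<and>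
    (\<forall>x\<in>M. \<forall>y\<in>M. \<tau> (x + y) = \<tau> x + \<tau> y \<and> \<tau> (x * y) = \<tau> x * \<tau> y)"

context
  fixes M :: "'a::field set" and \<tau> :: "'a \<Rightarrow> 'a"
  assumes M: "subfield M \<Omega>" and \<tau>: "hom_on M \<tau>"
begin

lemma hom_on_0: "\<tau> 0 = 0"
proof -
  have "\<tau> (0 + 0) = \<tau> 0 + \<tau> 0" using \<tau> subfield_0[OF M] unfolding hom_on_def by blast
  then show ?thesis by (metis add.right_neutral add_left_cancel)
qed

lemma hom_on_minus: assumes "x \<in> M" shows "\<tau> (- x) = - \<tau> x"
proof -
  have "\<tau> (x + - x) = \<tau> x + \<tau> (- x)" using \<tau> subfield_minus[OF M assms] assms unfolding hom_on_def by blast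
  then show ?thesis by (simp add: hom_on_0 eq_neg_iff_add_eq_0 add.commute)
qed

lemma hom_on_power: assumes "x \<in> M" shows "\<tau> (x ^ n) = \<tau> x ^ n"
  using \<tau> subfield_power[OF M assms] assms by (induction n) (auto simp: hom_on_def)

lemma hom_on_prod_mset: "(\<And>i. i \<in># I \<Longrightarrow> f i \<in> M) \<Longrightarrow> \<tau> (\<Prod>i\<in>#I. f i) = (\<Prod>i\<in>#I. \<tau> (f i))"
proof (induction I)
  case (add x I)
  have "(\<Prod>i\<in>#I. f i) \<in> M" using add.prems
    by (induction I) (auto intro: subfield_closed[OF M])
  then show ?case using add \<tau> by (auto simp: hom_on_def)
qed (use \<tau> in \<open>auto simp: hom_on_def\<close>)

lemma map_poly_add_hom_on:
  "poly_over M p \<Longrightarrow> poly_over M q \<Longrightarrow> map_poly \<tau> (p + q) = map_poly \<tau> p + map_poly \<tau> q"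
  using \<tau> by (intro poly_eqI) (auto simp: coeff_map_poly hom_on_0 hom_on_def poly_over_def)

lemma map_poly_smult_hom_on:
  "a \<in> M \<Longrightarrow> poly_over M p \<Longrightarrow> map_poly \<tau> (smult a p) = smult (\<tau> a) (map_poly \<tau> p)"
  using \<tau> by (intro poly_eqI) (auto simp: coeff_map_poly hom_on_0 hom_on_def poly_over_def)

lemma map_poly_mult_hom_on:
  assumes "poly_over M p" "poly_over M q"
  shows "map_poly \<tau> (p * q) = map_poly \<tau> p * map_poly \<tau> q"
  using assms
proof (induction p)
  case (pCons a p)
  then have "a \<in> M" "poly_over M p" by (auto simp: poly_over_pCons[OF M])
  then show ?case using pCons
    by (simp add: map_poly_add_hom_on map_poly_smult_hom_on map_poly_pCons[of \<tau>, OF hom_on_0]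
        poly_over_smult[OF M] poly_over_mult[OF M] poly_over_pCons[OF M] subfield_0[OF M] hom_on_0)
qed auto

lemma poly_map_poly_hom_on:
  assumes "poly_over M p" "x \<in> M"
  shows "poly (map_poly \<tau> p) (\<tau> x) = \<tau> (poly p x)"
  using assms
proof (induction p)
  case (pCons a p)
  then have "a \<in> M" "poly_over M p" by (auto simp: poly_over_pCons[OF M])
  moreover from this have "poly p x \<in> M" "x * poly p x \<in> M"
    using poly_closed[OF M] subfield_mult[OF M] pCons.prems by auto
  ultimately show ?case using pCons \<tau>
    by (auto simp: hom_on_def map_poly_pCons[of \<tau>, OF hom_on_0])
qed (auto simp: hom_on_0)

lemma conjugate_hom_on:
  assumes "L \<subseteq> M" "\<And>x. x \<in> L \<Longrightarrow> \<tau> x = x" "y \<in> M"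
  shows "conjugate L y (\<tau> y)"
  unfolding conjugate_def
proof (intro allI impI)
  fix p assume p: "poly_over L p" "poly p y = 0"
  have "map_poly \<tau> p = p" using p(1) assms(2) by (intro poly_eqI) (auto simp: coeff_map_poly hom_on_0 poly_over_def)
  then show "poly p (\<tau> y) = 0"
    using poly_map_poly_hom_on[OF poly_over_mono[OF p(1) assms(1)] assms(3)] p(2) by (simp add: hom_on_0)
qed

end

definition sext :: "'a::field set \<Rightarrow> 'a \<Rightarrow> 'a set"
  where "sext M z = {poly p z | p. poly_over M p}"

lemma
  assumes M: "subfield M \<Omega>"
  shows subset_sext: "M \<subseteq> sext M z" and sext_mem: "z \<in> sext M z"
proof
  show "z \<in> sext M z" unfolding sext_def
    using poly_over_pCons[OF M] poly_over_0[OF M] subfield_0[OF M] subfield_1[OF M]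
    by (intro CollectI exI[of _ "[:0, 1:]"]) auto
  fix x assume "x \<in> M"
  then show "x \<in> sext M z" unfolding sext_def
    using poly_over_pCons[OF M] poly_over_0[OF M] by (intro CollectI exI[of _ "[:x:]"]) auto
qed

lemma subfield_sext:
  fixes M :: "'a::field set"
  assumes M: "subfield M \<Omega>" and z: "z \<in> alg_cl M"
  shows "subfield (sext M z) \<Omega>"
proof (rule subfieldI_Amb)
  show "1 \<in> sext M z" using subset_sext[OF M] subfield_1[OF M] by auto
  fix x assume "x \<in> sext M z"
  then obtain p where p: "poly_over M p" "x = poly p z" by (auto simp: sext_def)
  {
    fix y assume "y \<in> sext M z"
    then obtain q where q: "poly_over M q" "y = poly q z" by (auto simp: sext_def)
    show "x - y \<in> sext M z" "x * y \<in> sext M z"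
      unfolding sext_def using p(2) q(2) poly_over_diff[OF M p(1) q(1)] poly_over_mult[OF M p(1) q(1)]
      by (metis (mono_tags, lifting) mem_Collect_eq poly_diff poly_mult)+
  }
  assume nz: "x \<noteq> 0"
  have "x \<in> alg_cl M"
    using p z subset_alg_cl[OF M] by (auto intro: poly_closed[OF subfield_alg_cl[OF M] poly_over_mono])
  then obtain g where g: "is_minpoly M x g" using minpoly_exists[OF M] by blast
  obtain c h where h: "g = pCons c h" by (cases g)
  have ch: "c \<in> M" "poly_over M h" using g h by (auto simp: is_minpoly_def poly_over_pCons[OF M])
  \<comment> \<open>With nonzero constant term, \<open>c + x * h(x) = 0\<close> can be solved for
    the inverse of \<open>x\<close> as a polynomial in \<open>x\<close>, hence in
    \<open>z\<close>.\<close>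
  have c0: "c \<noteq> 0"
  proof
    assume "c = 0"
    then have "h \<noteq> 0" "poly h x = 0" using g h nz is_minpoly_nonzero[OF g] by (auto simp: is_minpoly_def)
    then have "Polynomial.degree g \<le> Polynomial.degree h" using g ch by (auto simp: is_minpoly_def)
    then show False using \<open>h \<noteq> 0\<close> h by simp
  qed
  have "c + x * poly h x = 0" using g h by (auto simp: is_minpoly_def)
  then have "inverse x = - inverse c * poly h x" using c0 nz
    by (simp add: field_simps eq_neg_iff_add_eq_0)
  also have "\<dots> = poly (smult (- inverse c) (pcompose h p)) z" by (simp add: p poly_pcompose)
  also have "\<dots> \<in> sext M z" unfolding sext_def
    using ch p by (auto intro!: exI[of _ "smult (- inverse c) (pcompose h p)"] poly_over_minus[OF M] poly_over_smult[OF M] poly_over_pcompose[OF M] subfield_inverse[OF M] subfield_minus[OF M])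
  finally show "inverse x \<in> sext M z" .
qed

text \<open>The value at \<open>p(z)\<close> is the image of \<open>p\<close> under
  \<open>\<tau>\<close>, evaluated at \<open>z'\<close>. Two choices of \<open>p\<close> differ by a
  multiple of \<open>g\<close>, whose image vanishes at \<open>z'\<close>.\<close>

lemma hom_on_extend:
  fixes M :: "'a::field set"
  assumes M: "subfield M \<Omega>" and \<tau>: "hom_on M \<tau>" and g: "is_minpoly M z g"
    and z': "poly (map_poly \<tau> g) z' = 0"
  obtains \<tau>' where "hom_on (sext M z) \<tau>'" "\<And>x. x \<in> M \<Longrightarrow> \<tau>' x = \<tau> x" "\<tau>' z = z'"
proof -
  have wd: "poly (map_poly \<tau> p) z' = poly (map_poly \<tau> q) z'"
    if "poly_over M p" "poly_over M q" "poly p z = poly q z" for p q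
  proof -
    have d: "poly_over M (p - q)" by (rule poly_over_diff[OF M that(1,2)])
    have "poly (p - q) z = 0" using that by simp
    then obtain s where s: "poly_over M s" "p - q = s * g"
      using is_minpoly_dvd[OF M g d] by blast
    have "p = s * g + q" using s(2) by (simp add: algebra_simps)
    then have "map_poly \<tau> p = map_poly \<tau> s * map_poly \<tau> g + map_poly \<tau> q"
      using s(1) g that by (simp add: is_minpoly_def map_poly_add_hom_on[OF M \<tau>] map_poly_mult_hom_on[OF M \<tau>] poly_over_mult[OF M])
    then show ?thesis using z' by simp
  qed
  define \<tau>' where "\<tau>' x = poly (map_poly \<tau> (SOME p. poly_over M p \<and> poly p z = x)) z'" for x
  have eq: "\<tau>' (poly p z) = poly (map_poly \<tau> p) z'" if "poly_over M p" for p
  proof -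
    have "poly_over M (SOME q. poly_over M q \<and> poly q z = poly p z) \<and>
       poly (SOME q. poly_over M q \<and> poly q z = poly p z) z = poly p z"
      by (rule someI_ex) (use that in blast)
    then show ?thesis unfolding \<tau>'_def using wd that by blast
  qed
  have h0: "\<tau> 0 = 0" by (rule hom_on_0[OF M \<tau>])
  have c: "\<tau>' x = \<tau> x" if "x \<in> M" for x
    using eq[of "[:x:]"] that by (simp add: poly_over_pCons[OF M] poly_over_0[OF M] map_poly_pCons[of \<tau>, OF h0])
  have "hom_on (sext M z) \<tau>'" unfolding hom_on_def
  proof (intro conjI ballI)
    show "\<tau>' 1 = 1" using c[OF subfield_1[OF M]] \<tau> by (simp add: hom_on_def)
    fix x y assume "x \<in> sext M z" "y \<in> sext M z"
    then obtain p q where pq: "poly_over M p" "x = poly p z" "poly_over M q" "y = poly q z" by (auto simp: sext_def)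
    show "\<tau>' (x + y) = \<tau>' x + \<tau>' y"
      using eq[OF poly_over_add[OF M pq(1,3)]] eq[OF pq(1)] eq[OF pq(3)] pq
      by (simp add: map_poly_add_hom_on[OF M \<tau>])
    show "\<tau>' (x * y) = \<tau>' x * \<tau>' y"
      using eq[OF poly_over_mult[OF M pq(1,3)]] eq[OF pq(1)] eq[OF pq(3)] pq
      by (simp add: map_poly_mult_hom_on[OF M \<tau>])
  qed
  moreover have "\<tau>' z = z'"
    using eq[of "[:0, 1:]"] \<tau>
    by (simp add: poly_over_pCons[OF M] poly_over_0[OF M] map_poly_pCons[of \<tau>, OF h0] h0 subfield_0[OF M] subfield_1[OF M] hom_on_def)
  ultimately show ?thesis using c that by blast
qed

text \<open>Only finitely many roots ever have to be moved at once, so the elements of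
  \<open>S\<close> are adjoined one by one, each sent to some root of the transported minimal
  polynomial.\<close>

lemma conjugate_extend:
  fixes L :: "'a::alg_closed_field set"
  assumes L: "subfield L \<Omega>" and z: "z \<in> alg_cl L" and c: "conjugate L z z'"
    and S: "finite S" "S \<subseteq> alg_cl L"
  obtains M \<tau> where "subfield M \<Omega>" "L \<subseteq> M" "z \<in> M" "S \<subseteq> M" "hom_on M \<tau>"
    "\<forall>x\<in>L. \<tau> x = x" "\<tau> z = z'"
proof -
  have "\<exists>M \<tau>. subfield M \<Omega> \<and> L \<subseteq> M \<and> z \<in> M \<and> S \<subseteq> M \<and> hom_on M \<tau> \<and>
    (\<forall>x\<in>L. \<tau> x = x) \<and> \<tau> z = z'" using S
  proof (induction S)
    case empty
    obtain g where g: "is_minpoly L z g" using minpoly_exists[OF L z] .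
    have "map_poly (\<lambda>x. x) g = g" by simp
    then have "poly (map_poly (\<lambda>x. x) g) z' = 0" using c conjugate_iff_minpoly_root[OF L g] by simp
    then obtain \<tau> where "hom_on (sext L z) \<tau>" "\<And>x. x \<in> L \<Longrightarrow> \<tau> x = x" "\<tau> z = z'"
      using hom_on_extend[OF L _ g, of "\<lambda>x. x"] by (auto simp: hom_on_def)
    then show ?case using subfield_sext[OF L z] subset_sext[OF L] sext_mem[OF L] by blast
  next
    case (insert y S)
    then obtain M \<tau> where M: "subfield M \<Omega>" "L \<subseteq> M" "z \<in> M" "S \<subseteq> M" "hom_on M \<tau>"
      "\<forall>x\<in>L. \<tau> x = x" "\<tau> z = z'" by auto
    have y: "y \<in> alg_cl M" using insert.prems alg_cl_mono[OF M(2)] by auto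
    obtain g where g: "is_minpoly M y g" using minpoly_exists[OF M(1) y] .
    have "Polynomial.degree (map_poly \<tau> g) = Polynomial.degree g"
      using g M(5) by (intro map_poly_degree_eq) (auto simp: is_minpoly_def hom_on_def)
    then obtain y' where "poly (map_poly \<tau> g) y' = 0"
      using alg_closed_imp_poly_has_root is_minpoly_degree[OF g] by metis
    then obtain \<tau>' where "hom_on (sext M y) \<tau>'" "\<And>x. x \<in> M \<Longrightarrow> \<tau>' x = \<tau> x"
      using hom_on_extend[OF M(1,5) g] by metis
    then show ?case using subfield_sext[OF M(1) y] subset_sext[OF M(1), of y] sext_mem[OF M(1), of y] M
      by (intro exI[of _ "sext M y"] exI[of _ \<tau>']) auto
  qed
  then show ?thesis using that by blast
qed

lemma proots_prod_linear:
  fixes A :: "'a::field multiset"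
  shows "proots (\<Prod>x\<in>#A. [:- x, 1:]) = A"
proof (induction A)
  case (add x A)
  have "(\<Prod>x\<in>#A. [:- x, 1:]) \<noteq> 0" unfolding prod_mset_zero_iff by auto
  then have "proots ([:- x, 1:] * (\<Prod>x\<in>#A. [:- x, 1:])) = proots [:- x, 1:] + A"
    using add.IH by (subst proots_mult) auto
  then show ?case by simp
qed auto

lemma monic_eq_prod_proots:
  fixes g :: "'a::alg_closed_field poly"
  assumes "Polynomial.lead_coeff g = 1"
  shows "g = (\<Prod>x\<in>#proots g. [:- x, 1:])" "size (proots g) = Polynomial.degree g"
proof -
  obtain A where A: "size A = Polynomial.degree g" "g = (\<Prod>x\<in>#A. [:- x, 1:])"
    using alg_closed_imp_factorization[of g] assms by (metis leading_coeff_0_iff smult_1_left zero_neq_one)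
  then have "proots g = A" using proots_prod_linear by metis
  then show "g = (\<Prod>x\<in>#proots g. [:- x, 1:])" "size (proots g) = Polynomial.degree g"
    using A by simp_all
qed

text \<open>Applying \<open>\<tau>\<close> to the factorization of \<open>g\<close> gives a second
  factorization of the same polynomial, whose multiset of roots is the image.\<close>

lemma image_mset_hom_on_proots:
  fixes g :: "'a::alg_closed_field poly"
  assumes M: "subfield M \<Omega>" and \<tau>: "hom_on M \<tau>" and LM: "L \<subseteq> M" "\<And>x. x \<in> L \<Longrightarrow> \<tau> x = x"
    and g: "poly_over L g" "Polynomial.lead_coeff g = 1" and A: "set_mset (proots g) \<subseteq> M"
  shows "image_mset \<tau> (proots g) = proots g"
proof -
  have g': "map_poly \<tau> g = g" using g(1) LM(2)
    by (intro poly_eqI) (auto simp: coeff_map_poly hom_on_0[OF M \<tau>] poly_over_def)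
  have "poly_over M (\<Prod>x\<in>#A. [:- x, 1:]) \<and>
      map_poly \<tau> (\<Prod>x\<in>#A. [:- x, 1:]) = (\<Prod>x\<in>#image_mset \<tau> A. [:- x, 1:])"
    if "set_mset A \<subseteq> M" for A using that
  proof (induction A)
    case (add x A)
    have x: "x \<in> M" "set_mset A \<subseteq> M" using add.prems by auto
    have l: "poly_over M [:- x, 1:]" using x subfield_closed[OF M] by (simp add: poly_over_pCons[OF M] poly_over_0[OF M])
    have "map_poly \<tau> [:- x, 1:] = [:- \<tau> x, 1:]"
      using \<tau> hom_on_0[OF M \<tau>] hom_on_minus[OF M \<tau> x(1)] by (simp add: map_poly_pCons hom_on_def)
    then show ?case using add.IH[OF x(2)] l
      by (auto simp: map_poly_mult_hom_on[OF M \<tau> l] poly_over_mult[OF M l] simp del: mult_pCons_left)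
  qed (use \<tau> in \<open>auto simp: poly_over_1[OF M] hom_on_def\<close>)
  from this[OF A] have "g = (\<Prod>x\<in>#image_mset \<tau> (proots g). [:- x, 1:])"
    using g' monic_eq_prod_proots(1)[OF g(2)] by metis
  then show ?thesis using proots_prod_linear by metis
qed

section \<open>Purely inseparable closure\<close>

text \<open>With this convention the Frobenius map is the identity in characteristic 0.\<close>

definition frob :: "'a::field \<Rightarrow> 'a"
  where "frob x = x ^ (if CHAR('a) = 0 then 1 else CHAR('a))"

lemma frob_add: "frob (x + y) = frob x + frob (y :: 'a::field)"
  unfolding frob_def by (auto intro!: freshmans_dream prime_CHAR_semidom)

lemma frob_mult: "frob (x * y) = frob x * frob (y :: 'a::field)"
  by (simp add: frob_def power_mult_distrib)

lemma frob_inverse: "frob (inverse x) = inverse (frob (x :: 'a::field))"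
  by (simp add: frob_def power_inverse)

lemma frob_1 [simp]: "frob 1 = (1 :: 'a::field)"
  by (simp add: frob_def)

lemma frob_eq_0_iff [simp]: "frob x = 0 \<longleftrightarrow> x = (0 :: 'a::field)"
  by (auto simp: frob_def)

lemma frob_diff: "frob (x - y) = frob x - frob (y :: 'a::field)"
  using frob_add[of "x - y" y] by simp

lemma frob_inject: "frob x = frob y \<longleftrightarrow> x = (y :: 'a::field)"
  using frob_diff[of x y] frob_eq_0_iff[of "x - y"] by auto

lemma frob_closed: "subfield L \<Omega> \<Longrightarrow> x \<in> L \<Longrightarrow> (frob ^^ n) x \<in> L"
  by (induction n) (auto simp: frob_def intro: subfield_power)

lemma frob_funpow:
  "(frob ^^ n) (x * y) = (frob ^^ n) x * (frob ^^ n) (y :: 'a::field)"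
  "(frob ^^ n) (x - y) = (frob ^^ n) x - (frob ^^ n) y"
  "(frob ^^ n) (inverse x) = inverse ((frob ^^ n) x)"
  "(frob ^^ n) (1 :: 'a) = 1"
  by (induction n) (auto simp: frob_mult frob_diff frob_inverse)

lemma frob_funpow_power:
  obtains k where "k > 0" "\<And>x :: 'a::field. (frob ^^ n) x = x ^ k"
proof -
  define q :: nat where "q = (if CHAR('a) = 0 then 1 else CHAR('a))"
  have "(frob ^^ n) x = x ^ (q ^ n)" for x :: 'a
    by (induction n) (auto simp: frob_def q_def mult.commute simp flip: power_mult)
  moreover have "q ^ n > 0" by (auto simp: q_def)
  ultimately show ?thesis using that by blast
qed

text \<open>The elements purely inseparable over \<open>L\<close>; in characteristic 0 this is
  \<open>L\<close> itself.\<close>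

definition perf_cl :: "'a::field set \<Rightarrow> 'a set"
  where "perf_cl L = {y. \<exists>n. (frob ^^ n) y \<in> L}"

lemma subset_perf_cl: "L \<subseteq> perf_cl L"
  unfolding perf_cl_def by (auto intro: exI[of _ 0])

lemma perf_cl_perf_cl: "perf_cl (perf_cl L) = perf_cl L"
proof
  show "perf_cl (perf_cl L) \<subseteq> perf_cl L"
    unfolding perf_cl_def by (auto simp flip: funpow_add[unfolded o_def, THEN fun_cong])
qed (rule subset_perf_cl)

lemma subfield_perf_cl:
  fixes L :: "'a::field set"
  assumes L: "subfield L \<Omega>"
  shows "subfield (perf_cl L) \<Omega>"
proof (rule subfieldI_Amb)
  show "1 \<in> perf_cl L" using subset_perf_cl subfield_1[OF L] by auto
  fix x assume "x \<in> perf_cl L"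
  then obtain n where n: "(frob ^^ n) x \<in> L" by (auto simp: perf_cl_def)
  then show "inverse x \<in> perf_cl L" using subfield_inverse[OF L] by (auto simp: perf_cl_def frob_funpow)
  fix y assume "y \<in> perf_cl L"
  then obtain m where m: "(frob ^^ m) y \<in> L" by (auto simp: perf_cl_def)
  have "(frob ^^ (m + n)) x \<in> L" "(frob ^^ (n + m)) y \<in> L"
    unfolding funpow_add o_def using frob_closed[OF L] n m by blast+
  then have "(frob ^^ (n + m)) x \<in> L" "(frob ^^ (n + m)) y \<in> L" by (simp_all add: add.commute)
  then show "x - y \<in> perf_cl L" "x * y \<in> perf_cl L"
    unfolding perf_cl_def using subfield_diff[OF L] subfield_mult[OF L]
    by (auto simp: frob_funpow intro!: exI[of _ "n + m"])
qed

text \<open>The embedding that moves the Frobenius power to \<open>z\<close> can be chosen to be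
  defined at \<open>y\<close> too, and it commutes with powers.\<close>

lemma conjugate_frob:
  fixes L :: "'a::alg_closed_field set"
  assumes L: "subfield L \<Omega>" and y: "y \<in> alg_cl L" and c: "conjugate L ((frob ^^ n) y) z"
  obtains y' where "conjugate L y y'" "z = (frob ^^ n) y'"
proof -
  obtain k where k: "\<And>x :: 'a. (frob ^^ n) x = x ^ k" using frob_funpow_power[of n] by blast
  have fy: "finite {y}" "{y} \<subseteq> alg_cl L" using y by auto
  obtain M \<tau> where M: "subfield M \<Omega>" "L \<subseteq> M" "(frob ^^ n) y \<in> M" "{y} \<subseteq> M" "hom_on M \<tau>"
    "\<forall>x\<in>L. \<tau> x = x" "\<tau> ((frob ^^ n) y) = z"
    using conjugate_extend[OF L frob_closed[OF subfield_alg_cl[OF L] y] c fy] .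
  from M(4) have yM: "y \<in> M" by simp
  have "z = (frob ^^ n) (\<tau> y)" using M(7) k hom_on_power[OF M(1,5) yM] by simp
  then show ?thesis using that conjugate_hom_on[OF M(1,5,2) _ yM] M(6) by blast
qed

text \<open>Induction on the degree of the minimal polynomial: if its derivative vanishes, it is a
  polynomial in the p-th power of the variable, so \<open>frob y\<close> has smaller degree than
  \<open>y\<close>.\<close>

lemma frob_separable:
  fixes L :: "'a::field set"
  assumes L: "subfield L \<Omega>" and y: "y \<in> alg_cl L"
  obtains n h where "poly_over L h" "poly h ((frob ^^ n) y) = 0" "poly (pderiv h) ((frob ^^ n) y) \<noteq> 0"
proof -
  have "\<exists>n h. poly_over L h \<and> poly h ((frob ^^ n) y) = 0 \<and> poly (pderiv h) ((frob ^^ n) y) \<noteq> 0"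
    if "is_minpoly L y g" for g y using that
  proof (induction "Polynomial.degree g" arbitrary: g y rule: less_induct)
    case less
    note g = less.prems
    show ?case
    proof (cases "pderiv g = 0")
      case False
      have "Polynomial.degree (pderiv g) \<le> Polynomial.degree g - 1"
        by (intro degree_le) (auto simp: coeff_pderiv coeff_eq_0 simp del: of_nat_Suc)
      then have "poly (pderiv g) y \<noteq> 0"
        using g False is_minpoly_degree[OF g] poly_over_pderiv[OF L] unfolding is_minpoly_def by fastforce
      then show ?thesis using g by (intro exI[of _ 0] exI[of _ g]) (auto simp: is_minpoly_def)
    next
      case True
      define p where "p = CHAR('a)"
      define N where "N = Polynomial.degree g"
      have N: "N > 0" using is_minpoly_degree[OF g] by (simp add: N_def)
      have z: "coeff g i = 0" if "\<not> p dvd i" for i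
      proof (cases i)
        case (Suc j)
        have "of_nat (Suc j) * coeff g (Suc j) = 0" using arg_cong[OF True, of "\<lambda>p. coeff p j"]
          by (simp add: coeff_pderiv del: of_nat_Suc)
        moreover have "of_nat (Suc j) \<noteq> (0 :: 'a)" using that Suc of_nat_eq_0_iff_char_dvd p_def by metis
        ultimately show ?thesis using Suc by simp
      qed (use that in auto)
      have pN: "p dvd N" using z[of N] g unfolding N_def is_minpoly_def by force
      with N have "p \<noteq> 0" by auto
      moreover have "p \<noteq> Suc 0" unfolding p_def by (rule CHAR_not_1')
      ultimately have p: "p > 1" by simp
      have fr: "frob x = x ^ p" for x :: 'a using p by (simp add: frob_def p_def)
      \<comment> \<open>Chosen so that \<open>g(x) = g1(x^p)\<close>. The bound \<open>N\<close> is
        generous: coefficients beyond \<open>N div p\<close> are 0.\<close>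
      define g1 where "g1 = (\<Sum>i\<le>N. Polynomial.monom (coeff g (p * i)) i)"
      have cg1: "coeff g1 i = (if i \<le> N then coeff g (p * i) else 0)" for i
        by (simp add: g1_def coeff_sum)
      have o1: "poly_over L g1" using g cg1 subfield_0[OF L] by (auto simp: is_minpoly_def poly_over_def)
      have "coeff g1 (N div p) = 1" using pN p g by (simp add: cg1 N_def is_minpoly_def)
      then have n1: "g1 \<noteq> 0" by auto
      have d1: "Polynomial.degree g1 < N"
      proof -
        have "Polynomial.degree g1 \<le> N div p"
        proof (rule degree_le, intro allI impI)
          fix i assume "N div p < i"
          then have "N < p * i" using p by (metis div_less_iff_less_mult gr_implies_not0 mult.commute neq0_conv)
          then show "coeff g1 i = 0" by (auto simp: cg1 N_def coeff_eq_0)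
        qed
        also have "\<dots> < N" using N p by simp
        finally show ?thesis .
      qed
      have "poly g1 (frob y) = (\<Sum>i\<le>N. coeff g (p * i) * y ^ (p * i))"
        by (simp add: g1_def poly_sum poly_monom fr power_mult)
      also have "\<dots> = (\<Sum>j\<in>(*) p ` {..N}. coeff g j * y ^ j)"
        using p by (subst sum.reindex) (auto simp: inj_on_def)
      also have "\<dots> = (\<Sum>j\<in>{j. j \<le> N \<and> p dvd j}. coeff g j * y ^ j)"
      proof (intro sum.mono_neutral_right)
        have "k \<le> p * k" for k using p by simp
        then show "{j. j \<le> N \<and> p dvd j} \<subseteq> (*) p ` {..N}" by (auto simp: dvd_def intro!: imageI elim: order_trans[rotated])
      qed (use p in \<open>auto simp: N_def coeff_eq_0\<close>)
      also have "\<dots> = (\<Sum>j\<le>N. coeff g j * y ^ j)"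
        using z by (intro sum.mono_neutral_left) auto
      also have "\<dots> = 0" using g by (simp add: N_def is_minpoly_def flip: poly_altdef)
      finally have r1: "poly g1 (frob y) = 0" .
      then have "frob y \<in> alg_cl L" using alg_cl_iff[OF L] o1 n1 by blast
      then obtain g2 where g2: "is_minpoly L (frob y) g2" using minpoly_exists[OF L] by blast
      then have "Polynomial.degree g2 < Polynomial.degree g"
        using o1 n1 r1 d1 unfolding is_minpoly_def N_def by (meson le_less_trans)
      from less.hyps[OF this g2] obtain n h where "poly_over L h"
        "poly h ((frob ^^ n) (frob y)) = 0" "poly (pderiv h) ((frob ^^ n) (frob y)) \<noteq> 0" by blast
      then show ?thesis by (intro exI[of _ "Suc n"] exI[of _ h]) (simp add: funpow_swap1)
    qed
  qed
  then show ?thesis using minpoly_exists[OF L y] that by metis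
qed

text \<open>A separable Frobenius power of \<open>y\<close> again has no other conjugate, so its
  minimal polynomial has a single, simple root and is linear.\<close>

lemma unique_conjugate_imp_perf_cl:
  fixes L :: "'a::alg_closed_field set"
  assumes L: "subfield L \<Omega>" and y: "y \<in> alg_cl L" and u: "\<And>z. conjugate L y z \<Longrightarrow> z = y"
  shows "y \<in> perf_cl L"
proof -
  obtain n h where h: "poly_over L h" "poly h ((frob ^^ n) y) = 0" "poly (pderiv h) ((frob ^^ n) y) \<noteq> 0"
    using frob_separable[OF L y] .
  define w where "w = (frob ^^ n) y"
  have wC: "w \<in> alg_cl L" unfolding w_def by (rule frob_closed[OF subfield_alg_cl[OF L] y])
  obtain g where g: "is_minpoly L w g" using minpoly_exists[OF L wC] .
  have g0: "poly g w = 0" "poly_over L g" "Polynomial.lead_coeff g = 1" using g by (auto simp: is_minpoly_def)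
  have uw: "z = w" if "poly g z = 0" for z
  proof -
    have "conjugate L w z" using that conjugate_iff_minpoly_root[OF L g] by simp
    then show ?thesis unfolding w_def by (rule conjugate_frob[OF L y]) (auto dest: u)
  qed
  have "poly (pderiv g) w \<noteq> 0"
    using is_minpoly_simple[OF L g h(1)] h g0 by (auto simp: w_def)
  moreover obtain r where r: "g = [:- w, 1:] * r" using g0(1) by (meson dvdE poly_eq_0_iff_dvd)
  ultimately have rw: "poly r w \<noteq> 0" by (auto simp: pderiv_mult pderiv_pCons simp del: mult_pCons_left)
  have "Polynomial.degree r = 0"
  proof (rule ccontr)
    assume "Polynomial.degree r \<noteq> 0"
    then obtain z where "poly r z = 0" using alg_closed_imp_poly_has_root[of r] by auto
    then show False using uw[of z] rw by (auto simp: r)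
  qed
  then obtain c where "r = [:c:]" by (elim degree_eq_zeroE)
  then have "g = [:- w, 1:]" using r g0(3) by (auto split: if_splits)
  then have "- w \<in> L" using g0(2) by (simp add: poly_over_pCons[OF L])
  then have "w \<in> L" using subfield_minus[OF L] by fastforce
  then show ?thesis by (auto simp: perf_cl_def w_def)
qed

text \<open>Write \<open>b = r(\<beta>)\<close> with \<open>r\<close> reduced modulo the minimal
  polynomial \<open>g\<close>. Conjugation fixes \<open>frob b\<close> and Frobenius is injective,
  so \<open>r - b\<close> vanishes at all roots of \<open>g\<close>. These are distinct, hence too
  many unless \<open>r\<close> is the constant \<open>b\<close>.\<close>

lemma frob_mem_imp_mem_of_separable_sext:
  fixes M :: "'a::alg_closed_field set"
  assumes M: "subfield M \<Omega>" and h: "poly_over M h" "poly h \<beta> = 0" "poly (pderiv h) \<beta> \<noteq> 0"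
    and b: "b \<in> sext M \<beta>" "frob b \<in> M"
  shows "b \<in> M"
proof -
  have h0: "h \<noteq> 0" using h by auto
  then obtain g where g: "is_minpoly M \<beta> g" using minpoly_exists[OF M] alg_cl_iff[OF M] h by blast
  have g0: "poly g \<beta> = 0" "poly_over M g" "Polynomial.lead_coeff g = 1" "g \<noteq> 0" using g by (auto simp: is_minpoly_def)
  obtain p where p: "poly_over M p" "b = poly p \<beta>" using b(1) by (auto simp: sext_def)
  obtain s r where r: "poly_over M r" "p = s * g + r" "r = 0 \<or> Polynomial.degree r < Polynomial.degree g"
    using poly_over_division[OF M g0(2) p(1) g0(4)] by blast
  have br: "poly r \<beta> = b" using p r g0 by simp
  have roots: "poly (r - [:b:]) z = 0" if "poly g z = 0" for z
  proof -
    define q :: nat where "q = (if CHAR('a) = 0 then 1 else CHAR('a))"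
    have fq: "frob x = x ^ q" for x :: 'a by (simp add: frob_def q_def)
    have "poly_over M (r ^ q - [:frob b:])"
      using r(1) b(2) by (auto intro!: poly_over_diff[OF M] poly_over_power[OF M] simp: poly_over_pCons[OF M] poly_over_0[OF M])
    moreover have "poly (r ^ q - [:frob b:]) \<beta> = 0" by (simp add: br fq)
    moreover have "conjugate M \<beta> z" using that conjugate_iff_minpoly_root[OF M g] by simp
    ultimately have "poly (r ^ q - [:frob b:]) z = 0" by (auto simp: conjugate_def)
    then show ?thesis using frob_inject[of "poly r z" b] by (simp add: fq)
  qed
  have "r = [:b:]"
  proof (rule ccontr)
    assume "r \<noteq> [:b:]"
    have "count (proots g) z \<le> 1" for z
    proof (rule ccontr)
      assume "\<not> count (proots g) z \<le> 1"
      then have "2 \<le> order z g" using g0 by simp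
      then have "[:- z, 1:] ^ 2 dvd g" using order_divides by blast
      then obtain k where "g = [:- z, 1:] ^ 2 * k" by (rule dvdE)
      then have k: "g = [:- z, 1:] * ([:- z, 1:] * k)" by (simp only: power2_eq_square mult.assoc)
      have "poly g z = 0" "poly (pderiv g) z = 0"
        unfolding k by (simp_all add: pderiv_mult pderiv_pCons del: mult_pCons_left)
      then show False using is_minpoly_simple[OF M g h] by blast
    qed
    then have "proots g = mset_set (set_mset (proots g))"
      by (intro multiset_eqI) (metis count_eq_zero_iff count_mset_set(1,3) finite_set_mset le_antisym not_less_eq_eq One_nat_def le_zero_eq)
    then have "card (set_mset (proots g)) = Polynomial.degree g"
      using monic_eq_prod_proots(2)[OF g0(3)] by (metis size_mset_set)
    moreover have "card (set_mset (proots g)) \<le> card {z. poly (r - [:b:]) z = 0}"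
      using roots g0(4) \<open>r \<noteq> [:b:]\<close> by (intro card_mono poly_roots_finite) auto
    moreover have "\<dots> \<le> Polynomial.degree (r - [:b:])"
      using \<open>r \<noteq> [:b:]\<close> by (intro card_poly_roots_bound) auto
    moreover have "\<dots> < Polynomial.degree g"
      using r(3) is_minpoly_degree[OF g] by (intro degree_diff_less) auto
    ultimately show False by linarith
  qed
  then show ?thesis using r(1) by (simp add: poly_over_pCons[OF M])
qed

section \<open>Rational functions\<close>

lemma adjoin_fraction:
  fixes E :: "'a::field set"
  assumes E: "subfield E \<Omega>" and u: "u \<in> adjoin E X"
  obtains p r where "poly_over E p" "poly_over E r" "poly r X \<noteq> 0" "u = poly p X / poly r X"
proof -
  define Q where "Q = {poly p X / poly r X | p r. poly_over E p \<and> poly_over E r \<and> poly r X \<noteq> 0}"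
  have QI: "poly p X / poly r X \<in> Q" if "poly_over E p" "poly_over E r" "poly r X \<noteq> 0" for p r
    using that by (auto simp: Q_def)
  note cl = poly_over_diff[OF E] poly_over_mult[OF E] poly_over_1[OF E] poly_over_0[OF E]
  have "subfield Q \<Omega>"
  proof (rule subfieldI_Amb)
    show "1 \<in> Q" using QI[of 1 1] cl by simp
    fix x assume "x \<in> Q"
    then obtain p r where x: "poly_over E p" "poly_over E r" "poly r X \<noteq> 0" "x = poly p X / poly r X"
      by (auto simp: Q_def)
    show "inverse x \<in> Q" if "x \<noteq> 0" using QI[OF x(2,1)] that x(4) by simp
    fix y assume "y \<in> Q"
    then obtain p' r' where y: "poly_over E p'" "poly_over E r'" "poly r' X \<noteq> 0" "y = poly p' X / poly r' X"
      by (auto simp: Q_def)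
    have "x - y = poly (p * r' - p' * r) X / poly (r * r') X" "x * y = poly (p * p') X / poly (r * r') X"
      using x y by (simp_all add: diff_frac_eq)
    then show "x - y \<in> Q" "x * y \<in> Q"
      using QI[of "p * r' - p' * r" "r * r'"] QI[of "p * p'" "r * r'"] x(1-3) y(1-3) cl by simp_all
  qed
  moreover have "E \<subseteq> Q"
  proof
    fix e assume "e \<in> E"
    then show "e \<in> Q" using QI[of "[:e:]" 1] cl by (simp add: poly_over_pCons[OF E])
  qed
  moreover have "X \<in> Q" using QI[of "[:0,1:]" 1] cl subfield_0[OF E] subfield_1[OF E] by (simp add: poly_over_pCons[OF E])
  ultimately have "u \<in> Q" using adjoin_least u by blast
  then show ?thesis using that by (auto simp: Q_def)
qed

lemma transcendental_alg_cl:
  fixes F :: "'a::field set"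
  assumes F: "subfield F \<Omega>" and X: "X \<notin> alg_cl F" and p: "poly_over (alg_cl F) p" "poly p X = 0"
  shows "p = 0"
  using alg_cl_root[OF F p(1) _ p(2)] X by blast

text \<open>\<open>b * r(X) = p(X)\<close> is an identity of polynomials because \<open>X\<close> is
  transcendental, so \<open>b\<close> is a quotient of coefficients.\<close>

lemma adjoin_Int_alg_cl:
  fixes F :: "'a::field set"
  assumes F: "subfield F \<Omega>" and X: "X \<notin> alg_cl F" and D: "subfield D \<Omega>" "D \<subseteq> alg_cl F"
    and b: "b \<in> alg_cl F" "b \<in> adjoin D X"
  shows "b \<in> D"
proof -
  obtain p r where pr: "poly_over D p" "poly_over D r" "poly r X \<noteq> 0" "b = poly p X / poly r X"
    using adjoin_fraction[OF D(1) b(2)] .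
  have "poly_over (alg_cl F) (smult b r - p)"
    using pr(1,2)[THEN poly_over_mono, OF D(2)] b(1)
    by (intro poly_over_diff poly_over_smult subfield_alg_cl[OF F]) auto
  moreover have "poly (smult b r - p) X = 0" using pr(3,4) by simp
  ultimately have eq: "smult b r = p" using transcendental_alg_cl[OF F X] by force
  obtain i where "coeff r i \<noteq> 0" using pr(3) by (metis leading_coeff_0_iff poly_0)
  then have "b = coeff p i / coeff r i" by (simp flip: eq)
  then show ?thesis using pr(1,2) subfield_divide[OF D(1)] by (auto simp: poly_over_def)
qed

lemma adjoin_inverse:
  fixes K :: "'a::field set"
  assumes "X \<noteq> 0"
  shows "adjoin K (inverse X) = adjoin K X"
  using subfield_inverse[OF subfield_gen[of "insert X K"]] subfield_inverse[OF subfield_gen[of "insert (inverse X) K"]]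
    X_in_adjoin[of X K] X_in_adjoin[of "inverse X" K] subset_adjoin[of K]
  by (intro equalityI adjoin_least subfield_gen) (use inverse_inverse_eq[of X] in \<open>force+\<close>)

section \<open>Valuations\<close>

locale valued =
  fixes v :: "'a::alg_closed_field \<Rightarrow> 'g::linordered_ab_group_add extended"
  assumes val: "valuation \<Omega> v"
begin

lemma v_not_Minf [simp]: "v x \<noteq> Minf" and v_eq_Pinf [simp]: "v x = Pinf \<longleftrightarrow> x = 0"
  and v_mult: "v (x * y) = v x + v y" and v_add: "min (v x) (v y) \<le> v (x + y)"
  using val by (auto simp: valuation_def)

lemma v_Fin: assumes "x \<noteq> 0" obtains g where "v x = Fin g"
  using assms v_not_Minf[of x] v_eq_Pinf[of x] by (cases "v x") auto

lemma v_0 [simp]: "v 0 = Pinf" by simp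

lemma v_1 [simp]: "v 1 = 0"
proof -
  obtain g where g: "v 1 = Fin g" using v_Fin[of 1] by auto
  have "v (1 * 1) = v 1 + v 1" by (rule v_mult)
  then show ?thesis using g by (simp add: zero_extended_def)
qed

lemma v_minus [simp]: "v (- x) = v x"
proof -
  obtain g where g: "v (- 1) = Fin g" using v_Fin[of "- 1"] by auto
  have "v (- 1 * - 1) = v (- 1) + v (- 1)" by (rule v_mult)
  then have "g + g = 0" using g by (simp add: zero_extended_def)
  then have "v (- 1) = 0" using g by (simp add: zero_extended_def)
  then show ?thesis using v_mult[of "- 1" x] by simp
qed

lemma v_minus_commute: "v (x - y) = v (y - x)"
  using v_minus[of "x - y"] by simp

lemma v_add_ge: "z \<le> v x \<Longrightarrow> z \<le> v y \<Longrightarrow> z \<le> v (x + y)"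
  and v_add_gt: "z < v x \<Longrightarrow> z < v y \<Longrightarrow> z < v (x + y)"
  using v_add[of x y] by (auto simp: min_def split: if_splits)

lemma v_diff_ge: "z \<le> v x \<Longrightarrow> z \<le> v y \<Longrightarrow> z \<le> v (x - y)"
  and v_diff_gt: "z < v x \<Longrightarrow> z < v y \<Longrightarrow> z < v (x - y)"
  using v_add_ge[of z x "- y"] v_add_gt[of z x "- y"] by auto

lemma v_add_eq: assumes "v x < v y" shows "v (x + y) = v x"
proof (rule antisym)
  show "v x \<le> v (x + y)" using assms by (intro v_add_ge) auto
  show "v (x + y) \<le> v x"
  proof (rule ccontr)
    assume "\<not> ?thesis"
    then have "v x < v (x + y - y)" using assms by (intro v_diff_gt) auto
    then show False by simp
  qed
qed

lemma v_diff_eq: "v x < v y \<Longrightarrow> v (x - y) = v x"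
  using v_add_eq[of x "- y"] by auto

lemma v_eq_of_diff: "v x < v (x - y) \<Longrightarrow> v y = v x"
  using v_diff_eq[of x "x - y"] by simp

lemma v_mult_mono: "v a \<le> v b \<Longrightarrow> v c \<le> v d \<Longrightarrow> v (a * c) \<le> v (b * d)"
  by (simp add: v_mult add_mono)

lemma v_mult_strict: assumes "v a < v b" "v c \<le> v d" "c \<noteq> 0" shows "v (a * c) < v (b * d)"
proof -
  have "a \<noteq> 0" using assms(1) by auto
  then obtain g where g: "v a = Fin g" using v_Fin by blast
  obtain h where h: "v c = Fin h" using v_Fin assms(3) by blast
  show ?thesis using assms g h v_not_Minf[of b] v_not_Minf[of d] unfolding v_mult
    by (cases "v b"; cases "v d") (auto intro: add_less_le_mono)
qed

lemma v_mult_le_cancel: assumes "c \<noteq> 0" shows "v (c * a) \<le> v (c * b) \<longleftrightarrow> v a \<le> v b"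
  using v_mult_mono[of c c a b] v_mult_strict[of b a c c] assms
  by (auto simp: mult.commute simp flip: not_less)

lemma v_mult_less_cancel: assumes "c \<noteq> 0" shows "v (c * a) < v (c * b) \<longleftrightarrow> v a < v b"
  using v_mult_le_cancel[OF assms, of b a] by (auto simp flip: not_le)

lemma v_power_mono: "v a \<le> v b \<Longrightarrow> v (a ^ n) \<le> v (b ^ n)"
  by (induction n) (auto intro: v_mult_mono)

lemma v_power_strict: assumes "v a < v b" "n > 0" shows "v (a ^ n) < v (b ^ n)"
proof -
  obtain m where m: "n = Suc m" using assms(2) by (cases n) auto
  have "a \<noteq> 0" using assms(1) by auto
  then show ?thesis unfolding m power_Suc using assms(1) by (intro v_mult_strict v_power_mono) auto
qed

lemma v_divide_le_iff: assumes "c \<noteq> 0" shows "v (a / c) \<le> v b \<longleftrightarrow> v a \<le> v (b * c)"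
  using v_mult_le_cancel[OF assms, of "a / c" b] assms by (simp add: mult.commute)

lemma v_le_divide_iff: assumes "c \<noteq> 0" shows "v b \<le> v (a / c) \<longleftrightarrow> v (b * c) \<le> v a"
  using v_mult_le_cancel[OF assms, of b "a / c"] assms by (simp add: mult.commute)

lemma v_less_divide_iff: assumes "c \<noteq> 0" shows "v b < v (a / c) \<longleftrightarrow> v (b * c) < v a"
  using v_divide_le_iff[OF assms, of a b] by (auto simp flip: not_le)

lemma v_inverse_le_iff: assumes "a \<noteq> 0" "b \<noteq> 0" shows "v (inverse a) \<le> v (inverse b) \<longleftrightarrow> v b \<le> v a"
  using v_divide_le_iff[OF assms(1), of 1 "inverse b"] v_le_divide_iff[OF assms(2), of 1 a] assms
  by (simp add: divide_inverse mult.commute)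

lemma v_mult_ge_0: "0 \<le> v a \<Longrightarrow> v b \<le> v (a * b)"
  using v_mult_mono[of 1 a b b] by simp

lemma v_mult_ge_0': "0 \<le> v a \<Longrightarrow> 0 \<le> v b \<Longrightarrow> 0 \<le> v (a * b)"
  using v_mult_ge_0[of a b] by (rule order_trans[rotated])

lemma v_mult_eq_0: "v a = 0 \<Longrightarrow> v (a * b) = v b"
  by (simp add: v_mult)

lemma v_eq_0_nonzero: "v a = 0 \<Longrightarrow> a \<noteq> 0"
  using v_eq_Pinf[of a] by (auto simp: zero_extended_def)

lemma v_sum_ge: "(\<And>i. i \<in> I \<Longrightarrow> z \<le> v (f i)) \<Longrightarrow> z \<le> v (sum f I)"
  by (induction I rule: infinite_finite_induct) (auto intro: v_add_ge)

lemma v_of_nat_ge: "0 \<le> v (of_nat n)"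
  by (induction n) (auto intro: v_add_ge)

lemma pderiv_linear_mult:
  "poly (pderiv ([:- r, 1:] * q)) x = poly q x + (x - r) * poly (pderiv q) (x :: 'b::field)"
proof -
  have "pderiv [:- r, 1:] = 1" by (simp add: pderiv_pCons)
  then show ?thesis unfolding pderiv_mult by (simp add: algebra_simps)
qed

section \<open>Polynomials with integral coefficients\<close>

definition int_poly :: "'a poly \<Rightarrow> bool" where "int_poly f \<longleftrightarrow> (\<forall>i. 0 \<le> v (coeff f i))"

lemma int_poly_pCons [simp]: "int_poly (pCons a p) \<longleftrightarrow> 0 \<le> v a \<and> int_poly p"
  unfolding int_poly_def by (metis coeff_pCons_0 coeff_pCons_Suc not0_implies_Suc)

lemma int_poly_0 [simp]: "int_poly 0" and int_poly_1 [simp]: "int_poly 1"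
  by (auto simp: int_poly_def coeff_1)

lemma int_poly_mult: "int_poly p \<Longrightarrow> int_poly q \<Longrightarrow> int_poly (p * q)"
  by (auto simp: int_poly_def coeff_mult intro!: v_sum_ge v_mult_ge_0')

lemma int_poly_add: "int_poly p \<Longrightarrow> int_poly q \<Longrightarrow> int_poly (p + q)"
  by (auto simp: int_poly_def intro!: v_add_ge)

lemma int_poly_pderiv: "int_poly p \<Longrightarrow> int_poly (pderiv p)"
  by (auto simp: int_poly_def coeff_pderiv v_of_nat_ge simp del: of_nat_Suc intro!: v_mult_ge_0')

lemma int_poly_pcompose: "int_poly p \<Longrightarrow> int_poly q \<Longrightarrow> int_poly (pcompose p q)"
  by (induction p) (auto simp: pcompose_pCons intro!: int_poly_mult int_poly_add)

lemma int_poly_value: "int_poly p \<Longrightarrow> 0 \<le> v x \<Longrightarrow> 0 \<le> v (poly p x)"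
  by (induction p) (auto intro!: v_add_ge v_mult_ge_0')

lemma int_poly_synthetic_div: "int_poly p \<Longrightarrow> 0 \<le> v c \<Longrightarrow> int_poly (synthetic_div p c)"
  by (induction p) (auto intro: int_poly_value)

lemma int_poly_prod_linear: "(\<And>x. x \<in># A \<Longrightarrow> 0 \<le> v x) \<Longrightarrow> int_poly (\<Prod>x\<in>#A. [:- x, 1:])"
  by (induction A) (auto simp del: mult_pCons_left intro!: int_poly_mult)

text \<open>\<open>x - y\<close> divides \<open>p(x) - p(y)\<close> with an integral cofactor,
  obtained by synthetic division.\<close>

lemma int_poly_diff_value:
  assumes "int_poly p" "0 \<le> v x" "0 \<le> v y"
  shows "v (x - y) \<le> v (poly p x - poly p y)"
proof -
  have "poly p x = poly ([:- y, 1:] * synthetic_div p y + [:poly p y:]) x"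
    by (simp only: synthetic_div_correct')
  then have "poly p x - poly p y = poly (synthetic_div p y) x * (x - y)" by (simp add: algebra_simps)
  then show ?thesis using assms by (simp add: v_mult_ge_0 int_poly_value int_poly_synthetic_div)
qed

text \<open>Logarithmic derivative: \<open>f'(a) / f(a)\<close> is the sum of the \<open>1 / (a - r)\<close> over the roots \<open>r\<close>.\<close>

lemma near_root:
  assumes "v (s * poly (pderiv f) a) < v (poly f a)"
  obtains r where "poly f r = 0" "v s < v (a - r)"
proof -
  have f0: "f \<noteq> 0" using assms by auto
  then obtain A c where A: "f = smult c (\<Prod>x\<in>#A. [:- x, 1:])"
    using alg_closed_imp_factorization by metis
  have "\<exists>r\<in>#A. v s < v (a - r)"
  proof (rule ccontr)
    assume "\<not> ?thesis"
    then have "\<And>r. r \<in># A \<Longrightarrow> v (a - r) \<le> v s" by (auto simp: not_less)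
    \<comment> \<open>Denominator-free form of: if each \<open>1 / (a - r)\<close> has value at
      least that of \<open>1 / s\<close>, so has their sum.\<close>
    then have "v (poly (\<Prod>x\<in>#A. [:- x, 1:]) a) \<le> v (s * poly (pderiv (\<Prod>x\<in>#A. [:- x, 1:])) a)"
    proof (induction A)
      case (add r A)
      define Q where "Q = (\<Prod>x\<in>#A. [:- x, 1:])"
      have IH: "v (poly Q a) \<le> v (s * poly (pderiv Q) a)" unfolding Q_def using add by auto
      have "v ((a - r) * poly Q a) \<le> v (s * poly Q a + (a - r) * (s * poly (pderiv Q) a))"
        using add.prems[of r] IH by (intro v_add_ge v_mult_mono) auto
      moreover have "poly ([:- r, 1:] * Q) a = (a - r) * poly Q a"
        "s * poly (pderiv ([:- r, 1:] * Q)) a = s * poly Q a + (a - r) * (s * poly (pderiv Q) a)"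
        unfolding pderiv_linear_mult by (simp_all add: algebra_simps)
      ultimately show ?case by (simp add: Q_def del: mult_pCons_left)
    qed auto
    then have "v (c * poly (\<Prod>x\<in>#A. [:- x, 1:]) a) \<le> v (c * (s * poly (pderiv (\<Prod>x\<in>#A. [:- x, 1:])) a))"
      by (rule v_mult_mono[OF order_refl])
    also have "c * poly (\<Prod>x\<in>#A. [:- x, 1:]) a = poly f a" by (simp add: A)
    also have "c * (s * poly (pderiv (\<Prod>x\<in>#A. [:- x, 1:])) a) = s * poly (pderiv f) a"
      by (simp add: A pderiv_smult mult_ac)
    finally show False using assms by simp
  qed
  then obtain r where r: "r \<in># A" "v s < v (a - r)" by blast
  have "poly f r = 0" using r(1) by (auto simp: A poly_prod_mset prod_mset_zero_iff image_iff intro!: bexI[of _ r])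
  then show ?thesis using r(2) that by blast
qed

lemma hensel_root_exists:
  assumes "0 < v (poly f a)" "v (poly (pderiv f) a) = 0"
  obtains b where "poly f b = 0" "0 < v (b - a)"
  using near_root[of 1 f a] assms by (auto simp: v_minus_commute)

text \<open>The cofactor is a unit on the whole residue disc of \<open>a\<close>, so
  \<open>v (poly f x) = v (x - b)\<close> there. Uniqueness, continuity of the root and the
  convergence of Newton's method all rest on this.\<close>

lemma hensel_root_cofactor:
  assumes f: "int_poly f" and a: "0 \<le> v a" and d: "v (poly (pderiv f) a) = 0"
    and b: "poly f b = 0" "0 < v (b - a)"
  obtains u where "int_poly u" "f = [:- b, 1:] * u" "\<forall>x. 0 < v (x - a) \<longrightarrow> v (poly u x) = 0"
proof -
  have vb: "0 \<le> v b" using v_add_ge[of 0 a "b - a"] a b(2) by simp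
  define u where "u = synthetic_div f b"
  have u: "int_poly u" unfolding u_def by (rule int_poly_synthetic_div[OF f vb])
  have fu: "f = [:- b, 1:] * u" using synthetic_div_correct'[of b f] b(1) by (simp add: u_def)
  have "poly (pderiv f) a = poly u a - (b - a) * poly (pderiv u) a"
    unfolding fu pderiv_linear_mult by (simp add: algebra_simps)
  moreover have "0 < v ((b - a) * poly (pderiv u) a)"
    using v_mult_ge_0[of "poly (pderiv u) a" "b - a"] int_poly_value[OF int_poly_pderiv[OF u] a] b(2)
    by (simp add: mult.commute)
  ultimately have ua: "v (poly u a) = 0"
    using d v_add_eq[of "poly (pderiv f) a" "(b - a) * poly (pderiv u) a"] by simp
  have "v (poly u x) = 0" if x: "0 < v (x - a)" for x
  proof -
    have "0 \<le> v x" using v_add_ge[of 0 a "x - a"] a x by simp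
    then have "v (x - a) \<le> v (poly u x - poly u a)" by (rule int_poly_diff_value[OF u _ a])
    then have "v (poly u a) < v (poly u x - poly u a)" using x ua by simp
    from v_add_eq[OF this] show ?thesis using ua by simp
  qed
  then show ?thesis using that u fu by blast
qed

lemma hensel_root_unique:
  assumes "int_poly f" "0 \<le> v a" "v (poly (pderiv f) a) = 0"
    "poly f b = 0" "0 < v (b - a)" "poly f b' = 0" "0 < v (b' - a)"
  shows "b' = b"
proof -
  obtain u where u: "int_poly u" "f = [:- b, 1:] * u" "\<forall>x. 0 < v (x - a) \<longrightarrow> v (poly u x) = 0"
    using hensel_root_cofactor[OF assms(1-5)] .
  have "poly f b' = (b' - b) * poly u b'" by (simp add: u(2) algebra_simps)
  moreover have "poly u b' \<noteq> 0" using u(3) assms(7) v_eq_0_nonzero by blast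
  ultimately show ?thesis using assms(6) by simp
qed

section \<open>Henselian fields\<close>

lemma poly_over_valuation_ring: "poly_over {x \<in> L. 0 \<le> v x} f \<longleftrightarrow> poly_over L f \<and> int_poly f"
  by (auto simp: poly_over_def int_poly_def)

text \<open>By uniqueness, a Hensel root found anywhere in the ambient field is the one that
  \<open>L\<close> provides.\<close>

lemma henselianD:
  assumes "henselian v L" "poly_over L f" "int_poly f" "a \<in> L" "0 \<le> v a" "v (poly (pderiv f) a) = 0"
    "poly f b = 0" "0 < v (b - a)"
  shows "b \<in> L"
proof -
  have "0 \<le> v b" using v_add_ge[of 0 a "b - a"] assms by simp
  then have "v (b - a) \<le> v (poly f b - poly f a)" using assms by (intro int_poly_diff_value)
  then have "0 < v (poly f a)" using assms by simp
  then obtain b' where "b' \<in> L" "poly f b' = 0" "0 < v (b' - a)"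
    using assms(1-6) unfolding henselian_def poly_over_valuation_ring by blast
  then show ?thesis using hensel_root_unique[OF assms(3,5,6,7,8)] by blast
qed

text \<open>The ambient field is algebraically closed and always contains the Hensel root, so only
  its membership in \<open>L\<close> is at stake.\<close>

lemma henselianI:
  assumes "\<And>f a b. poly_over L f \<Longrightarrow> int_poly f \<Longrightarrow> a \<in> L \<Longrightarrow> 0 \<le> v a \<Longrightarrow> 0 < v (poly f a) \<Longrightarrow>
    v (poly (pderiv f) a) = 0 \<Longrightarrow> poly f b = 0 \<Longrightarrow> 0 < v (b - a) \<Longrightarrow> b \<in> L"
  shows "henselian v L"
  unfolding henselian_def poly_over_valuation_ring
proof (intro allI impI)
  fix f a
  assume *: "(poly_over L f \<and> int_poly f) \<and> a \<in> L \<and> 0 \<le> v a \<and> 0 < v (poly f a) \<and> v (poly (pderiv f) a) = 0"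
  then obtain b where "poly f b = 0" "0 < v (b - a)" using hensel_root_exists by blast
  then show "\<exists>b\<in>L. poly f b = 0 \<and> 0 < v (b - a)" using * assms by blast
qed

lemma henselian_Int_alg_cl:
  assumes F: "subfield F \<Omega>" and L: "henselian v L"
  shows "henselian v (L \<inter> alg_cl F)"
proof (rule henselianI)
  fix f a b assume *: "poly_over (L \<inter> alg_cl F) f" "int_poly f" "a \<in> L \<inter> alg_cl F" "0 \<le> v a"
    "v (poly (pderiv f) a) = 0" "poly f b = 0" "0 < v (b - a)"
  have "f \<noteq> 0" using *(5) v_eq_0_nonzero by fastforce
  then have "b \<in> alg_cl F" using alg_cl_root[OF F poly_over_mono[OF *(1)]] *(6) by blast
  moreover have "b \<in> L" using * henselianD[OF L poly_over_mono[OF *(1)]] by blast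
  ultimately show "b \<in> L \<inter> alg_cl F" by simp
qed

lemma henselian_alg_cl: "subfield F \<Omega> \<Longrightarrow> henselian v (alg_cl F)"
  using henselian_Int_alg_cl[of F UNIV] henselianI[of UNIV] by simp

lemma
  assumes F: "subfield F \<Omega>"
  shows subfield_henselization: "subfield (henselization v F) \<Omega>"
    and henselian_henselization: "henselian v (henselization v F)"
    and subset_henselization: "F \<subseteq> henselization v F"
    and henselization_subset_alg_cl: "henselization v F \<subseteq> alg_cl F"
proof -
  let ?S = "{L. subfield L \<Omega> \<and> F \<subseteq> L \<and> L \<subseteq> alg_cl F \<and> henselian v L}"
  show "subfield (henselization v F) \<Omega>" unfolding henselization_def by (rule subfield_Inter) auto
  show "F \<subseteq> henselization v F" unfolding henselization_def by auto
  have "alg_cl F \<in> ?S" using F henselian_alg_cl subfield_alg_cl subset_alg_cl by auto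
  then show "henselization v F \<subseteq> alg_cl F" unfolding henselization_def by auto
  show "henselian v (henselization v F)"
  proof (rule henselianI)
    fix f a b assume *: "poly_over (henselization v F) f" "int_poly f" "a \<in> henselization v F" "0 \<le> v a"
      "v (poly (pderiv f) a) = 0" "poly f b = 0" "0 < v (b - a)"
    show "b \<in> henselization v F" unfolding henselization_def
    proof (rule InterI)
      fix L assume L: "L \<in> ?S"
      then have "henselization v F \<subseteq> L" by (auto simp: henselization_def)
      then show "b \<in> L" using L * henselianD[OF _ poly_over_mono[OF *(1)]] by blast
    qed
  qed
qed

lemma henselization_least:
  assumes F: "subfield F \<Omega>" and L: "subfield L \<Omega>" "henselian v L" "F \<subseteq> L"
  shows "henselization v F \<subseteq> L"
proof -
  have "subfield (L \<inter> alg_cl F) \<Omega>" using subfield_Int[OF L(1) subfield_alg_cl[OF F]] .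
  then have "henselization v F \<subseteq> L \<inter> alg_cl F"
    unfolding henselization_def using henselian_Int_alg_cl[OF F L(2)] subset_alg_cl[OF F] L(3) by blast
  then show ?thesis by blast
qed

lemma henselization_mono:
  assumes "subfield F \<Omega>" "subfield G \<Omega>" "F \<subseteq> G"
  shows "henselization v F \<subseteq> henselization v G"
  using assms subset_henselization[of G]
  by (intro henselization_least subfield_henselization henselian_henselization) auto

section \<open>Uniqueness of the extension of a henselian valuation\<close>

lemma coeff_prod_linear:
  fixes A :: "'b::field multiset"
  shows "coeff (\<Prod>x\<in>#A. [:- x, 1:]) (size A) = 1"
    "A \<noteq> {#} \<Longrightarrow> coeff (\<Prod>x\<in>#A. [:- x, 1:]) (size A - 1) = - sum_mset A"
proof -
  have d: "Polynomial.degree (\<Prod>x\<in>#A. [:- x, 1:]) \<le> size A" for A :: "'b multiset"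
    by (induction A) (auto intro: order_trans[OF degree_diff_le_max] order_trans[OF degree_smult_le] degree_add_le)
  show 1: "coeff (\<Prod>x\<in>#A. [:- x, 1:]) (size A) = 1" for A :: "'b multiset"
    using d by (induction A) (auto simp: coeff_eq_0 le_imp_less_Suc)
  show "A \<noteq> {#} \<Longrightarrow> coeff (\<Prod>x\<in>#A. [:- x, 1:]) (size A - 1) = - sum_mset A"
  proof (induction A)
    case (add x A)
    show ?case
    proof (cases "A = {#}")
      case False
      then obtain n where n: "size A = Suc n" by (metis size_eq_0_iff_empty not0_implies_Suc)
      have "coeff (\<Prod>x\<in>#A. [:- x, 1:]) (Suc n) = 1" "coeff (\<Prod>x\<in>#A. [:- x, 1:]) n = - sum_mset A"
        using 1[of A] add.IH[OF False] n by auto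
      then show ?thesis by (simp add: n)
    qed simp
  qed simp
qed

lemma v_sum_mset_gt: "z < Pinf \<Longrightarrow> (\<And>x. x \<in># A \<Longrightarrow> z < v x) \<Longrightarrow> z < v (sum_mset A)"
  by (induction A) (auto intro: v_add_gt)

lemma v_prod_mset_eq_0: "(\<And>x. x \<in># A \<Longrightarrow> v (f x) = 0) \<Longrightarrow> v (\<Prod>x\<in>#A. f x) = 0"
  by (induction A) (auto simp: v_mult)

lemma dominant_simple_root_mem:
  assumes L: "subfield L \<Omega>" "henselian v L" and g: "is_minpoly L z g"
    and s: "poly (pderiv g) z \<noteq> 0" and dom: "\<And>z'. poly g z' = 0 \<Longrightarrow> z' \<noteq> z \<Longrightarrow> v z < v z'"
  shows "z \<in> L"
proof (cases "z = 0")
  case False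
  have g0: "poly g z = 0" "poly_over L g" "Polynomial.lead_coeff g = 1" "g \<noteq> 0" using g by (auto simp: is_minpoly_def)
  define B where "B = proots g - {#z#}"
  have z: "z \<in># proots g" using g0 by simp
  then have A: "proots g = add_mset z B" by (simp add: B_def)
  define r where "r = (\<Prod>x\<in>#B. [:- x, 1:])"
  have gr: "g = [:- z, 1:] * r" using monic_eq_prod_proots(1)[OF g0(3)] unfolding A r_def by simp
  have "poly r z \<noteq> 0" using s unfolding gr pderiv_linear_mult by simp
  then have zB: "z \<notin># B" by (auto simp: r_def poly_prod_mset prod_mset_zero_iff)
  have dB: "v z < v x" if "x \<in># B" for x
  proof (rule dom)
    have "x \<in># proots g" using that A by simp
    then show "poly g x = 0" using g0(4) by simp
  qed (use zB that in auto)
  have vz: "v z < Pinf" using False v_eq_Pinf[of z] by (cases "v z") (auto simp del: v_eq_Pinf)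
  \<comment> \<open>The sum of all roots lies in \<open>L\<close> and, \<open>z\<close> being
    dominant, has the value of \<open>z\<close>. Dividing all roots by \<open>e\<close> gives
    \<open>z\<close> the residue 1 and the others the residue 0, so 1 is a simple zero of the
    reduction of \<open>f\<close>.\<close>
  define e where "e = z + sum_mset B"
  have vS: "v z < v (sum_mset B)" using v_sum_mset_gt[OF vz] dB by blast
  then have ve: "v e = v z" unfolding e_def by (rule v_add_eq)
  then have e0: "e \<noteq> 0" using False v_eq_Pinf by metis
  have "coeff (\<Prod>x\<in>#proots g. [:- x, 1:]) (size (proots g) - 1) = - sum_mset (proots g)"
    by (rule coeff_prod_linear(2)) (simp add: A)
  then have "coeff g (Polynomial.degree g - 1) = - e"
    unfolding monic_eq_prod_proots(1)[OF g0(3), symmetric] monic_eq_prod_proots(2)[OF g0(3)] by (simp add: A e_def)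
  then have eL: "e \<in> L" using g0(2) subfield_minus[OF L(1), of "- e"] by (metis minus_minus poly_over_def)
  define f where "f = (\<Prod>x\<in>#proots g. [:- (x / e), 1:])"
  have "pcompose (\<Prod>x\<in>#A. [:- x, 1:]) [:0, e:] = smult (e ^ size A) (\<Prod>x\<in>#A. [:- (x / e), 1:])" for A
  proof (induction A)
    case (add x A)
    have "pcompose [:- x, 1:] [:0, e:] = smult e [:- (x / e), 1:]" using e0 by (simp add: pcompose_pCons)
    then show ?case using add
      by (simp only: image_mset_add_mset prod_mset.add_mset size_add_mset pcompose_mult power_Suc
          mult_smult_left mult_smult_right smult_smult mult.commute)
  qed (simp add: pcompose_1)
  from this[of "proots g"] have "pcompose g [:0, e:] = smult (e ^ size (proots g)) f"
    using monic_eq_prod_proots(1)[OF g0(3)] by (simp add: f_def)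
  then have "f = smult (inverse (e ^ size (proots g))) (pcompose g [:0, e:])" using e0 by simp
  then have fL: "poly_over L f" using g0(2) eL
    by (auto intro!: poly_over_smult[OF L(1)] poly_over_pcompose[OF L(1)] subfield_inverse[OF L(1)] subfield_power[OF L(1)]
        simp: poly_over_pCons[OF L(1)] poly_over_0[OF L(1)] subfield_0[OF L(1)])
  have ge: "0 \<le> v (x / e)" if "v z \<le> v x" for x using v_le_divide_iff[OF e0, of 1 x] that ve by simp
  have gB: "0 < v (x / e)" if "v z < v x" for x using v_less_divide_iff[OF e0, of 1 x] that ve by simp
  define r' where "r' = (\<Prod>x\<in>#B. [:- (x / e), 1:])"
  have "0 \<le> v x" if "x \<in># image_mset (\<lambda>x. x / e) B" for x
    using that dB ge by (auto simp: less_imp_le)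
  then have i1: "int_poly r'" unfolding r'_def
    using int_poly_prod_linear[of "image_mset (\<lambda>x. x / e) B"] by (simp add: image_mset.compositionality o_def)
  have ff: "f = [:- (z / e), 1:] * r'" by (simp add: f_def A r'_def)
  have i2: "int_poly f" unfolding ff using ge[of z] i1 by (intro int_poly_mult) auto
  have "v (1 - x / e) = 0" if "x \<in># B" for x using v_diff_eq[of 1 "x / e"] gB[OF dB[OF that]] by simp
  then have r1: "v (poly r' 1) = 0" unfolding r'_def by (simp add: poly_prod_mset v_prod_mset_eq_0)
  have ze: "0 < v (z / e - 1)"
  proof -
    have "z / e - 1 = - (sum_mset B / e)" using e0 by (simp add: e_def field_simps)
    then show ?thesis using gB[OF vS] by simp
  qed
  have "poly (pderiv f) 1 = poly r' 1 - (z / e - 1) * poly (pderiv r') 1"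
    unfolding ff pderiv_linear_mult by (simp add: algebra_simps)
  moreover have "0 < v ((z / e - 1) * poly (pderiv r') 1)"
    using v_mult_ge_0[of "poly (pderiv r') 1" "z / e - 1"] int_poly_value[OF int_poly_pderiv[OF i1], of 1] ze
    by (simp add: mult.commute)
  ultimately have "v (poly (pderiv f) 1) = 0" using r1 v_diff_eq[of "poly r' 1"] by simp
  then have "z / e \<in> L"
    using henselianD[OF L(2) fL i2 subfield_1[OF L(1)], of "z / e"] ze by (simp add: ff)
  then show ?thesis using subfield_mult[OF L(1) _ eL, of "z / e"] e0 by simp
qed (simp add: subfield_0[OF L(1)])

text \<open>Powers preserve strict inequalities of values, so dominance passes to a separable
  Frobenius power.\<close>

lemma dominant_imp_perf_cl:
  assumes L: "subfield L \<Omega>" "henselian v L" and y: "y \<in> alg_cl L"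
    and dom: "\<And>z. conjugate L y z \<Longrightarrow> z \<noteq> y \<Longrightarrow> v y < v z"
  shows "y \<in> perf_cl L"
proof -
  obtain n h where h: "poly_over L h" "poly h ((frob ^^ n) y) = 0" "poly (pderiv h) ((frob ^^ n) y) \<noteq> 0"
    using frob_separable[OF L(1) y] .
  define w where "w = (frob ^^ n) y"
  have "w \<in> alg_cl L" unfolding w_def by (rule frob_closed[OF subfield_alg_cl[OF L(1)] y])
  then obtain g where g: "is_minpoly L w g" using minpoly_exists[OF L(1)] by blast
  obtain k where k: "k > 0" "\<And>x :: 'a. (frob ^^ n) x = x ^ k" using frob_funpow_power[of n] by blast
  have "w \<in> L"
  proof (rule dominant_simple_root_mem[OF L g])
    show "poly (pderiv g) w \<noteq> 0" using is_minpoly_simple[OF L(1) g h(1)] h g by (auto simp: w_def is_minpoly_def)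
    fix z assume z: "poly g z = 0" "z \<noteq> w"
    then have "conjugate L ((frob ^^ n) y) z" using conjugate_iff_minpoly_root[OF L(1) g] by (simp add: w_def)
    then obtain y' where y': "conjugate L y y'" "z = (frob ^^ n) y'" using conjugate_frob[OF L(1) y] by blast
    then have "v y < v y'" using dom z by (auto simp: w_def)
    then show "v w < v z" using v_power_strict k y'(2) by (simp add: w_def)
  qed
  then show ?thesis by (auto simp: perf_cl_def w_def)
qed

lemma v_prod_mset_ge: "(\<And>x. x \<in># B \<Longrightarrow> v m \<le> v x) \<Longrightarrow> v (m ^ size B) \<le> v (prod_mset B)"
  by (induction B) (auto intro!: v_mult_mono)

lemma v_prod_mset_eq: "(\<And>x. x \<in># B \<Longrightarrow> v x = v m) \<Longrightarrow> v (prod_mset B) = v (m ^ size B)"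
  by (induction B) (auto simp: v_mult)

lemma v_prod_mset_gt:
  assumes "\<And>x. x \<in># B \<Longrightarrow> v m \<le> v x" "y \<in># B" "v m < v y"
  shows "v (m ^ size B) < v (prod_mset B)"
proof -
  obtain C where C: "B = add_mset y C" using assms(2) by (meson mset_add)
  have "m \<noteq> 0" using assms(3) by auto
  then show ?thesis using assms C v_mult_strict[OF assms(3), of "m ^ size C" "prod_mset C"] v_prod_mset_ge[of C m] by auto
qed

text \<open>
  The product \<open>\<beta>\<close> of the conjugates of least value is strictly dominated by each of its other
  conjugates, hence purely inseparable over \<open>L\<close>; but an embedding that moves one of these factors
  to a conjugate of larger value raises the value of \<open>\<beta>\<close>.
\<close>

lemma conjugate_value_eq:
  assumes L: "subfield L \<Omega>" "henselian v L" and y: "y \<in> alg_cl L" and c: "conjugate L y y'"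
  shows "v y' = v y"
proof (rule ccontr)
  assume ne: "v y' \<noteq> v y"
  obtain g where g: "is_minpoly L y g" using minpoly_exists[OF L(1) y] .
  have g0: "poly g y = 0" "poly_over L g" "Polynomial.lead_coeff g = 1" "g \<noteq> 0" using g by (auto simp: is_minpoly_def)
  define A where "A = proots g"
  have yA: "y \<in># A" "y' \<in># A" using c conjugate_iff_minpoly_root[OF L(1) g] g0 by (auto simp: A_def)
  have conjA: "conjugate L x x'" if "x \<in># A" "x' \<in># A" for x x'
    using that conjugate_iff_minpoly_root[OF L(1) is_minpoly_root[OF L(1) g]] g0(4) by (simp add: A_def)
  have "\<exists>m\<in>set_mset A. \<forall>x\<in>set_mset A. v m \<le> v x"
    
  proof -
    have "A \<noteq> {#}" using yA by auto
    then show ?thesis using ex_min_if_finite[of "v ` set_mset A"] by (auto simp: not_less)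
  qed
  then obtain m where m: "m \<in># A" "\<And>x. x \<in># A \<Longrightarrow> v m \<le> v x" by blast
  obtain Y where Y: "Y \<in># A" "v m < v Y"
    using m(2)[OF yA(1)] m(2)[OF yA(2)] ne yA by (metis order_le_less)
  have m0: "m \<noteq> 0" using Y(2) by auto
  define B where "B = filter_mset (\<lambda>x. v x = v m) A"
  define \<beta> where "\<beta> = prod_mset B"
  have v\<beta>: "v \<beta> = v (m ^ size B)" unfolding \<beta>_def by (rule v_prod_mset_eq) (auto simp: B_def)
  have AC: "set_mset A \<subseteq> alg_cl L" using conjugate_alg_cl[OF L(1) y] conjA[OF yA(1)] by auto
  have key: "\<tau> \<beta> = \<beta> \<or> v \<beta> < v (\<tau> \<beta>)" "(\<exists>x\<in>#B. v m < v (\<tau> x)) \<Longrightarrow> v \<beta> < v (\<tau> \<beta>)"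
    if M: "subfield M \<Omega>" "L \<subseteq> M" "set_mset A \<subseteq> M" "hom_on M \<tau>" "\<forall>x\<in>L. \<tau> x = x" for M \<tau>
  proof -
    have BA: "B \<subseteq># A" by (simp add: B_def)
    have BM: "\<And>x. x \<in># B \<Longrightarrow> x \<in> M" using M(3) by (auto simp: B_def)
    have t: "\<tau> \<beta> = prod_mset (image_mset \<tau> B)"
      unfolding \<beta>_def using hom_on_prod_mset[OF M(1,4), of B "\<lambda>x. x"] BM by simp
    have "image_mset \<tau> A = A"
      unfolding A_def using M g0 by (intro image_mset_hom_on_proots[of M \<tau> L]) (auto simp: A_def)
    then have sub: "image_mset \<tau> B \<subseteq># A" using image_mset_subseteq_mono[OF BA] by metis
    have ge: "\<And>x. x \<in># image_mset \<tau> B \<Longrightarrow> v m \<le> v x" using mset_subset_eqD[OF sub] m(2) by blast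
    show gt: "v \<beta> < v (\<tau> \<beta>)" if larger: "\<exists>x\<in>#B. v m < v (\<tau> x)"
    proof -
      obtain x where "x \<in># B" "v m < v (\<tau> x)" using larger by blast
      then show ?thesis using v_prod_mset_gt[of "image_mset \<tau> B" m "\<tau> x"] ge t v\<beta> by simp
    qed
    show "\<tau> \<beta> = \<beta> \<or> v \<beta> < v (\<tau> \<beta>)"
    proof (cases "\<exists>x\<in>#B. v m < v (\<tau> x)")
      \<comment> \<open>If no factor gains value, \<open>\<tau>\<close> maps \<open>B\<close> into
        the roots of least value, that is, into \<open>B\<close>; by counting it permutes
        \<open>B\<close>.\<close>
      case False
      then have "\<And>x. x \<in># image_mset \<tau> B \<Longrightarrow> v x = v m" using ge by (force simp: order_le_less)
      then have "filter_mset (\<lambda>x. v x = v m) (image_mset \<tau> B) = image_mset \<tau> B" by (simp add: filter_mset_eq_conv)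
      then have "image_mset \<tau> B \<subseteq># B" unfolding B_def[of] using multiset_filter_mono[OF sub] by (metis B_def)
      then have "image_mset \<tau> B = B" by (metis mset_subset_size size_image_mset subset_mset.le_neq_trans less_irrefl)
      then show ?thesis using t \<beta>_def by simp
    qed (use gt in blast)
  qed
  have \<beta>C: "\<beta> \<in> alg_cl L"
  proof -
    have "set_mset B \<subseteq> alg_cl L" using AC by (auto simp: B_def)
    then show ?thesis unfolding \<beta>_def
      by (induction B) (auto intro: subfield_closed[OF subfield_alg_cl[OF L(1)]])
  qed
  have "\<beta> \<in> perf_cl L"
  proof (rule dominant_imp_perf_cl[OF L \<beta>C])
    fix z assume z: "conjugate L \<beta> z" "z \<noteq> \<beta>"
    obtain M \<tau> where M: "subfield M \<Omega>" "L \<subseteq> M" "\<beta> \<in> M" "set_mset A \<subseteq> M" "hom_on M \<tau>" "\<forall>x\<in>L. \<tau> x = x" "\<tau> \<beta> = z"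
      using conjugate_extend[OF L(1) \<beta>C z(1) finite_set_mset AC] .
    then show "v \<beta> < v z" using key(1)[OF M(1,2,4,5,6)] z(2) by auto
  qed
  then obtain n where n: "(frob ^^ n) \<beta> \<in> L" by (auto simp: perf_cl_def)
  obtain k where k: "k > 0" "\<And>x :: 'a. (frob ^^ n) x = x ^ k" using frob_funpow_power[of n] by blast
  have mC: "m \<in> alg_cl L" using m AC by auto
  \<comment> \<open>This embedding raises the value of one factor of \<open>\<beta>\<close>, yet it
    fixes a power of \<open>\<beta>\<close>, which lies in \<open>L\<close>.\<close>
  obtain M \<tau> where M: "subfield M \<Omega>" "L \<subseteq> M" "m \<in> M" "set_mset A \<subseteq> M" "hom_on M \<tau>" "\<forall>x\<in>L. \<tau> x = x" "\<tau> m = Y"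
    using conjugate_extend[OF L(1) mC conjA[OF m(1) Y(1)] finite_set_mset AC] .
  have "m \<in># B" using m by (simp add: B_def)
  then have "v \<beta> < v (\<tau> \<beta>)" using key(2)[OF M(1,2,4,5,6)] Y(2) M(7) by blast
  then have "v (\<beta> ^ k) < v (\<tau> \<beta> ^ k)" using v_power_strict k(1) by blast
  moreover have "\<beta> \<in> M"
  proof -
    have "set_mset B \<subseteq> M" using M(4) by (auto simp: B_def)
    then show ?thesis unfolding \<beta>_def by (induction B) (auto intro: subfield_closed[OF M(1)])
  qed
  then have "\<tau> \<beta> ^ k = \<tau> (\<beta> ^ k)" using hom_on_power[OF M(1,5)] by simp
  moreover have "\<tau> (\<beta> ^ k) = \<beta> ^ k" using n k(2) M(6) by simp
  ultimately show False by simp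
qed

text \<open>Conjugates over \<open>E\<close> are conjugates over the henselian \<open>L\<close>, so
  each is as close to \<open>b0\<close> as \<open>b\<close> is, hence too close to \<open>b\<close>
  to differ from it. The two fields are kept apart because the lemma is applied to an
  \<open>E\<close> that is not shown to be henselian.\<close>

lemma krasner:
  assumes L: "subfield L \<Omega>" "henselian v L" and E: "subfield E \<Omega>" "L \<subseteq> E"
    and b: "b \<in> alg_cl L" and b0: "b0 \<in> E" "b0 \<in> alg_cl L"
    and near: "\<And>b'. conjugate E b b' \<Longrightarrow> b' \<noteq> b \<Longrightarrow> v (b - b') < v (b - b0)"
  shows "b \<in> perf_cl E"
proof (rule unique_conjugate_imp_perf_cl[OF E(1)])
  show "b \<in> alg_cl E" using b alg_cl_mono[OF E(2)] by auto
  fix z assume z: "conjugate E b z"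
  show "z = b"
  proof (rule ccontr)
    assume "z \<noteq> b"
    have "conjugate L (b - b0) (z - b0)" using conjugate_mono[OF E(2) conjugate_diff[OF E(1) z b0(1)]] .
    then have "v (z - b0) = v (b - b0)"
      using conjugate_value_eq[OF L] subfield_diff[OF subfield_alg_cl[OF L(1)] b b0(2)] by blast
    then have "v (b - b0) \<le> v ((b - b0) - (z - b0))" by (intro v_diff_ge[of _ "b - b0" "z - b0"]) auto
    then show False using near[OF z \<open>z \<noteq> b\<close>] by simp
  qed
qed

text \<open>A maximal field not containing \<open>b\<close> is henselian, as Hensel roots are separable.\<close>

lemma henselization_no_inseparable:
  assumes N: "subfield N \<Omega>" and b: "b \<in> henselization v N" "frob b \<in> N"
  shows "b \<in> N"
proof (rule ccontr)
  assume bN: "b \<notin> N"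
  define S where "S = {M. subfield M \<Omega> \<and> N \<subseteq> M \<and> M \<subseteq> alg_cl N \<and> b \<notin> M}"
  have "\<exists>M\<in>S. \<forall>M'\<in>S. M \<subseteq> M' \<longrightarrow> M' = M"
  proof (rule subset_Zorn_nonempty)
    show "S \<noteq> {}" using N bN subset_alg_cl[OF N] by (auto simp: S_def)
    fix C assume C: "C \<noteq> {}" "subset.chain S C"
    have CS: "subfield M \<Omega>" "N \<subseteq> M" "M \<subseteq> alg_cl N" "b \<notin> M" if "M \<in> C" for M
      using C(2) that by (auto simp: subset.chain_def S_def)
    have dir: "\<exists>M\<in>C. x \<in> M \<and> y \<in> M" if xy: "x \<in> \<Union>C" "y \<in> \<Union>C" for x y
    proof -
      obtain M1 M2 where M: "M1 \<in> C" "x \<in> M1" "M2 \<in> C" "y \<in> M2" using xy by blast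
      then have "M1 \<subseteq> M2 \<or> M2 \<subseteq> M1" using C(2) unfolding subset_chain_def by blast
      then show ?thesis using M by blast
    qed
    obtain M0 where M0: "M0 \<in> C" using C(1) by blast
    have "subfield (\<Union>C) \<Omega>"
    proof (rule subfieldI_Amb)
      show "1 \<in> \<Union>C" using M0 subfield_1[OF CS(1)[OF M0]] by blast
      show "inverse x \<in> \<Union>C" if "x \<in> \<Union>C" for x using that subfield_inverse[OF CS(1)] by blast
      fix x y assume "x \<in> \<Union>C" "y \<in> \<Union>C"
      then obtain M where M: "M \<in> C" "x \<in> M" "y \<in> M" using dir by blast
      show "x - y \<in> \<Union>C" "x * y \<in> \<Union>C"
        using M subfield_diff[OF CS(1)[OF M(1)] M(2,3)] subfield_mult[OF CS(1)[OF M(1)] M(2,3)] by blast+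
    qed
    moreover have "N \<subseteq> \<Union>C" using CS(2)[OF M0] M0 by blast
    moreover have "\<Union>C \<subseteq> alg_cl N" using CS(3) by blast
    moreover have "b \<notin> \<Union>C" using CS(4) by blast
    ultimately show "\<Union>C \<in> S" by (simp add: S_def)
  qed
  then obtain M where M: "subfield M \<Omega>" "N \<subseteq> M" "M \<subseteq> alg_cl N" "b \<notin> M"
    and max: "\<And>M'. M' \<in> S \<Longrightarrow> M \<subseteq> M' \<Longrightarrow> M' = M" by (auto simp: S_def)
  have "henselian v M"
  proof (rule henselianI, rule ccontr)
    fix f a \<beta> assume f: "poly_over M f" "int_poly f" "a \<in> M" "0 \<le> v a" "v (poly (pderiv f) a) = 0"
      "poly f \<beta> = 0" "0 < v (\<beta> - a)" and nM: "\<beta> \<notin> M"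
    have v\<beta>: "0 \<le> v \<beta>" using v_add_ge[of 0 a "\<beta> - a"] f(4,7) by simp
    have "v (\<beta> - a) \<le> v (poly (pderiv f) \<beta> - poly (pderiv f) a)"
      by (rule int_poly_diff_value[OF int_poly_pderiv[OF f(2)] v\<beta> f(4)])
    then have s: "poly (pderiv f) \<beta> \<noteq> 0" using f(5,7) by auto
    then have "f \<noteq> 0" by auto
    then have \<beta>: "\<beta> \<in> alg_cl N"
      using alg_cl_root[OF N poly_over_mono[OF f(1) M(3)]] f(6) by blast
    then have \<beta>M: "\<beta> \<in> alg_cl M" using alg_cl_mono[OF M(2)] by blast
    have "sext M \<beta> \<subseteq> alg_cl N" unfolding sext_def
      using poly_closed[OF subfield_alg_cl[OF N] poly_over_mono[OF _ M(3)] \<beta>] by blast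
    \<comment> \<open>By maximality a Hensel root outside \<open>M\<close> generates a field
      containing \<open>b\<close>. That extension is separable while \<open>frob b\<close> lies in
      \<open>M\<close>, so \<open>b\<close> would already be in \<open>M\<close>.\<close>
    then have "b \<in> sext M \<beta>"
      using max[of "sext M \<beta>"] subfield_sext[OF M(1) \<beta>M] subset_sext[OF M(1), of \<beta>] sext_mem[OF M(1), of \<beta>] nM M(2)
      by (auto simp: S_def)
    then have "b \<in> M" using frob_mem_imp_mem_of_separable_sext[OF M(1) f(1,6) s] b(2) M(2) by blast
    then show False using M(4) by blast
  qed
  then show False using henselization_least[OF N M(1) _ M(2)] b(1) M(4) by blast
qed

text \<open>Frobenius powers are removed one at a time: once \<open>frob b\<close> is in
  \<open>D\<close>, \<open>b\<close> lies in \<open>D(X)\<close>, whose elements algebraic over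
  \<open>F\<close> lie in \<open>D\<close>.\<close>

lemma henselization_adjoin_perf_cl:
  assumes F: "subfield F \<Omega>" and X: "X \<notin> alg_cl F" and D: "subfield D \<Omega>" "D \<subseteq> alg_cl F"
    and b: "b \<in> henselization v (adjoin D X)" "b \<in> alg_cl F" "b \<in> perf_cl D"
  shows "b \<in> D"
proof -
  have "b \<in> D" if "(frob ^^ n) b \<in> D" "b \<in> henselization v (adjoin D X)" "b \<in> alg_cl F" for n using that
  proof (induction n arbitrary: b)
    case (Suc n)
    have f: "frob b \<in> henselization v (adjoin D X)" "frob b \<in> alg_cl F"
      using frob_closed[OF subfield_henselization[OF subfield_gen] Suc.prems(2), of 1]
        frob_closed[OF subfield_alg_cl[OF F] Suc.prems(3), of 1] by simp_all
    have "frob b \<in> D" using Suc.IH[OF _ f] Suc.prems(1) by (simp add: funpow_swap1)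
    then have "b \<in> adjoin D X"
      using henselization_no_inseparable[OF subfield_gen Suc.prems(2)] subset_adjoin by blast
    then show ?case by (rule adjoin_Int_alg_cl[OF F X D Suc.prems(3)])
  qed simp
  then show ?thesis using b by (auto simp: perf_cl_def)
qed

section \<open>Closures\<close>

text \<open>Infinitesimal over \<open>K\<close>. Bounds are given by nonzero elements of
  \<open>K\<close> instead of values, so that they can be multiplied and inverted within
  \<open>K\<close>.\<close>

definition small :: "'a set \<Rightarrow> 'a \<Rightarrow> bool"
  where "small K x \<longleftrightarrow> (\<forall>\<kappa>\<in>K. \<kappa> \<noteq> 0 \<longrightarrow> v \<kappa> < v x)"

text \<open>The bounded elements form a ring in which the infinitesimal ones are an ideal.\<close>

definition bdd :: "'a set \<Rightarrow> 'a \<Rightarrow> bool"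
  where "bdd K x \<longleftrightarrow> (\<exists>\<kappa>\<in>K. \<kappa> \<noteq> 0 \<and> v \<kappa> \<le> v x)"

definition cofinal_in :: "'a set \<Rightarrow> 'a set \<Rightarrow> bool"
  where "cofinal_in K T \<longleftrightarrow> (\<forall>y\<in>T. y \<noteq> 0 \<longrightarrow> (\<exists>\<kappa>\<in>K. \<kappa> \<noteq> 0 \<and> v y < v \<kappa>))"

text \<open>\<open>K\<close> supplies the precisions, \<open>L\<close> the approximants,
  \<open>T\<close> the elements approximated. \<open>L\<close> need not lie in \<open>T\<close>: the
  henselization of \<open>K(X)\<close> is to approximate elements algebraic over
  \<open>F\<close>.\<close>

definition vclosure :: "'a set \<Rightarrow> 'a set \<Rightarrow> 'a set \<Rightarrow> 'a set"
  where "vclosure K L T = {y \<in> T. \<forall>\<kappa>\<in>K. \<kappa> \<noteq> 0 \<longrightarrow> (\<exists>l\<in>L. v \<kappa> < v (y - l))}"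

lemma vclosureD: "y \<in> vclosure K L T \<Longrightarrow> \<kappa> \<in> K \<Longrightarrow> \<kappa> \<noteq> 0 \<Longrightarrow> \<exists>l\<in>L. v \<kappa> < v (y - l)"
  by (auto simp: vclosure_def)

lemma v_less_0 [simp]: "v \<kappa> < Pinf \<longleftrightarrow> \<kappa> \<noteq> 0"
  using v_eq_Pinf[of \<kappa>] v_not_Minf[of \<kappa>] by (cases "v \<kappa>") (auto simp del: v_eq_Pinf v_not_Minf)

lemma Int_subset_vclosure: "L \<inter> T \<subseteq> vclosure K L T"
  by (auto simp: vclosure_def intro!: bexI)

lemma cofinal_bdd:
  assumes K: "subfield K \<Omega>" and T: "subfield T \<Omega>" and co: "cofinal_in K T" and x: "x \<in> T"
  shows "bdd K x"
proof (cases "x = 0")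
  case True
  then show ?thesis using subfield_1[OF K] by (auto simp: bdd_def intro!: bexI[of _ 1])
next
  case False
  obtain \<kappa> where \<kappa>: "\<kappa> \<in> K" "\<kappa> \<noteq> 0" "v (inverse x) < v \<kappa>"
    using co subfield_inverse[OF T x] False unfolding cofinal_in_def by (metis nonzero_imp_inverse_nonzero)
  then have "v (inverse \<kappa>) \<le> v x" using v_inverse_le_iff[of \<kappa> "inverse x"] False by simp
  then show ?thesis unfolding bdd_def
    using subfield_inverse[OF K \<kappa>(1)] \<kappa>(2) by (intro bexI[of _ "inverse \<kappa>"]) auto
qed

lemma bdd_mult: assumes K: "subfield K \<Omega>" shows "bdd K x \<Longrightarrow> bdd K y \<Longrightarrow> bdd K (x * y)"
  unfolding bdd_def using subfield_mult[OF K] v_mult_mono by (metis mult_eq_0_iff)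

lemma bdd_add: "bdd K x \<Longrightarrow> bdd K y \<Longrightarrow> bdd K (x + y)"
  unfolding bdd_def using v_add_ge[of _ x y] by (metis linear order_trans)

lemma bdd_poly:
  assumes K: "subfield K \<Omega>" and p: "\<And>i. bdd K (coeff p i)" and x: "bdd K x"
  shows "bdd K (poly p x)"
  using p
proof (induction p)
  case 0
  then show ?case by simp
next
  case (pCons a p)
  have "bdd K a" "\<And>i. bdd K (coeff p i)" using pCons.prems[of 0] pCons.prems[of "Suc _"] by auto
  then show ?case using pCons.IH bdd_add bdd_mult[OF K x] by simp
qed

lemma bdd_ge_0: "subfield K \<Omega> \<Longrightarrow> 0 \<le> v x \<Longrightarrow> bdd K x"
  unfolding bdd_def using subfield_1 by (intro bexI[of _ 1]) auto

lemma small_add: "small K x \<Longrightarrow> small K y \<Longrightarrow> small K (x + y)"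
  and small_diff: "small K x \<Longrightarrow> small K y \<Longrightarrow> small K (x - y)"
  by (auto simp: small_def intro: v_add_gt v_diff_gt)

lemma small_0: "small K 0"
  by (simp add: small_def)

lemma small_minus_commute: "small K (x - y) \<Longrightarrow> small K (y - x)"
  by (simp add: small_def v_minus_commute)

lemma small_mult:
  assumes K: "subfield K \<Omega>" and x: "small K x" and y: "bdd K y"
  shows "small K (x * y)"
  unfolding small_def
proof (intro ballI impI)
  fix \<kappa> assume \<kappa>: "\<kappa> \<in> K" "\<kappa> \<noteq> 0"
  obtain \<rho> where \<rho>: "\<rho> \<in> K" "\<rho> \<noteq> 0" "v \<rho> \<le> v y" using y by (auto simp: bdd_def)
  have "v (\<kappa> / \<rho>) < v x" using x \<kappa> \<rho> subfield_divide[OF K] by (simp add: small_def)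
  then have "v (\<kappa> / \<rho> * \<rho>) < v (x * y)" using \<rho> by (intro v_mult_strict)
  then show "v \<kappa> < v (x * y)" using \<rho> by simp
qed

lemma small_mono: "small K x \<Longrightarrow> v x \<le> v y \<Longrightarrow> small K y"
  unfolding small_def by (meson less_le_trans)

lemma small_bdd: "subfield K \<Omega> \<Longrightarrow> small K x \<Longrightarrow> bdd K x"
  using subfield_1[of K] by (auto simp: small_def bdd_def intro!: bexI[of _ 1] less_imp_le)

lemma small_pos: "subfield K \<Omega> \<Longrightarrow> small K x \<Longrightarrow> 0 < v x"
  using subfield_1[of K] by (auto simp: small_def dest!: bspec[of _ _ 1])

lemma subfield_vclosure:
  assumes K: "subfield K \<Omega>" and L: "subfield L \<Omega>" and T: "subfield T \<Omega>" and co: "cofinal_in K T"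
  shows "subfield (vclosure K L T) \<Omega>"
proof (rule subfieldI_Amb)
  show "1 \<in> vclosure K L T" using Int_subset_vclosure subfield_1[OF L] subfield_1[OF T] by blast
  fix x assume x: "x \<in> vclosure K L T"
  then have xT: "x \<in> T" by (simp add: vclosure_def)
  {
    assume x0: "x \<noteq> 0"
    obtain \<tau> where \<tau>: "\<tau> \<in> K" "\<tau> \<noteq> 0" "v x < v \<tau>" using co xT x0 by (auto simp: cofinal_in_def)
    have "\<exists>l\<in>L. v \<kappa> < v (inverse x - l)" if \<kappa>: "\<kappa> \<in> K" "\<kappa> \<noteq> 0" for \<kappa>
    proof -
      \<comment> \<open>\<open>1/x - 1/l = (l - x) / (x * l)\<close>, so precision
        \<open>\<kappa> * \<tau> * \<tau>\<close> suffices once \<open>v l = v x\<close>; precision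
        \<open>\<tau>\<close> ensures the latter.\<close>
      define \<mu> where "\<mu> = (if v \<tau> \<le> v (\<kappa> * \<tau> * \<tau>) then \<kappa> * \<tau> * \<tau> else \<tau>)"
      have \<mu>: "\<mu> \<in> K" "\<mu> \<noteq> 0" "v \<tau> \<le> v \<mu>" "v (\<kappa> * \<tau> * \<tau>) \<le> v \<mu>"
        using \<kappa> \<tau> subfield_mult[OF K] by (auto simp: \<mu>_def)
      obtain l where l: "l \<in> L" "v \<mu> < v (x - l)" using vclosureD[OF x \<mu>(1,2)] by blast
      have "v x < v (x - l)" using \<tau>(3) \<mu>(3) l(2) by order
      then have vl: "v l = v x" by (rule v_eq_of_diff)
      then have l0: "l \<noteq> 0" using x0 v_eq_Pinf by metis
      have "v (\<kappa> * x * l) \<le> v (\<kappa> * \<tau> * \<tau>)" using \<tau>(3) vl by (intro v_mult_mono) auto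
      then have "v (\<kappa> * x * l) < v (x - l)" using \<mu>(4) l(2) by order
      then have "v \<kappa> < v ((l - x) / (x * l))"
        using v_less_divide_iff[of "x * l" \<kappa> "l - x"] x0 l0 by (simp add: v_minus_commute mult.assoc)
      also have "(l - x) / (x * l) = inverse x - inverse l" using x0 l0 by (simp add: field_simps)
      finally show ?thesis using subfield_inverse[OF L l(1)] by blast
    qed
    then show "inverse x \<in> vclosure K L T" using subfield_inverse[OF T xT] by (simp add: vclosure_def)
  }
  fix y assume y: "y \<in> vclosure K L T"
  then have yT: "y \<in> T" by (simp add: vclosure_def)
  have "\<exists>l\<in>L. v \<kappa> < v (x - y - l)" if \<kappa>: "\<kappa> \<in> K" "\<kappa> \<noteq> 0" for \<kappa>
  proof -
    obtain l m where "l \<in> L" "v \<kappa> < v (x - l)" "m \<in> L" "v \<kappa> < v (y - m)" using vclosureD[OF x \<kappa>] vclosureD[OF y \<kappa>] by blast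
    then show ?thesis using v_diff_gt[of "v \<kappa>" "x - l" "y - m"] subfield_diff[OF L]
      by (intro bexI[of _ "l - m"]) (auto simp: algebra_simps)
  qed
  then show "x - y \<in> vclosure K L T" using subfield_diff[OF T xT yT] by (simp add: vclosure_def)
  have "\<exists>l\<in>L. v \<kappa> < v (x * y - l)" if \<kappa>: "\<kappa> \<in> K" "\<kappa> \<noteq> 0" for \<kappa>
  proof -
    obtain \<rho> where \<rho>: "\<rho> \<in> K" "\<rho> \<noteq> 0" "v \<rho> \<le> v x" using cofinal_bdd[OF K T co xT] by (auto simp: bdd_def)
    obtain \<sigma> where \<sigma>: "\<sigma> \<in> K" "\<sigma> \<noteq> 0" "v \<sigma> \<le> v y" using cofinal_bdd[OF K T co yT] by (auto simp: bdd_def)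
    \<comment> \<open>In \<open>x * y - l * m = (x - l) * m + (y - m) * x\<close>, precision
      \<open>\<kappa> / \<rho>\<close> handles the second term, and precision
      \<open>\<sigma>\<close> gives the bound \<open>v \<sigma> \<le> v m\<close> for the
      first.\<close>
    define \<mu> where "\<mu> = (if v \<sigma> \<le> v (\<kappa> / \<rho>) then \<kappa> / \<rho> else \<sigma>)"
    have \<mu>: "\<mu> \<in> K" "\<mu> \<noteq> 0" "v \<sigma> \<le> v \<mu>" "v (\<kappa> / \<rho>) \<le> v \<mu>"
      using \<kappa> \<rho> \<sigma> subfield_divide[OF K] by (auto simp: \<mu>_def)
    obtain m where m: "m \<in> L" "v \<mu> < v (y - m)" using vclosureD[OF y \<mu>(1,2)] by blast
    have vm: "v \<sigma> \<le> v m" using v_diff_ge[of "v \<sigma>" y "y - m"] \<sigma>(3) \<mu>(3) m(2) by simp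
    have "\<kappa> / \<sigma> \<in> K" "\<kappa> / \<sigma> \<noteq> 0" using \<kappa> \<sigma> subfield_divide[OF K] by auto
    then obtain l where l: "l \<in> L" "v (\<kappa> / \<sigma>) < v (x - l)" using vclosureD[OF x] by blast
    have "v (\<kappa> / \<sigma> * \<sigma>) < v ((x - l) * m)" using l(2) vm \<sigma>(2) by (rule v_mult_strict)
    moreover have "v (\<kappa> / \<rho> * \<rho>) < v ((y - m) * x)"
      using order.strict_trans1[OF \<mu>(4) m(2)] \<rho>(3,2) by (rule v_mult_strict)
    ultimately have "v \<kappa> < v ((x - l) * m + (y - m) * x)" using \<rho> \<sigma> by (intro v_add_gt) auto
    then show ?thesis using subfield_mult[OF L l(1) m(1)] by (intro bexI[of _ "l * m"]) (auto simp: algebra_simps)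
  qed
  then show "x * y \<in> vclosure K L T" using subfield_mult[OF T xT yT] by (simp add: vclosure_def)
qed

section \<open>Perturbation of polynomials and continuity of Hensel roots\<close>

lemma poly_near_value_less:
  assumes "\<And>i. z < v (coeff f i - coeff g i)" "0 \<le> v x"
  shows "z < v (poly f x - poly g x)"
proof -
  have "z < v (poly h x)" if "\<And>i. z < v (coeff h i)" for h using that
  proof (induction h)
    case (pCons a h)
    have "z < v a" "\<And>i. z < v (coeff h i)"
      using pCons.prems[of 0] pCons.prems[of "Suc _"] by auto
    then have "z < v a" "z < v (poly h x)" using pCons.IH by auto
    then show ?case using v_mult_ge_0[OF assms(2), of "poly h x"] by (auto intro!: v_add_gt)
  qed auto
  from this[of "f - g"] show ?thesis using assms by simp
qed

lemma coeff_pderiv_near: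
  assumes "\<And>i. z < v (coeff f i - coeff g i)"
  shows "z < v (coeff (pderiv f) i - coeff (pderiv g) i)"
proof -
  have "coeff (pderiv f) i - coeff (pderiv g) i = of_nat (Suc i) * (coeff f (Suc i) - coeff g (Suc i))"
    by (simp add: coeff_pderiv algebra_simps)
  then show ?thesis using v_mult_ge_0[OF v_of_nat_ge[of "Suc i"]] assms[of "Suc i"] by (metis less_le_trans)
qed

lemma near_int_poly:
  assumes "int_poly f" "\<And>i. 0 < v (coeff f i - coeff g i)"
  shows "int_poly g"
  unfolding int_poly_def
proof
  fix i show "0 \<le> v (coeff g i)"
    using v_diff_ge[of 0 "coeff f i" "coeff f i - coeff g i"] assms by (simp add: int_poly_def less_imp_le)
qed

text \<open>The cofactor of \<open>f\<close> at its root \<open>b\<close> is a unit at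
  \<open>b'\<close>, so \<open>v (b - b')\<close> is the value of
  \<open>f(b') = f(b') - g(b')\<close>. The bound \<open>z\<close> is quantified in the conclusion
  so that one \<open>b'\<close> serves all precisions at once, as infinitesimal closeness
  demands.\<close>

lemma henselian_root_near:
  assumes L: "henselian v L"
    and f: "int_poly f" "0 \<le> v a" "v (poly (pderiv f) a) = 0" "poly f b = 0" "0 < v (b - a)"
    and g: "poly_over L g" "a' \<in> L" "0 < v (a - a')" "\<And>i. 0 < v (coeff f i - coeff g i)"
  obtains b' where "b' \<in> L" "\<forall>z. (\<forall>i. z < v (coeff f i - coeff g i)) \<longrightarrow> z < v (b - b')"
proof -
  have ig: "int_poly g" by (rule near_int_poly[OF f(1) g(4)])
  have va: "0 \<le> v a'" using v_diff_ge[of 0 a "a - a'"] f(2) g(3) by simp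
  have vb: "0 \<le> v b" using v_add_ge[of 0 a "b - a"] f(2,5) by simp
  have "v (b - a') \<le> v (poly f b - poly f a')" by (rule int_poly_diff_value[OF f(1) vb va])
  moreover have "0 < v (b - a')" using v_add_gt[of 0 "b - a" "a - a'"] f(5) g(3) by simp
  ultimately have "0 < v (poly f a')" using f(4) by simp
  moreover have "0 < v (poly f a' - poly g a')" by (rule poly_near_value_less[OF g(4) va])
  ultimately have ga: "0 < v (poly g a')" using v_diff_gt[of 0 "poly f a'" "poly f a' - poly g a'"] by simp
  have "0 < v (poly (pderiv f) a' - poly (pderiv g) a')"
    by (rule poly_near_value_less[OF coeff_pderiv_near[OF g(4)] va])
  moreover have "v (a - a') \<le> v (poly (pderiv f) a - poly (pderiv f) a')"
    by (rule int_poly_diff_value[OF int_poly_pderiv[OF f(1)] f(2) va])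
  ultimately have "0 < v ((poly (pderiv f) a - poly (pderiv f) a') + (poly (pderiv f) a' - poly (pderiv g) a'))"
    using g(3) by (intro v_add_gt) auto
  then have "v (poly (pderiv f) a) < v (poly (pderiv f) a - poly (pderiv g) a')" using f(3) by simp
  from v_eq_of_diff[OF this] have dg: "v (poly (pderiv g) a') = 0" using f(3) by simp
  obtain b' where b': "poly g b' = 0" "0 < v (b' - a')" using hensel_root_exists[OF ga dg] .
  have b'L: "b' \<in> L" by (rule henselianD[OF L g(1) ig g(2) va dg b'])
  obtain u where u: "int_poly u" "f = [:- b, 1:] * u" "\<forall>x. 0 < v (x - a) \<longrightarrow> v (poly u x) = 0"
    using hensel_root_cofactor[OF f] .
  have "0 < v (b' - a)" using v_diff_gt[of 0 "b' - a'" "a - a'"] b'(2) g(3) by simp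
  then have ub: "v (poly u b') = 0" using u(3) by blast
  have vb': "0 \<le> v b'" using v_add_ge[of 0 a' "b' - a'"] va b'(2) by simp
  have "poly f b' = poly u b' * (b' - b)" by (simp add: u(2) algebra_simps)
  then have "v (b - b') = v (poly f b' - poly g b')" using v_mult_eq_0[OF ub] b'(1) by (simp add: v_minus_commute)
  then show ?thesis using that[OF b'L] poly_near_value_less[of _ f g b'] vb' by metis
qed

text \<open>\<open>P 0\<close> is for the indices beyond the degree of \<open>f\<close>, where both
  coefficients are 0.\<close>

lemma poly_over_choice:
  assumes L: "subfield L \<Omega>" and P: "\<And>i. \<exists>l\<in>L. P (coeff f i - l)" "P 0"
  obtains g where "poly_over L g" "\<And>i. P (coeff f i - coeff g i)"
proof -
  obtain l where l: "\<And>i. l i \<in> L \<and> P (coeff f i - l i)" using P(1) by metis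
  define g where "g = (\<Sum>i\<le>Polynomial.degree f. Polynomial.monom (l i) i)"
  have "coeff g i = (if i \<le> Polynomial.degree f then l i else 0)" for i by (simp add: g_def coeff_sum)
  then show ?thesis using l P(2) subfield_0[OF L] by (intro that[of g]) (auto simp: poly_over_def coeff_eq_0)
qed

lemma henselian_vclosure:
  assumes K: "subfield K \<Omega>" and L: "subfield L \<Omega>" "henselian v L" and F: "subfield F \<Omega>"
  shows "henselian v (vclosure K L (alg_cl F))"
proof (rule henselianI)
  fix f a b assume *: "poly_over (vclosure K L (alg_cl F)) f" "int_poly f" "a \<in> vclosure K L (alg_cl F)" "0 \<le> v a"
    "v (poly (pderiv f) a) = 0" "poly f b = 0" "0 < v (b - a)"
  have "poly_over (alg_cl F) f" using *(1) by (auto simp: poly_over_def vclosure_def)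
  moreover have "f \<noteq> 0" using *(5) v_eq_0_nonzero by fastforce
  ultimately have bC: "b \<in> alg_cl F" using alg_cl_root[OF F] *(6) by blast
  have "\<exists>l\<in>L. v \<kappa> < v (b - l)" if \<kappa>: "\<kappa> \<in> K" "\<kappa> \<noteq> 0" for \<kappa>
  proof -
    \<comment> \<open>Nonnegative precision keeps the perturbed polynomial and starting point within
      the reach of Hensel's Lemma.\<close>
    define \<mu> where "\<mu> = (if 0 \<le> v \<kappa> then \<kappa> else 1)"
    have \<mu>: "\<mu> \<in> K" "\<mu> \<noteq> 0" "0 \<le> v \<mu>" "v \<kappa> \<le> v \<mu>"
      using \<kappa> subfield_1[OF K] by (auto simp: \<mu>_def)
    obtain a' where a': "a' \<in> L" "v \<mu> < v (a - a')" using vclosureD[OF *(3) \<mu>(1,2)] by blast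
    obtain g where g: "poly_over L g" "\<And>i. v \<mu> < v (coeff f i - coeff g i)"
    proof (rule poly_over_choice[OF L(1), of "\<lambda>x. v \<mu> < v x" f])
      show "\<exists>l\<in>L. v \<mu> < v (coeff f i - l)" for i
        using vclosureD[OF _ \<mu>(1,2)] *(1) unfolding poly_over_def by blast
    qed (use \<mu> in auto)
    obtain b' where b': "b' \<in> L" "\<forall>z. (\<forall>i. z < v (coeff f i - coeff g i)) \<longrightarrow> z < v (b - b')"
      using henselian_root_near[OF L(2) *(2,4,5,6,7) g(1) a'(1) le_less_trans[OF \<mu>(3) a'(2)] le_less_trans[OF \<mu>(3) g(2)]] .
    have "v \<mu> < v (b - b')" using b'(2) g(2) by blast
    then show ?thesis using b'(1) le_less_trans[OF \<mu>(4)] by blast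
  qed
  then show "b \<in> vclosure K L (alg_cl F)" using bC by (simp add: vclosure_def)
qed

text \<open>In the vanishing sum of the terms \<open>coeff p i * y ^ i\<close> the least value
  occurs at least twice; two such terms express a positive multiple of the value of \<open>y\<close>
  by values of \<open>G\<close>.\<close>

lemma algebraic_value:
  assumes G: "subfield G \<Omega>" and y: "y \<in> alg_cl G" "y \<noteq> 0"
  obtains j u where "j > 0" "u \<in> G" "u \<noteq> 0" "v (y ^ j) = v u"
proof -
  note witness = that
  obtain p where p: "poly_over G p" "p \<noteq> 0" "poly p y = 0" using y(1) alg_cl_iff[OF G] by blast
  define t where "t i = coeff p i * y ^ i" for i
  define I where "I = {i. i \<le> Polynomial.degree p \<and> coeff p i \<noteq> 0}"
  have I: "finite I" "I \<noteq> {}" using p(2) by (auto simp: I_def)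
  have "(\<Sum>i\<in>I. t i) = (\<Sum>i\<le>Polynomial.degree p. t i)"
    by (rule sum.mono_neutral_left) (auto simp: I_def t_def)
  then have s: "(\<Sum>i\<in>I. t i) = 0" using p(3) by (simp add: poly_altdef t_def)
  have nz: "t i \<noteq> 0" if "i \<in> I" for i using that y(2) by (auto simp: I_def t_def)
  obtain i where i: "i \<in> I" "\<And>l. l \<in> I \<Longrightarrow> v (t i) \<le> v (t l)"
    using ex_min_if_finite[of "(\<lambda>i. v (t i)) ` I"] I by (auto simp: not_less)
  have "\<exists>l\<in>I - {i}. v (t l) \<le> v (t i)"
  proof (rule ccontr)
    assume "\<not> ?thesis"
    then have "\<And>l. l \<in> I - {i} \<Longrightarrow> v (t i) < v (t l)" by (auto simp: not_le)
    moreover have "v (t i) < v (\<Sum>l\<in>J. t l)" if "finite J" "\<And>l. l \<in> J \<Longrightarrow> v (t i) < v (t l)" for J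
      using that nz[OF i(1)] by (induction J rule: finite_induct) (auto intro: v_add_gt)
    ultimately have "v (t i) < v (\<Sum>l\<in>I - {i}. t l)" using I(1) by blast
    then have "v (t i + (\<Sum>l\<in>I - {i}. t l)) = v (t i)" by (rule v_add_eq)
    then have "v 0 = v (t i)" using s sum.remove[OF I(1) i(1), of t] by simp
    then show False using nz[OF i(1)] v_less_0[of "t i"] by simp
  qed
  then obtain l where l: "l \<in> I" "l \<noteq> i" "v (t l) = v (t i)" using i(2) by (metis Diff_iff antisym singletonI)
  have main: "thesis" if "l < i" "l \<in> I" "i \<in> I" "v (t l) = v (t i)" for l i
  proof -
    have c: "coeff p l \<noteq> 0" "coeff p i \<noteq> 0" using that by (auto simp: I_def)
    have "y ^ i = y ^ (i - l) * y ^ l" using that(1) by (simp flip: power_add)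
    then have "t i = (coeff p i * y ^ l) * y ^ (i - l)" "t l = (coeff p i * y ^ l) * (coeff p l / coeff p i)"
      using c by (simp_all add: t_def)
    then have "v ((coeff p i * y ^ l) * y ^ (i - l)) = v ((coeff p i * y ^ l) * (coeff p l / coeff p i))"
      using that(4) by simp
    then have "v (y ^ (i - l)) = v (coeff p l / coeff p i)"
      using v_mult_le_cancel[of "coeff p i * y ^ l"] c(2) y(2) by (metis antisym mult_eq_0_iff order_refl power_not_zero)
    moreover have "coeff p l / coeff p i \<in> G" using p(1) subfield_divide[OF G] by (auto simp: poly_over_def)
    ultimately show ?thesis using c that(1) by (intro witness[of "i - l" "coeff p l / coeff p i"]) auto
  qed
  show ?thesis using main[of l i] main[of i l] l i(1) by (metis linorder_neqE_nat)
qed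

section \<open>Elements infinitesimally close to the ground field\<close>

text \<open>\<open>e\<close> is the lowest nonzero coefficient and \<open>k\<close> its index; what
  remains after dividing by \<open>Y ^ k\<close> is \<open>Y\<close> times a bounded
  element.\<close>

lemma poly_in_small_element:
  assumes K: "subfield K \<Omega>" and E: "subfield E \<Omega>" "\<And>x. x \<in> E \<Longrightarrow> bdd K x" and Y: "small K Y"
    and q: "poly_over E q" "q \<noteq> 0"
  obtains k e m where "e \<in> E" "e \<noteq> 0" "small K m" "poly q Y = Y ^ k * (e + m)"
proof -
  have "\<exists>k e m. e \<in> E \<and> e \<noteq> 0 \<and> small K m \<and> poly q Y = Y ^ k * (e + m)" using q
  proof (induction q)
    case (pCons a q)
    have aq: "a \<in> E" "poly_over E q" using pCons.prems by (auto simp: poly_over_pCons[OF E(1)])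
    show ?case
    proof (cases "a = 0")
      case True
      then obtain k e m where "e \<in> E" "e \<noteq> 0" "small K m" "poly q Y = Y ^ k * (e + m)"
        using pCons.IH aq(2) pCons.hyps by auto
      then show ?thesis using True by (intro exI[of _ "Suc k"] exI[of _ e] exI[of _ m]) simp
    next
      case False
      have "bdd K (poly q Y)"
        using aq(2) E(2) small_bdd[OF K Y] by (intro bdd_poly[OF K]) (auto simp: poly_over_def)
      then have "small K (Y * poly q Y)" by (rule small_mult[OF K Y])
      then show ?thesis using aq(1) False by (intro exI[of _ 0] exI[of _ a] exI[of _ "Y * poly q Y"]) simp
    qed
  qed simp
  then show ?thesis using that by blast
qed

text \<open>
  Here \<open>Y = X - c\<close> is infinitesimal over \<open>C = alg_cl F\<close>. The field \<open>E\<close> of all elements of \<open>C\<close>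
  that \<open>L\<close> approximates is henselian, and the \<open>Y\<close>-adic closure of \<open>E(X)\<close> is a henselian field:
  a root modulo \<open>Y\<close> is found in \<open>E\<close>, and Newton's method lifts it. Its elements in \<open>C\<close> lie in \<open>E\<close>.
\<close>

lemma henselization_Int_alg_cl_near:
  assumes K: "subfield K \<Omega>" and F: "subfield F \<Omega>" "K \<subseteq> F"
    and L: "subfield L \<Omega>" "henselian v L" "K \<subseteq> L" "X \<in> L"
    and co: "cofinal_in K (alg_cl F)" and dense: "F \<subseteq> vclosure K L (alg_cl F)"
    and alg: "alg_cl (adjoin F X) = UNIV"
    and c: "c \<in> alg_cl F" "X \<noteq> c" "small K (X - c)"
  shows "henselization v (adjoin F X) \<inter> alg_cl F \<subseteq> vclosure K L (alg_cl F)"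
proof -
  define C where "C = alg_cl F"
  have C: "subfield C \<Omega>" unfolding C_def by (rule subfield_alg_cl[OF F(1)])
  define E where "E = vclosure K L C"
  have E: "subfield E \<Omega>" unfolding E_def C_def by (rule subfield_vclosure[OF K L(1) subfield_alg_cl[OF F(1)] co])
  have hE: "henselian v E" unfolding E_def C_def by (rule henselian_vclosure[OF K L(1,2) F(1)])
  have EC: "E \<subseteq> C" by (auto simp: E_def vclosure_def)
  have bC: "bdd K x" if "x \<in> C" for x
    using cofinal_bdd[OF K C _ that] co by (simp add: C_def)
  have bE: "bdd K x" if "x \<in> E" for x using that EC bC by auto
  have nsC: "\<not> small K x" if "x \<in> C" "x \<noteq> 0" for x
    using co that unfolding cofinal_in_def small_def C_def by (meson order_less_asym)
  have nsE: "\<not> small K x" if "x \<in> E" "x \<noteq> 0" for x using that EC nsC by auto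
  define Y where "Y = X - c"
  have Y: "small K Y" "Y \<noteq> 0" using c by (auto simp: Y_def)
  have Ypos: "0 < v Y" by (rule small_pos[OF K Y(1)])
  have FE: "F \<subseteq> E" using dense by (simp add: E_def C_def)
  \<comment> \<open>\<open>X\<close> lies in \<open>L\<close> and differs from \<open>c\<close> by
    an infinitesimal, so it approximates \<open>c\<close> to every precision.\<close>
  have cE: "c \<in> E" unfolding E_def vclosure_def C_def
    using c(1,3) L(4) by (auto simp: small_def v_minus_commute intro!: bexI[of _ X])
  define N where "N = adjoin E X"
  have N: "subfield N \<Omega>" unfolding N_def by (rule subfield_gen)
  have EN: "E \<subseteq> N" and XN: "X \<in> N" unfolding N_def by (rule subset_adjoin, rule X_in_adjoin)
  have YN: "Y \<in> N" unfolding Y_def using subfield_diff[OF N XN] EN cE by blast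
  have v_sum_small: "v (e + m) = v e" if em: "e \<in> E" "e \<noteq> 0" "small K m" for e m
  proof (rule v_add_eq)
    obtain \<kappa> where "\<kappa> \<in> K" "\<kappa> \<noteq> 0" "v e < v \<kappa>" using co em EC by (auto simp: cofinal_in_def C_def)
    then show "v e < v m" using em(3) by (auto simp: small_def dest: less_trans)
  qed
  \<comment> \<open>A nonzero element of \<open>E(X)\<close> is a possibly negative power of
    \<open>Y\<close> times \<open>e + m\<close>; the factor \<open>Y ^ l\<close> on the left avoids
    negative exponents.\<close>
  have N_rep: "\<exists>k l e m. e \<in> E \<and> e \<noteq> 0 \<and> small K m \<and> u * Y ^ l = Y ^ k * (e + m)" if u: "u \<in> N" "u \<noteq> 0" for u
  proof -
    obtain p r where pr: "poly_over E p" "poly_over E r" "poly r X \<noteq> 0" "u = poly p X / poly r X"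
      using adjoin_fraction[OF E u(1)[unfolded N_def]] .
    have shift: "\<exists>k e m. e \<in> E \<and> e \<noteq> 0 \<and> small K m \<and> poly p X = Y ^ k * (e + m)"
      if p: "poly_over E p" "poly p X \<noteq> 0" for p
    proof -
      define q where "q = pcompose p [:c, 1:]"
      have "poly_over E q" unfolding q_def using p(1) cE subfield_1[OF E]
        by (intro poly_over_pcompose[OF E]) (auto simp: poly_over_pCons[OF E] poly_over_0[OF E])
      moreover have qX: "poly q Y = poly p X" by (simp add: q_def poly_pcompose Y_def)
      moreover have "q \<noteq> 0" using qX p(2) by auto
      ultimately show ?thesis using poly_in_small_element[OF K E bE Y(1), of q] by metis
    qed
    have "poly p X \<noteq> 0" using u(2) pr(4) by auto
    then obtain k e m where 1: "e \<in> E" "e \<noteq> 0" "small K m" "poly p X = Y ^ k * (e + m)" using shift[OF pr(1)] by blast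
    obtain l e' m' where 2: "e' \<in> E" "e' \<noteq> 0" "small K m'" "poly r X = Y ^ l * (e' + m')" using shift[OF pr(2,3)] by blast
    have n2: "e' + m' \<noteq> 0" using pr(3) 2(4) by auto
    define n where "n = (m * e' - m' * e) / (e' * (e' + m'))"
    have "small K (m * e' - m' * e)" using small_mult[OF K 1(3) bE[OF 2(1)]] small_mult[OF K 2(3) bE[OF 1(1)]] by (rule small_diff)
    moreover have "bdd K (inverse (e' * (e' + m')))"
    proof -
      have b: "bdd K (inverse (e' * e'))" using bE subfield_inverse[OF E] subfield_mult[OF E] 2(1) by blast
      have "v (e' * (e' + m')) = v (e' * e')" using v_sum_small[OF 2(1-3)] by (simp add: v_mult)
      then have "v (inverse (e' * e')) \<le> v (inverse (e' * (e' + m')))"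
        using v_inverse_le_iff[of "e' * e'" "e' * (e' + m')"] 2(2) n2 by simp
      then show ?thesis using b unfolding bdd_def by (meson order_trans)
    qed
    ultimately have sn: "small K n" unfolding n_def divide_inverse by (rule small_mult[OF K])
    have "(e + m) / (e' + m') - e / e' = n"
      unfolding diff_frac_eq[OF n2 2(2)] n_def by (simp add: algebra_simps)
    then have "e / e' + n = (e + m) / (e' + m')" by (simp add: algebra_simps)
    moreover have "Y ^ k * s / (Y ^ l * t) * Y ^ l = Y ^ k * (s / t)" if "t \<noteq> 0" for s t
      using that Y(2) by (simp add: field_simps)
    ultimately have "u * Y ^ l = Y ^ k * (e / e' + n)" using pr(4) 1(4) 2(4) n2 by simp
    moreover have "e / e' \<in> E" "e / e' \<noteq> 0" using 1 2 subfield_divide[OF E] by auto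
    ultimately show ?thesis using sn by blast
  qed
  have FXN: "adjoin F X \<subseteq> N" unfolding N_def by (rule adjoin_mono[OF FE])
  \<comment> \<open>Every element is algebraic over \<open>F(X)\<close>, so a positive multiple of
    its value lies in the group generated by \<open>v Y\<close> and the values of
    \<open>E\<close>.\<close>
  have val_rep: "\<exists>j k l e. j > 0 \<and> e \<in> E \<and> e \<noteq> 0 \<and> v (y ^ j * Y ^ l) = v (Y ^ k * e)" if y: "y \<noteq> 0" for y
  proof -
    obtain j u where u: "j > 0" "u \<in> adjoin F X" "u \<noteq> 0" "v (y ^ j) = v u"
      using algebraic_value[OF subfield_gen, of y "insert X F"] alg y by auto
    obtain k l e m where r: "e \<in> E" "e \<noteq> 0" "small K m" "u * Y ^ l = Y ^ k * (e + m)" using N_rep u(2,3) FXN by blast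
    have "v (y ^ j * Y ^ l) = v (u * Y ^ l)" using u(4) by (simp add: v_mult)
    also have "\<dots> = v (Y ^ k * e)" using r v_sum_small by (simp add: v_mult)
    finally show ?thesis using u(1) r(1,2) by blast
  qed
  have Ybig: "0 \<le> v (Y * x)" if "bdd K x" for x using small_pos[OF K small_mult[OF K Y(1) that]] by simp
  have Ypow: "0 \<le> v (Y ^ n)" for n using Ypos v_power_mono[of 1 Y n] by simp
  \<comment> \<open>Infinitesimals are archimedean: powers of \<open>Y\<close> exceed every finite
    value (\<open>arch1\<close>), and powers of each infinitesimal reach \<open>v Y\<close>
    (\<open>arch2\<close>).\<close>
  have arch1: "\<exists>n. v y < v (Y ^ n)" if y0: "y \<noteq> 0" for y
  proof (cases "v y \<le> 0")
    case True
    then show ?thesis using Ypos by (intro exI[of _ 1]) simp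
  next
    case False
    obtain j k l e where j: "j > 0" "e \<in> E" "e \<noteq> 0" "v (y ^ j * Y ^ l) = v (Y ^ k * e)" using val_rep[OF y0] by blast
    obtain i where i: "j = Suc i" using j(1) by (cases j) auto
    have "0 \<le> v (y ^ i)" using v_power_mono[of 1 y i] False by simp
    then have "v y \<le> v (y ^ j)" using v_mult_ge_0[of "y ^ i" y] i by (simp add: mult.commute)
    also have "\<dots> \<le> v (Y ^ l * y ^ j)" by (rule v_mult_ge_0[OF Ypow])
    also have "\<dots> = v (Y ^ k * e)" using j(4) by (simp add: mult.commute)
    also have "\<dots> < v (Y ^ k * Y)"
    proof -
      obtain \<kappa> where "\<kappa> \<in> K" "\<kappa> \<noteq> 0" "v e < v \<kappa>" using co j EC by (auto simp: cofinal_in_def C_def)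
      then have "v e < v Y" using Y(1) by (auto simp: small_def dest: less_trans)
      then show ?thesis using v_mult_less_cancel[of "Y ^ k"] Y(2) by simp
    qed
    finally show ?thesis by (intro exI[of _ "Suc k"]) (simp add: mult.commute)
  qed
  have coN: "cofinal_in N UNIV" unfolding cofinal_in_def
    using arch1 subfield_power[OF N YN] Y(2) by (metis power_not_zero)
  have arch2: "\<exists>n. v Y \<le> v (y ^ n)" if y: "y \<noteq> 0" "small K y" for y
  proof -
    obtain j k l e where j: "j > 0" "e \<in> E" "e \<noteq> 0" "v (y ^ j * Y ^ l) = v (Y ^ k * e)" using val_rep[OF y(1)] by blast
    have sj: "small K (y ^ j)"
    proof -
      obtain i where i: "j = Suc i" using j(1) by (cases j) auto
      have "0 \<le> v (y ^ i)" using v_power_mono[of 1 y i] small_pos[OF K y(2)] by simp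
      then show ?thesis using small_mono[OF y(2)] v_mult_ge_0[of "y ^ i" y] i by (simp add: mult.commute)
    qed
    have "l < k"
    proof (rule ccontr)
      assume "\<not> l < k"
      then have "Y ^ l = Y ^ k * Y ^ (l - k)" by (simp flip: power_add)
      then have "v (Y ^ k * (Y ^ (l - k) * y ^ j)) = v (Y ^ k * e)" using j(4) by (simp add: mult_ac)
      then have "v (Y ^ (l - k) * y ^ j) \<le> v e" using v_mult_le_cancel[of "Y ^ k"] Y(2) by (metis order_refl power_not_zero)
      then have "small K e" using small_mono[OF sj] v_mult_ge_0[OF Ypow] by (meson order_trans)
      then show False using nsE j by blast
    qed
    then obtain s where s: "k = Suc (l + s)" using less_iff_Suc_add by blast
    have "v (Y ^ l * y ^ j) = v (Y ^ l * (Y ^ Suc s * e))" using j(4) s by (simp add: power_add mult_ac)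
    then have *: "v (y ^ j) = v (Y ^ Suc s * e)" using v_mult_le_cancel[of "Y ^ l"] Y(2) by (metis antisym order_refl power_not_zero)
    \<comment> \<open>\<open>e\<close> may have negative value. After squaring, one of the two spare
      factors \<open>Y\<close> absorbs \<open>e * e\<close>, and the other remains.\<close>
    have "Y ^ Suc s * e * (Y ^ Suc s * e) = (Y ^ (2 * s) * (Y * (e * e))) * Y"
      by (simp add: power_mult power2_eq_square power_mult_distrib mult_ac)
    moreover have "0 \<le> v (Y ^ (2 * s) * (Y * (e * e)))"
      by (intro v_mult_ge_0'[OF Ypow] Ybig bE subfield_mult[OF E j(2) j(2)])
    ultimately have "v Y \<le> v (Y ^ Suc s * e * (Y ^ Suc s * e))" using v_mult_ge_0 by metis
    also have "\<dots> = v (y ^ (j + j))" using * by (simp only: v_mult power_add)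
    finally show ?thesis by blast
  qed
  define M where "M = vclosure N N UNIV"
  have M: "subfield M \<Omega>" unfolding M_def by (rule subfield_vclosure[OF N N subfield_UNIV coN])
  have NM: "N \<subseteq> M" unfolding M_def using Int_subset_vclosure[of N UNIV N] by simp
  \<comment> \<open>Residues modulo infinitesimals: for \<open>u * Y ^ l = Y ^ k * (e + m)\<close>
    the residue is \<open>e\<close> if \<open>k = l\<close> and 0 if \<open>k > l\<close>, while
    \<open>k < l\<close> would make \<open>e\<close> infinitesimal.\<close>
  have residue: "\<exists>e\<in>E. small K (y - e)" if y: "y \<in> M" "bdd K y" for y
  proof -
    obtain u where u: "u \<in> N" "v Y < v (y - u)" using vclosureD[OF y(1)[unfolded M_def] YN Y(2)] by blast
    have su: "small K (y - u)" using small_mono[OF Y(1)] u(2) by simp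
    have bu: "bdd K u" using bdd_add[OF y(2) small_bdd[OF K small_minus_commute[OF su]]] by simp
    have "\<exists>e\<in>E. small K (u - e)"
    proof (cases "u = 0")
      case True
      then show ?thesis using subfield_0[OF E] small_0 by (auto intro!: bexI[of _ 0])
    next
      case False
      obtain k l e m where r: "e \<in> E" "e \<noteq> 0" "small K m" "u * Y ^ l = Y ^ k * (e + m)" using N_rep u(1) False by blast
      consider "l = k" | s where "k = Suc (l + s)" | s where "l = Suc (k + s)"
        using less_iff_Suc_add by (metis linorder_neqE_nat)
      then show ?thesis
      proof cases
        case 1
        then have "u - e = m" using r(4) Y(2) by (simp add: mult.commute)
        then show ?thesis using r by blast
      next
        case 2
        then have "Y ^ l * u = Y ^ l * (Y * (Y ^ s * (e + m)))" using r(4) by (simp add: power_add mult_ac)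
        then have "u = Y * (Y ^ s * (e + m))" using Y(2) by simp
        moreover have "small K (Y * (Y ^ s * (e + m)))"
          using bdd_add[OF bE[OF r(1)] small_bdd[OF K r(3)]] bdd_ge_0[OF K Ypow] by (intro small_mult[OF K Y(1)] bdd_mult[OF K])
        ultimately show ?thesis using subfield_0[OF E] by (auto intro!: bexI[of _ 0])
      next
        case 3
        then have "Y ^ k * (Y * (Y ^ s * u)) = Y ^ k * (e + m)" using r(4) by (simp add: power_add mult_ac)
        then have "Y * (Y ^ s * u) = e + m" using Y(2) by simp
        moreover have "small K (Y * (Y ^ s * u))" using bu bdd_ge_0[OF K Ypow] by (intro small_mult[OF K Y(1)] bdd_mult[OF K])
        ultimately have "small K e" using small_diff[OF _ r(3), of "e + m"] by simp
        then show ?thesis using nsE r by blast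
      qed
    qed
    then obtain e where "e \<in> E" "small K (u - e)" by blast
    then show ?thesis using small_add[OF su, of "u - e"] by (intro bexI[of _ e]) simp_all
  qed
  have "henselian v M"
  proof (rule henselianI)
    fix f a b assume f: "poly_over M f" "int_poly f" "a \<in> M" "0 \<le> v a" "v (poly (pderiv f) a) = 0"
      "poly f b = 0" "0 < v (b - a)"
    \<comment> \<open>The residues of \<open>a\<close> and of the coefficients of \<open>f\<close>
      define a Hensel problem over \<open>E\<close>; its root \<open>b'\<close> starts Newton's
      method at infinitesimal distance from \<open>b\<close>.\<close>
    obtain a' where a': "a' \<in> E" "small K (a - a')" using residue[OF f(3) bdd_ge_0[OF K f(4)]] by blast
    obtain g where g: "poly_over E g" "\<And>i. small K (coeff f i - coeff g i)"
    proof (rule poly_over_choice[OF E, of "small K" f])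
      show "\<exists>l\<in>E. small K (coeff f i - l)" for i
        using residue[OF _ bdd_ge_0[OF K]] f(1,2) unfolding poly_over_def int_poly_def by blast
    qed (use small_0 in auto)
    obtain b' where b': "b' \<in> E" "\<forall>z. (\<forall>i. z < v (coeff f i - coeff g i)) \<longrightarrow> z < v (b - b')"
      using henselian_root_near[OF hE f(2,4,5,6,7) g(1) a'(1) small_pos[OF K a'(2)] small_pos[OF K g(2)]] .
    define d where "d = b' - b"
    have sd: "small K d" unfolding small_def d_def using b'(2) g(2) by (auto simp: small_def v_minus_commute)
    have dpos: "0 < v d" by (rule small_pos[OF K sd])
    have ba: "0 < v (b' - a)" using v_add_gt[OF dpos f(7)] by (simp add: d_def)
    obtain u where u: "int_poly u" "f = [:- b, 1:] * u" "\<forall>x. 0 < v (x - a) \<longrightarrow> v (poly u x) = 0"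
      using hensel_root_cofactor[OF f(2,4,5,6,7)] .
    \<comment> \<open>Gaining one factor \<open>d\<close> per step is enough, as some power of the
      infinitesimal \<open>d\<close> reaches \<open>v Y\<close>.\<close>
    have newton: "\<exists>x\<in>M. 0 < v (x - a) \<and> v (d ^ Suc n) \<le> v (x - b)" for n
    proof (induction n)
      case 0
      have "b' \<in> M" using b'(1) EN NM by blast
      then show ?case using ba by (auto simp: d_def)
    next
      case (Suc n)
      then obtain x where x: "x \<in> M" "0 < v (x - a)" "v (d ^ Suc n) \<le> v (x - b)" by blast
      have vx: "0 \<le> v x" using v_add_ge[of 0 a "x - a"] f(4) x(2) by simp
      have ux: "v (poly u x) = 0" using u(3) x(2) by blast
      have xb: "0 < v (x - b)" using v_diff_gt[OF x(2) f(7)] by simp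
      have iu: "0 \<le> v (poly (pderiv u) x)" by (rule int_poly_value[OF int_poly_pderiv[OF u(1)] vx])
      define D where "D = poly (pderiv f) x"
      have D: "D = poly u x + (x - b) * poly (pderiv u) x" unfolding D_def u(2) by (rule pderiv_linear_mult)
      have "v (x - b) \<le> v (poly (pderiv u) x * (x - b))" by (rule v_mult_ge_0[OF iu])
      then have "v (poly u x) < v ((x - b) * poly (pderiv u) x)" using xb ux by (simp add: mult.commute)
      from v_add_eq[OF this] have vD: "v D = 0" using ux D by simp
      then have D0: "D \<noteq> 0" by (rule v_eq_0_nonzero)
      define x' where "x' = x - poly f x / D"
      have fx: "poly f x = (x - b) * poly u x" by (simp add: u(2) algebra_simps)
      have eq: "D * (x' - b) = poly (pderiv u) x * ((x - b) * (x - b))"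
        using D0 by (simp add: x'_def fx field_simps) (simp add: D algebra_simps)
      have "v (x' - b) = v (D * (x' - b))" using v_mult_eq_0[OF vD] by simp
      then have *: "v ((x - b) * (x - b)) \<le> v (x' - b)" using v_mult_ge_0[OF iu] eq by metis
      have "v (x - b) \<le> v ((x - b) * (x - b))" by (rule v_mult_ge_0) (use xb in simp)
      then have "0 < v (x' - b)" using * xb by order
      then have 1: "0 < v (x' - a)" using v_add_gt[of 0 "x' - b" "b - a"] f(7) by simp
      have "v d \<le> v (d ^ Suc n)" using v_mult_ge_0[of "d ^ n" d] v_power_mono[of 1 d n] dpos by (simp add: mult.commute)
      then have "v (d * d ^ Suc n) \<le> v ((x - b) * (x - b))" using x(3) by (intro v_mult_mono) order
      then have 2: "v (d ^ Suc (Suc n)) \<le> v (x' - b)" using * by simp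
      have "x' \<in> M" unfolding x'_def D_def
        using x(1) poly_closed[OF M f(1)] poly_closed[OF M poly_over_pderiv[OF M f(1)]]
        by (intro subfield_diff[OF M] subfield_divide[OF M]) auto
      then show ?case using 1 2 by blast
    qed
    have "\<exists>l\<in>N. v \<kappa> < v (b - l)" if \<kappa>: "\<kappa> \<in> N" "\<kappa> \<noteq> 0" for \<kappa>
    proof (cases "d = 0")
      case True
      then show ?thesis using b'(1) EN \<kappa>(2) by (auto simp: d_def intro!: bexI[of _ b'])
    next
      case False
      obtain n where n: "v \<kappa> < v (Y ^ n)" using arch1[OF \<kappa>(2)] by blast
      obtain m where m: "v Y \<le> v (d ^ m)" using arch2[OF False sd] by blast
      have "v (Y ^ n) \<le> v (d ^ (m * n))" using v_power_mono[OF m] by (simp add: power_mult)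
      also have "\<dots> \<le> v (d ^ Suc (m * n))" using v_mult_ge_0[of d] dpos by simp
      finally have k: "v \<kappa> < v (d ^ Suc (m * n))" using n by order
      obtain x where x: "x \<in> M" "v (d ^ Suc (m * n)) \<le> v (x - b)" using newton by blast
      obtain l where l: "l \<in> N" "v \<kappa> < v (x - l)" using vclosureD[OF x(1)[unfolded M_def] \<kappa>] by blast
      have "v \<kappa> < v (x - b)" using k x(2) by order
      have "v \<kappa> < v ((x - l) - (x - b))" using l(2) \<open>v \<kappa> < v (x - b)\<close> by (rule v_diff_gt)
      then show ?thesis using l(1) by auto
    qed
    then show "b \<in> M" by (simp add: M_def vclosure_def)
  qed
  then have HM: "henselization v (adjoin F X) \<subseteq> M" using FXN NM by (intro henselization_least subfield_gen M) auto
  show ?thesis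
  proof
    fix y assume "y \<in> henselization v (adjoin F X) \<inter> alg_cl F"
    then have y: "y \<in> M" "y \<in> C" using HM by (auto simp: C_def)
    then obtain e where e: "e \<in> E" "small K (y - e)" using residue bC by blast
    then have "y = e" using nsC[of "y - e"] subfield_diff[OF C y(2)] EC by auto
    then show "y \<in> vclosure K L (alg_cl F)" using e(1) by (simp add: E_def C_def)
  qed
qed

section \<open>Cofinality, and approximation by the henselization of K(X)\<close>

lemma cofinal_in_alg_cl:
  assumes K: "subfield K \<Omega>" and F: "subfield F \<Omega>"
    and \<pi>: "\<pi> \<in> K" "\<pi> \<noteq> 0" "0 < v \<pi>"
    and vals: "\<And>u. u \<in> F \<Longrightarrow> u \<noteq> 0 \<Longrightarrow> \<exists>k\<in>K. k \<noteq> 0 \<and> v u = v k"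
  shows "cofinal_in K (alg_cl F)"
  unfolding cofinal_in_def
proof (intro ballI impI)
  fix y assume y: "y \<in> alg_cl F" "y \<noteq> 0"
  show "\<exists>\<kappa>\<in>K. \<kappa> \<noteq> 0 \<and> v y < v \<kappa>"
  proof (cases "v y \<le> 0")
    case True
    then show ?thesis using \<pi> by (intro bexI[of _ \<pi>]) auto
  next
    case False
    obtain j u where j: "j > 0" "u \<in> F" "u \<noteq> 0" "v (y ^ j) = v u" using algebraic_value[OF F y] .
    obtain k where k: "k \<in> K" "k \<noteq> 0" "v u = v k" using vals j by blast
    obtain i where i: "j = Suc i" using j(1) by (cases j) auto
    have "0 \<le> v (y ^ i)" using v_power_mono[of 1 y i] False by simp
    then have "v y \<le> v (y ^ j)" using v_mult_ge_0[of "y ^ i" y] i by (simp add: mult.commute)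
    also have "\<dots> = v k" using j k by simp
    \<comment> \<open>The factor \<open>\<pi>\<close> makes the inequality strict.\<close>
    also have "\<dots> < v (k * \<pi>)" using v_mult_less_cancel[of k 1 \<pi>] k(2) \<pi>(3) by simp
    finally show ?thesis using subfield_mult[OF K k(1) \<pi>(1)] k(2) \<pi>(2) by (intro bexI[of _ "k * \<pi>"]) auto
  qed
qed

lemma cofinal_finite:
  assumes K: "subfield K \<Omega>" and co: "cofinal_in K T" and R: "finite R" "R \<subseteq> T"
  obtains \<kappa> where "\<kappa> \<in> K" "\<kappa> \<noteq> 0" "\<forall>r\<in>R. r \<noteq> 0 \<longrightarrow> v r < v \<kappa>"
proof -
  have "\<exists>\<kappa>\<in>K. \<kappa> \<noteq> 0 \<and> (\<forall>r\<in>R. r \<noteq> 0 \<longrightarrow> v r < v \<kappa>)" using R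
  proof (induction R rule: finite_induct)
    case empty
    then show ?case using subfield_1[OF K] by (intro bexI[of _ 1]) auto
  next
    case (insert r R)
    then obtain \<kappa> where \<kappa>: "\<kappa> \<in> K" "\<kappa> \<noteq> 0" "\<forall>r\<in>R. r \<noteq> 0 \<longrightarrow> v r < v \<kappa>" by auto
    show ?case
    proof (cases "r = 0")
      case True
      then show ?thesis using \<kappa> by auto
    next
      case False
      then obtain \<rho> where \<rho>: "\<rho> \<in> K" "\<rho> \<noteq> 0" "v r < v \<rho>"
        using co insert.prems unfolding cofinal_in_def by blast
      show ?thesis
      proof (cases "v \<kappa> \<le> v \<rho>")
        case True
        then show ?thesis using \<kappa> \<rho> by (intro bexI[of _ \<rho>]) (auto dest: less_le_trans)
      next
        case False
        then have "v r < v \<kappa>" using \<rho>(3) by order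
        then show ?thesis using \<kappa> by (intro bexI[of _ \<kappa>]) auto
      qed
    qed
  qed
  then show ?thesis using that by blast
qed

lemma not_small_prod_linear:
  assumes K: "subfield K \<Omega>" and s: "\<And>c. c \<in># A \<Longrightarrow> \<not> small K (X - c)"
  shows "\<exists>\<kappa>\<in>K. \<kappa> \<noteq> 0 \<and> v (poly (\<Prod>c\<in>#A. [:- c, 1:]) X) \<le> v \<kappa>"
  using s
proof (induction A)
  case empty
  then show ?case using subfield_1[OF K] by (intro bexI[of _ 1]) auto
next
  case (add c A)
  then obtain \<kappa> where \<kappa>: "\<kappa> \<in> K" "\<kappa> \<noteq> 0" "v (poly (\<Prod>c\<in>#A. [:- c, 1:]) X) \<le> v \<kappa>" by auto
  have "\<not> small K (X - c)" using add.prems by simp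
  then obtain \<rho> where \<rho>: "\<rho> \<in> K" "\<rho> \<noteq> 0" "v (X - c) \<le> v \<rho>" by (auto simp: small_def not_less)
  have "poly (\<Prod>c\<in>#add_mset c A. [:- c, 1:]) X = (X - c) * poly (\<Prod>c\<in>#A. [:- c, 1:]) X"
    by (simp add: algebra_simps)
  then show ?case using v_mult_mono[OF \<rho>(3) \<kappa>(3)] subfield_mult[OF K \<rho>(1) \<kappa>(1)] \<rho>(2) \<kappa>(2)
    by (intro bexI[of _ "\<rho> * \<kappa>"]) auto
qed

text \<open>If \<open>K\<close> is not cofinal, some nonzero \<open>u = p(X) / r(X)\<close> is
  infinitesimal. When \<open>inverse X\<close> is not infinitesimal, \<open>X\<close> and hence
  \<open>r(X)\<close> are bounded, so \<open>p(X)\<close> is infinitesimal. But \<open>p\<close>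
  splits over \<open>alg_cl F\<close>, so one of its factors \<open>X - c\<close> must be
  infinitesimal.\<close>

lemma henselization_Int_alg_cl_approx:
  assumes K: "subfield K \<Omega>" and F: "subfield F \<Omega>" "K \<subseteq> F"
    and L: "subfield L \<Omega>" "henselian v L" "K \<subseteq> L" "X \<in> L"
    and co: "cofinal_in K (alg_cl F)" and dense: "F \<subseteq> vclosure K L (alg_cl F)"
    and alg: "alg_cl (adjoin F X) = UNIV" and X: "X \<notin> alg_cl F"
  shows "henselization v (adjoin F X) \<inter> alg_cl F \<subseteq> vclosure K L (alg_cl F)"
proof (cases "cofinal_in K UNIV")
  case True
  have UN: "alg_cl UNIV = (UNIV :: 'a set)" using subset_alg_cl[OF subfield_UNIV] by auto
  define M where "M = vclosure K L UNIV"
  have M: "subfield M \<Omega>" "henselian v M"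
    unfolding M_def using subfield_vclosure[OF K L(1) subfield_UNIV True] henselian_vclosure[OF K L(1,2) subfield_UNIV] UN by auto
  have "F \<subseteq> M" "X \<in> M" using dense L(4) Int_subset_vclosure[of L UNIV K] by (auto simp: M_def vclosure_def)
  then have "adjoin F X \<subseteq> M" by (rule adjoin_least[OF M(1)])
  then have "henselization v (adjoin F X) \<subseteq> M" by (rule henselization_least[OF subfield_gen M])
  then show ?thesis by (auto simp: M_def vclosure_def)
next
  case False
  note C = subfield_alg_cl[OF F(1)]
  have X0: "X \<noteq> 0" using X subfield_0[OF C] by auto
  consider c where "c \<in> alg_cl F" "small K (X - c)" | "small K (inverse X)"
    | "\<And>c. c \<in> alg_cl F \<Longrightarrow> \<not> small K (X - c)" "\<not> small K (inverse X)" by blast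
  then show ?thesis
  proof cases
    case 1
    then show ?thesis using henselization_Int_alg_cl_near[OF K F L co dense alg] X by blast
  next
    case 2
    \<comment> \<open>The inverse of \<open>X\<close> generates the same field and is
      infinitesimally close to \<open>c = 0\<close>.\<close>
    have "small K (inverse X - 0)" "inverse X \<noteq> 0" using 2 X0 by auto
    then show ?thesis
      using henselization_Int_alg_cl_near[OF K F L(1-3) subfield_inverse[OF L(1,4)] co dense _ subfield_0[OF C]] alg
      by (simp add: adjoin_inverse[OF X0])
  next
    case 3
    have bX: "bdd K X"
    proof -
      obtain \<kappa> where \<kappa>: "\<kappa> \<in> K" "\<kappa> \<noteq> 0" "v (inverse X) \<le> v \<kappa>" using 3(2) by (auto simp: small_def not_less)
      then have "v (inverse \<kappa>) \<le> v X" using v_inverse_le_iff[of \<kappa> "inverse X"] X0 by simp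
      then show ?thesis unfolding bdd_def using subfield_inverse[OF K \<kappa>(1)] \<kappa>(2)
        by (intro bexI[of _ "inverse \<kappa>"]) auto
    qed
    obtain y where y: "y \<noteq> 0" "\<And>\<kappa>. \<kappa> \<in> K \<Longrightarrow> \<kappa> \<noteq> 0 \<Longrightarrow> v \<kappa> \<le> v y"
      using False unfolding cofinal_in_def by (auto simp: not_less)
    have sy: "small K y" unfolding small_def
    proof (intro ballI impI)
      fix \<kappa> assume \<kappa>: "\<kappa> \<in> K" "\<kappa> \<noteq> 0"
      have "\<kappa> \<in> alg_cl F" using \<kappa> F subset_alg_cl by blast
      then obtain \<rho> where \<rho>: "\<rho> \<in> K" "\<rho> \<noteq> 0" "v \<kappa> < v \<rho>" using co \<kappa> unfolding cofinal_in_def by blast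
      then show "v \<kappa> < v y" using y(2)[OF \<rho>(1,2)] by order
    qed
    obtain j u where u: "j > 0" "u \<in> adjoin F X" "u \<noteq> 0" "v (y ^ j) = v u"
      using algebraic_value[OF subfield_gen, of y "insert X F"] alg y(1) by auto
    obtain i where i: "j = Suc i" using u(1) by (cases j) auto
    have "0 \<le> v (y ^ i)" using v_power_mono[of 1 y i] small_pos[OF K sy] by simp
    then have "small K (y ^ j)" using small_mono[OF sy] v_mult_ge_0[of "y ^ i" y] i by (simp add: mult.commute)
    then have su: "small K u" using u(4) by (auto simp: small_def)
    obtain p r where pr: "poly_over F p" "poly_over F r" "poly r X \<noteq> 0" "u = poly p X / poly r X"
      using adjoin_fraction[OF F(1) u(2)] .
    have "bdd K x" if "x \<in> F" for x using cofinal_bdd[OF K C co] subset_alg_cl[OF F(1)] that by blast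
    then have "bdd K (poly r X)" using pr(2) by (intro bdd_poly[OF K _ bX]) (auto simp: poly_over_def)
    then have "small K (u * poly r X)" by (rule small_mult[OF K su])
    then have sp: "small K (poly p X)" using pr(3,4) by simp
    have p0: "p \<noteq> 0" using pr(4) u(3) by auto
    obtain A where A: "p = smult (Polynomial.lead_coeff p) (\<Prod>c\<in>#A. [:- c, 1:])"
      using alg_closed_imp_factorization[OF p0] by blast
    have "c \<in> alg_cl F" if "c \<in># A" for c
    proof -
      have "poly (\<Prod>c\<in>#A. [:- c, 1:]) c = 0" using that by (auto simp: poly_prod_mset prod_mset_zero_iff image_iff intro!: bexI[of _ c])
      then have "poly p c = 0" using A by (metis mult_zero_right poly_smult)
      then show ?thesis using alg_cl_iff[OF F(1)] pr(1) p0 by blast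
    qed
    then obtain \<kappa> where \<kappa>: "\<kappa> \<in> K" "\<kappa> \<noteq> 0" "v (poly (\<Prod>c\<in>#A. [:- c, 1:]) X) \<le> v \<kappa>"
      using not_small_prod_linear[OF K, of A X] 3(1) by blast
    have lF: "Polynomial.lead_coeff p \<in> alg_cl F" "Polynomial.lead_coeff p \<noteq> 0"
      using pr(1) p0 subset_alg_cl[OF F(1)] by (auto simp: poly_over_def)
    then obtain \<rho> where \<rho>: "\<rho> \<in> K" "\<rho> \<noteq> 0" "v (Polynomial.lead_coeff p) < v \<rho>"
      using co unfolding cofinal_in_def by blast
    have "poly p X = Polynomial.lead_coeff p * poly (\<Prod>c\<in>#A. [:- c, 1:]) X" using A by (metis poly_smult)
    then have "v (poly p X) \<le> v (\<rho> * \<kappa>)" using v_mult_mono[OF less_imp_le[OF \<rho>(3)] \<kappa>(3)] by simp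
    moreover have "v (\<rho> * \<kappa>) < v (poly p X)"
      using sp subfield_mult[OF K \<rho>(1) \<kappa>(1)] \<rho>(2) \<kappa>(2) by (simp add: small_def)
    ultimately show ?thesis by simp
  qed
qed

section \<open>Replacing b by a nearby root over K, and the two applications of Krasner's
  Lemma\<close>

text \<open>Hensel's Lemma for the polynomial \<open>g(b + e t) / e^2\<close> in \<open>t\<close>.\<close>

lemma newton_root_unique:
  assumes g: "int_poly g" and b: "0 \<le> v b" and e: "v (poly (pderiv g) b) = v e" "0 \<le> v e" "e \<noteq> 0"
    and gb: "v (e * e) < v (poly g b)"
  obtains b0 where "poly g b0 = 0" "v e < v (b0 - b)"
    "\<forall>z. poly g z = 0 \<and> v e < v (z - b) \<longrightarrow> z = b0"
proof -
  define q where "q = pcompose g [:b, 1:]"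
  have q: "int_poly q" unfolding q_def using g b by (intro int_poly_pcompose) auto
  define G where "G = smult (inverse (e * e)) (pcompose q [:0, e:])"
  have Gt: "poly G t = poly g (b + e * t) / (e * e)" for t
    by (simp add: G_def q_def poly_pcompose divide_inverse mult.commute)
  have cG: "coeff G i = inverse (e * e) * (e ^ i * coeff q i)" for i by (simp add: G_def coeff_pcompose_linear)
  have c0: "coeff q 0 = poly g b" by (simp add: q_def poly_pcompose flip: poly_0_coeff_0)
  have "poly (pderiv q) 0 = poly (pderiv g) b" by (simp add: q_def pderiv_pcompose poly_pcompose pderiv_pCons)
  then have c1: "coeff q 1 = poly (pderiv g) b" by (simp add: poly_0_coeff_0 coeff_pderiv)
  have G0: "0 < v (coeff G 0)"
    using v_less_divide_iff[of "e * e" 1 "poly g b"] gb e(3) by (simp add: cG c0 divide_inverse mult.commute)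
  have "coeff G 1 = poly (pderiv g) b / e" using e(3) by (simp add: cG c1[unfolded One_nat_def] field_simps)
  moreover have "v (poly (pderiv g) b / e) = 0"
    using v_divide_le_iff[OF e(3), of "poly (pderiv g) b" 1] v_le_divide_iff[OF e(3), of 1 "poly (pderiv g) b"] e(1) by simp
  ultimately have G1: "v (coeff G 1) = 0" by simp
  have "0 \<le> v (coeff G i)" for i
  proof -
    consider "i = 0" | "i = 1" | k where "i = Suc (Suc k)" by (metis One_nat_def not0_implies_Suc)
    then show ?thesis
    proof cases
      case 3
      then have "coeff G i = e ^ k * coeff q i" using e(3) by (simp add: cG field_simps)
      moreover have "0 \<le> v (e ^ k)" using v_power_mono[of 1 e k] e(2) by simp
      ultimately show ?thesis using q by (simp add: int_poly_def v_mult_ge_0')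
    qed (use G0 G1 in auto)
  qed
  then have iG: "int_poly G" by (simp add: int_poly_def)
  have 0: "0 < v (poly G 0)" "v (poly (pderiv G) 0) = 0" using G0 G1 by (simp_all add: poly_0_coeff_0 coeff_pderiv)
  obtain t where t: "poly G t = 0" "0 < v (t - 0)" using hensel_root_exists[OF 0] .
  show ?thesis
  proof (rule that[of "b + e * t"])
    show "poly g (b + e * t) = 0" using t(1) e(3) by (simp add: Gt)
    show "v e < v (b + e * t - b)" using v_mult_less_cancel[OF e(3), of 1 t] t(2) by simp
    show "\<forall>z. poly g z = 0 \<and> v e < v (z - b) \<longrightarrow> z = b + e * t"
    proof (intro allI impI)
      fix z assume z: "poly g z = 0 \<and> v e < v (z - b)"
      define s where "s = (z - b) / e"
      have zs: "z = b + e * s" using e(3) by (simp add: s_def)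
      have "poly G s = 0" using z by (simp add: Gt flip: zs)
      moreover have "0 < v (s - 0)" using v_less_divide_iff[OF e(3), of 1 "z - b"] z by (simp add: s_def)
      ultimately show "z = b + e * t" using hensel_root_unique[OF iG _ 0(2) t] zs by simp
    qed
  qed
qed

text \<open>
  The root \<open>b0\<close> near \<open>b\<close> of a polynomial \<open>g0\<close> over \<open>K\<close> near the minimal polynomial \<open>g\<close> of \<open>b\<close>
  is purely inseparable over the henselization of \<open>F(X)\<close>, hence over that of \<open>K(X)\<close>, and then \<open>b\<close> is
  purely inseparable over the field generated by the henselization of \<open>F\<close> and \<open>b0\<close>.
\<close>

lemma integral_separable_mem_perf_cl:
  assumes K: "subfield K \<Omega>" and F: "subfield F \<Omega>" "K \<subseteq> F"
    and dense: "\<And>a \<kappa>. a \<in> F \<Longrightarrow> \<kappa> \<in> F \<Longrightarrow> \<kappa> \<noteq> 0 \<Longrightarrow> \<exists>b\<in>K. v \<kappa> < v (a - b)"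
    and co: "cofinal_in K (alg_cl F)"
    and alg: "alg_cl (adjoin F X) = UNIV" and X: "X \<notin> alg_cl F"
    and D: "subfield D \<Omega>" "henselization v F \<subseteq> D" "alg_cl K \<inter> henselization v (adjoin K X) \<subseteq> D"
    and b: "b \<in> alg_cl F" "b \<in> henselization v (adjoin F X)"
    and g: "is_minpoly F b g" "\<And>z. poly g z = 0 \<Longrightarrow> 0 \<le> v z" "poly (pderiv g) b \<noteq> 0"
  shows "b \<in> perf_cl D"
proof -
  define H where "H = henselization v (adjoin F X)"
  define L where "L = henselization v (adjoin K X)"
  note C = subfield_alg_cl[OF F(1)]
  have H: "subfield H \<Omega>" "henselian v H" "adjoin F X \<subseteq> H"
    unfolding H_def by (intro subfield_henselization henselian_henselization subset_henselization subfield_gen)+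
  have L: "subfield L \<Omega>" "henselian v L" "adjoin K X \<subseteq> L"
    unfolding L_def by (intro subfield_henselization henselian_henselization subset_henselization subfield_gen)+
  have KL: "K \<subseteq> L" "X \<in> L" using L(3) subset_adjoin[of K X] X_in_adjoin[of X K] by auto
  have KH: "K \<subseteq> H" using H(3) subset_adjoin[of F X] F(2) by auto
  have FC: "F \<subseteq> alg_cl F" by (rule subset_alg_cl[OF F(1)])
  have g0: "poly_over F g" "poly g b = 0" "Polynomial.lead_coeff g = 1" "g \<noteq> 0" using g(1) by (auto simp: is_minpoly_def)
  have ig: "int_poly g" using int_poly_prod_linear[of "proots g"] g(2) g0(4) monic_eq_prod_proots(1)[OF g0(3)] by simp
  have vb: "0 \<le> v b" using g(2) g0(2) by blast
  \<comment> \<open>\<open>e\<close> bounds the distance of \<open>b\<close> from its other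
    conjugates: the cofactor of \<open>g\<close> at \<open>b\<close> takes the value
    \<open>e\<close> at \<open>b\<close> and 0 at every other root, and is integral.\<close>
  define e where "e = poly (pderiv g) b"
  have e: "0 \<le> v e" "e \<noteq> 0" unfolding e_def using int_poly_value[OF int_poly_pderiv[OF ig] vb] g(3) by auto
  have sep: "v (b - z) \<le> v e" if z: "poly g z = 0" "z \<noteq> b" for z
  proof -
    define u where "u = synthetic_div g b"
    have u: "int_poly u" "g = [:- b, 1:] * u"
      using int_poly_synthetic_div[OF ig vb] synthetic_div_correct'[of b g] g0(2) by (simp_all add: u_def)
    have "e = poly u b" unfolding e_def by (subst u(2)) (simp only: pderiv_linear_mult, simp)
    moreover have "(z - b) * poly u z = 0" using z(1) by (subst (asm) u(2)) (simp add: algebra_simps)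
    then have "poly u z = 0" using z(2) by simp
    ultimately show ?thesis using int_poly_diff_value[OF u(1) vb g(2)[OF z(1)]] by simp
  qed
  have "e \<in> alg_cl F" unfolding e_def
    using poly_closed[OF C poly_over_pderiv[OF C poly_over_mono[OF g0(1) FC]] b(1)] .
  then have "e * e \<in> alg_cl F" "e * e \<noteq> 0" using subfield_mult[OF C] e(2) by auto
  \<comment> \<open>Precision beyond \<open>e * e\<close> gives Newton's condition for the perturbed
    polynomial at \<open>b\<close> and leaves the value of the derivative there unchanged.\<close>
  then obtain \<kappa> where \<kappa>: "\<kappa> \<in> K" "\<kappa> \<noteq> 0" "v (e * e) < v \<kappa>" using co unfolding cofinal_in_def by blast
  have e\<kappa>: "v e < v \<kappa>" using v_mult_ge_0[OF e(1), of e] \<kappa>(3) by order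
  obtain g' where g': "poly_over K g'" "\<And>i. v \<kappa> < v (coeff g i - coeff g' i)"
  proof (rule poly_over_choice[OF K, of "\<lambda>x. v \<kappa> < v x" g])
    show "\<exists>l\<in>K. v \<kappa> < v (coeff g i - l)" for i
      using dense[of "coeff g i" \<kappa>] g0(1) \<kappa>(1,2) F(2) by (auto simp: poly_over_def)
  qed (use \<kappa> in auto)
  have k0: "0 < v \<kappa>" using e(1) e\<kappa> by order
  have ig': "int_poly g'" using near_int_poly[OF ig, of g'] g'(2) k0 by (meson less_trans)
  have "v \<kappa> < v (poly g b - poly g' b)" by (rule poly_near_value_less[OF g'(2) vb])
  then have gb: "v (e * e) < v (poly g' b)" using \<kappa>(3) g0(2) by simp
  have "v \<kappa> < v (e - poly (pderiv g') b)" unfolding e_def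
    by (rule poly_near_value_less[OF coeff_pderiv_near[OF g'(2)] vb])
  then have "v e < v (e - poly (pderiv g') b)" using e\<kappa> by order
  then have eg: "v (poly (pderiv g') b) = v e" by (rule v_eq_of_diff)
  obtain b0 where b0: "poly g' b0 = 0" "v e < v (b0 - b)"
    and un: "\<forall>z. poly g' z = 0 \<and> v e < v (z - b) \<longrightarrow> z = b0"
    using newton_root_unique[OF ig' vb eg e gb] .
  have "g' \<noteq> 0"
  proof
    assume "g' = 0"
    then have "v e = Pinf" using eg by simp
    then show False using e(2) by simp
  qed
  then have b0K: "b0 \<in> alg_cl K" using alg_cl_iff[OF K] g'(1) b0(1) by blast
  have b0C: "b0 \<in> alg_cl F" using b0K alg_cl_mono[OF F(2)] by auto
  have bH: "b \<in> H" using b(2) by (simp add: H_def)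
  have b0H: "b0 \<in> alg_cl H" using b0K alg_cl_mono[OF KH] by auto
  \<comment> \<open>\<open>b\<close> lies in the henselian \<open>H\<close>, so conjugates of
    \<open>b0\<close> over \<open>H\<close> are equally far from \<open>b\<close>, and
    \<open>b0\<close> is the only root of \<open>g'\<close> that close.\<close>
  have "b0 \<in> perf_cl H"
  proof (rule unique_conjugate_imp_perf_cl[OF H(1) b0H])
    fix z assume z: "conjugate H b0 z"
    have "b0 - b \<in> alg_cl H" using subfield_diff[OF subfield_alg_cl[OF H(1)] b0H] subset_alg_cl[OF H(1)] bH by blast
    then have "v (z - b) = v (b0 - b)" using conjugate_value_eq[OF H(1,2) _ conjugate_diff[OF H(1) z bH]] by simp
    moreover have "poly g' z = 0" using z b0(1) poly_over_mono[OF g'(1) KH] by (auto simp: conjugate_def)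
    ultimately show "z = b0" using un b0(2) by simp
  qed
  then obtain n where n: "(frob ^^ n) b0 \<in> H" by (auto simp: perf_cl_def)
  define a where "a = (frob ^^ n) b0"
  have aK: "a \<in> alg_cl K" unfolding a_def by (rule frob_closed[OF subfield_alg_cl[OF K] b0K])
  have aC: "a \<in> alg_cl F" using aK alg_cl_mono[OF F(2)] by auto
  have KL': "alg_cl K \<subseteq> alg_cl L" by (rule alg_cl_mono[OF KL(1)])
  have vals: "\<exists>l\<in>L. v \<kappa> < v (y - l)" if "y \<in> F" "\<kappa> \<in> K" "\<kappa> \<noteq> 0" for y \<kappa>
    using dense[of y \<kappa>] that F(2) KL(1) by blast
  then have FV: "F \<subseteq> vclosure K L (alg_cl F)" using FC by (auto simp: vclosure_def)
  have aV: "a \<in> vclosure K L (alg_cl F)"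
    using henselization_Int_alg_cl_approx[OF K F L(1,2) KL co FV alg X] n aC by (auto simp: a_def H_def)
  \<comment> \<open>The finitely many differences between \<open>a\<close> and its other conjugates
    over \<open>K\<close> have values below that of some \<open>\<rho>\<close> in \<open>K\<close>,
    and \<open>L\<close> approximates \<open>a\<close> to that precision.\<close>
  have "a \<in> perf_cl L"
  proof -
    obtain h where h: "is_minpoly K a h" using minpoly_exists[OF K aK] .
    have h0: "h \<noteq> 0" "poly_over K h" using h by (auto simp: is_minpoly_def)
    have "{z. poly h z = 0} \<subseteq> alg_cl F" using h0 alg_cl_iff[OF K] alg_cl_mono[OF F(2)] by blast
    then have R: "finite ((\<lambda>z. a - z) ` {z. poly h z = 0})" "(\<lambda>z. a - z) ` {z. poly h z = 0} \<subseteq> alg_cl F"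
      using poly_roots_finite[OF h0(1)] subfield_diff[OF C aC] by auto
    obtain \<rho> where \<rho>: "\<rho> \<in> K" "\<rho> \<noteq> 0" "\<forall>r\<in>(\<lambda>z. a - z) ` {z. poly h z = 0}. r \<noteq> 0 \<longrightarrow> v r < v \<rho>"
      using cofinal_finite[OF K co R] .
    obtain l where l: "l \<in> L" "v \<rho> < v (a - l)" using vclosureD[OF aV \<rho>(1,2)] by blast
    show ?thesis
    proof (rule krasner[OF L(1,2) L(1) order_refl _ l(1)])
      show "a \<in> alg_cl L" "l \<in> alg_cl L" using aK KL' l(1) subset_alg_cl[OF L(1)] by auto
      fix z assume z: "conjugate L a z" "z \<noteq> a"
      have "poly h z = 0" using conjugate_mono[OF KL(1) z(1)] conjugate_iff_minpoly_root[OF K h] by simp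
      then have "v (a - z) < v \<rho>" using \<rho>(3) z(2) by auto
      then show "v (a - z) < v (a - l)" using l(2) by order
    qed
  qed
  then obtain m where m: "(frob ^^ m) a \<in> L" by (auto simp: perf_cl_def)
  have "(frob ^^ m) a \<in> D" using m frob_closed[OF subfield_alg_cl[OF K] aK] D(3) by (auto simp: L_def)
  then have "(frob ^^ n) b0 \<in> perf_cl D" unfolding a_def[symmetric] perf_cl_def by blast
  then have "b0 \<in> perf_cl (perf_cl D)" unfolding perf_cl_def[of "perf_cl D"] by blast
  then have b0D: "b0 \<in> perf_cl D" by (simp add: perf_cl_perf_cl)
  have FhE: "henselization v F \<subseteq> perf_cl D" using D(2) subset_perf_cl by blast
  have FE: "F \<subseteq> perf_cl D" using FhE subset_henselization[OF F(1)] by blast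
  have CH: "alg_cl F \<subseteq> alg_cl (henselization v F)" by (rule alg_cl_mono[OF subset_henselization[OF F(1)]])
  \<comment> \<open>Krasner over \<open>henselization v F\<close>: \<open>b0\<close> is closer to
    \<open>b\<close> than \<open>v e\<close>, hence closer than any other conjugate.\<close>
  have "b \<in> perf_cl (perf_cl D)"
  proof (rule krasner[OF subfield_henselization[OF F(1)] henselian_henselization[OF F(1)] subfield_perf_cl[OF D(1)] FhE _ b0D])
    show "b \<in> alg_cl (henselization v F)" "b0 \<in> alg_cl (henselization v F)" using CH b(1) b0C by auto
    fix z assume z: "conjugate (perf_cl D) b z" "z \<noteq> b"
    have "poly g z = 0" using conjugate_mono[OF FE z(1)] conjugate_iff_minpoly_root[OF F(1) g(1)] by simp
    then show "v (b - z) < v (b - b0)" using sep[OF _ z(2)] b0(2) by (simp add: v_minus_commute)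
  qed
  then show ?thesis by (simp add: perf_cl_perf_cl)
qed

lemma scale_integral:
  assumes K: "subfield K \<Omega>" and R: "finite R" "\<And>r. r \<in> R \<Longrightarrow> bdd K r"
  obtains s where "s \<in> K" "s \<noteq> 0" "\<forall>r\<in>R. 0 \<le> v (s * r)"
proof -
  have "\<exists>s\<in>K. s \<noteq> 0 \<and> (\<forall>r\<in>R. 0 \<le> v (s * r))" using R
  proof (induction R rule: finite_induct)
    case empty
    then show ?case using subfield_1[OF K] by (intro bexI[of _ 1]) auto
  next
    case (insert r R)
    then obtain s where s: "s \<in> K" "s \<noteq> 0" "\<forall>r\<in>R. 0 \<le> v (s * r)" by auto
    obtain \<rho> where \<rho>: "\<rho> \<in> K" "\<rho> \<noteq> 0" "v \<rho> \<le> v r" using insert.prems[of r] by (auto simp: bdd_def)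
    define t where "t = (if v s \<le> v (inverse \<rho>) then inverse \<rho> else s)"
    have t: "t \<in> K" "t \<noteq> 0" "v s \<le> v t" "v (inverse \<rho>) \<le> v t"
      using s \<rho> subfield_inverse[OF K] by (auto simp: t_def)
    have "0 \<le> v (t * r)" using v_mult_mono[OF t(4) \<rho>(3)] \<rho>(2) by simp
    moreover have "0 \<le> v (t * r')" if "r' \<in> R" for r'
      using v_mult_mono[OF t(3) order_refl, of r'] s(3) that order_trans by blast
    ultimately show ?case using t(1,2) by (intro bexI[of _ t]) auto
  qed
  then show ?thesis using that by blast
qed

text \<open>Reduction to integral conjugates: \<open>b\<close> is multiplied by a suitable nonzero
  \<open>s\<close> of \<open>K\<close>, which affects neither separability nor membership in the
  fields concerned.\<close>

lemma separable_mem_perf_cl: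
  assumes K: "subfield K \<Omega>" and F: "subfield F \<Omega>" "K \<subseteq> F"
    and dense: "\<And>a \<kappa>. a \<in> F \<Longrightarrow> \<kappa> \<in> F \<Longrightarrow> \<kappa> \<noteq> 0 \<Longrightarrow> \<exists>b\<in>K. v \<kappa> < v (a - b)"
    and co: "cofinal_in K (alg_cl F)"
    and alg: "alg_cl (adjoin F X) = UNIV" and X: "X \<notin> alg_cl F"
    and D: "subfield D \<Omega>" "henselization v F \<subseteq> D" "alg_cl K \<inter> henselization v (adjoin K X) \<subseteq> D"
    and b: "b \<in> alg_cl F" "b \<in> henselization v (adjoin F X)"
    and h: "poly_over F h" "poly h b = 0" "poly (pderiv h) b \<noteq> 0"
  shows "b \<in> perf_cl D"
proof -
  note C = subfield_alg_cl[OF F(1)]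
  obtain g where g: "is_minpoly F b g" using minpoly_exists[OF F(1) b(1)] .
  have g0: "g \<noteq> 0" "poly_over F g" using g by (auto simp: is_minpoly_def)
  have "bdd K r" if "r \<in> {z. poly g z = 0}" for r
    using that alg_cl_iff[OF F(1)] g0 cofinal_bdd[OF K C co] by blast
  then obtain s where s: "s \<in> K" "s \<noteq> 0" "\<forall>r\<in>{z. poly g z = 0}. 0 \<le> v (s * r)"
    using scale_integral[OF K poly_roots_finite[OF g0(1)]] by metis
  have sF: "s \<in> F" "inverse s \<in> F" using s F subfield_inverse[OF F(1)] by auto
  have sb: "s * b \<in> alg_cl F" using subfield_mult[OF C] b(1) sF(1) subset_alg_cl[OF F(1)] by blast
  have "F \<subseteq> henselization v (adjoin F X)" using subset_henselization[OF subfield_gen[of "insert X F"]] subset_adjoin[of F X] by blast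
  then have sbH: "s * b \<in> henselization v (adjoin F X)"
    using sF(1) b(2) by (intro subfield_mult[OF subfield_henselization[OF subfield_gen]]) auto
  obtain g' where g': "is_minpoly F (s * b) g'" using minpoly_exists[OF F(1) sb] .
  have int: "0 \<le> v z" if "poly g' z = 0" for z
  proof -
    have "conjugate F (s * b) z" using that conjugate_iff_minpoly_root[OF F(1) g'] by simp
    from conjugate_mult[OF F(1) this sF(2)] have "conjugate F b (inverse s * z)" using s(2) by (simp add: mult.assoc[symmetric])
    then have "poly g (inverse s * z) = 0" using conjugate_iff_minpoly_root[OF F(1) g] by simp
    then have "0 \<le> v (s * (inverse s * z))" using s(3) by blast
    then show ?thesis using s(2) by (simp add: mult.assoc[symmetric])
  qed
  have sbs: "s * b * inverse s = b" using s(2) by (simp add: field_simps)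
  define h' where "h' = pcompose h [:0, inverse s:]"
  have h': "poly_over F h'" "poly h' (s * b) = 0" "poly (pderiv h') (s * b) \<noteq> 0"
    unfolding h'_def using h s(2) sF(2) subfield_0[OF F(1)]
    by (auto simp: sbs poly_pcompose pderiv_pcompose pderiv_pCons poly_over_pCons[OF F(1)] poly_over_0[OF F(1)] intro!: poly_over_pcompose[OF F(1)])
  have "poly g' (s * b) = 0" using g' by (simp add: is_minpoly_def)
  then have "poly (pderiv g') (s * b) \<noteq> 0" using is_minpoly_simple[OF F(1) g' h'] by blast
  then have "s * b \<in> perf_cl D"
    using integral_separable_mem_perf_cl[OF K F dense co alg X D sb sbH g' int] by blast
  moreover have "inverse s \<in> perf_cl D" using sF(2) subset_henselization[OF F(1)] D(2) subset_perf_cl by blast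
  ultimately have "inverse s * (s * b) \<in> perf_cl D" using subfield_mult[OF subfield_perf_cl[OF D(1)]] by blast
  moreover have "inverse s * (s * b) = b" using s(2) by (simp add: field_simps)
  ultimately show ?thesis by metis
qed

lemma IC_of_dense:
  assumes K: "subfield K \<Omega>" and F: "subfield F \<Omega>" "K \<subseteq> F" and dense: "dense_in \<Omega> v K F"
    and alg: "alg_cl (adjoin F X) = UNIV" and X: "X \<notin> alg_cl F"
  shows "gen (henselization v F \<union> IC v K X) = IC v F X"
proof
  define D where "D = gen (henselization v F \<union> IC v K X)"
  define H where "H = henselization v (adjoin F X)"
  note C = subfield_alg_cl[OF F(1)]
  have H: "subfield H \<Omega>" "henselian v H" "adjoin F X \<subseteq> H"
    unfolding H_def by (intro subfield_henselization henselian_henselization subset_henselization subfield_gen)+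
  have IC_F: "IC v F X = alg_cl F \<inter> H" by (simp add: IC_def H_def)
  have sub: "henselization v F \<union> IC v K X \<subseteq> IC v F X"
  proof -
    have "henselization v F \<subseteq> H" unfolding H_def by (intro henselization_mono F(1) subfield_gen subset_adjoin)
    moreover have "henselization v (adjoin K X) \<subseteq> H"
      unfolding H_def by (intro henselization_mono subfield_gen adjoin_mono F(2))
    ultimately show ?thesis using henselization_subset_alg_cl[OF F(1)] alg_cl_mono[OF F(2)] by (auto simp: IC_def H_def)
  qed
  have sIC: "subfield (IC v F X) \<Omega>" unfolding IC_F by (rule subfield_Int[OF C H(1)])
  show DI: "gen (henselization v F \<union> IC v K X) \<subseteq> IC v F X" by (rule gen_least[OF sIC sub])
  have D: "subfield D \<Omega>" "henselization v F \<subseteq> D" "alg_cl K \<inter> henselization v (adjoin K X) \<subseteq> D" "D \<subseteq> alg_cl F"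
    using subfield_gen subset_gen[of "henselization v F \<union> IC v K X"] DI by (auto simp: D_def IC_def)
  have FD: "F \<subseteq> D" using subset_henselization[OF F(1)] D(2) by blast
  have dense': "\<exists>b\<in>K. v \<kappa> < v (a - b)" if a: "a \<in> F" and \<kappa>: "\<kappa> \<in> F" "\<kappa> \<noteq> 0" for a \<kappa>
  proof -
    obtain \<gamma> where \<gamma>: "v \<kappa> = Fin \<gamma>" using v_Fin[OF \<kappa>(2)] .
    have "\<gamma> \<in> value_group v F" unfolding value_group_def using \<kappa>(1) \<gamma> by (auto simp: image_iff intro!: bexI[of _ \<kappa>])
    then show ?thesis using dense a unfolding dense_in_def by (simp add: \<gamma>)
  qed
  have vals: "\<exists>k\<in>K. k \<noteq> 0 \<and> v u = v k" if u: "u \<in> F" "u \<noteq> 0" for u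
  proof -
    \<comment> \<open>An element closer to \<open>u\<close> than \<open>v u\<close> has the same
      value, so density leaves the value group unchanged.\<close>
    obtain k where k: "k \<in> K" "v u < v (u - k)" using dense'[OF u(1) u] by blast
    then have "v k = v u" by (intro v_eq_of_diff)
    moreover have "k \<noteq> 0" using k(2) by auto
    ultimately show ?thesis using k(1) by auto
  qed
  show "IC v F X \<subseteq> gen (henselization v F \<union> IC v K X)"
  proof
    fix b assume "b \<in> IC v F X"
    then have b: "b \<in> alg_cl F" "b \<in> H" by (auto simp: IC_F)
    show "b \<in> gen (henselization v F \<union> IC v K X)"
    proof (cases "\<exists>\<pi>\<in>K. \<pi> \<noteq> 0 \<and> v \<pi> \<noteq> 0")
      case False
      \<comment> \<open>For a trivial valuation the values of \<open>K\<close> are not cofinal, but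
        density then means equality.\<close>
      have "F \<subseteq> K"
      proof
        fix a assume a: "a \<in> F"
        obtain k where k: "k \<in> K" "v 1 < v (a - k)" using dense'[OF a subfield_1[OF F(1)]] by auto
        have "a - k = 0"
        proof (rule ccontr)
          assume "a - k \<noteq> 0"
          then obtain k' where "k' \<in> K" "k' \<noteq> 0" "v (a - k) = v k'"
            using vals subfield_diff[OF F(1) a] k(1) F(2) by blast
          then show False using False k(2) by auto
        qed
        then show "a \<in> K" using k(1) by simp
      qed
      then have "F = K" using F(2) by blast
      then show ?thesis using b D(3) by (auto simp: H_def D_def)
    next
      case True
      then obtain \<pi> where \<pi>: "\<pi> \<in> K" "\<pi> \<noteq> 0" "v \<pi> \<noteq> 0" by blast
      obtain \<pi>' where \<pi>': "\<pi>' \<in> K" "\<pi>' \<noteq> 0" "0 < v \<pi>'"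
      proof (cases "0 < v \<pi>")
        case False
        then have "v \<pi> < v 1" using \<pi>(3) by simp
        then have "\<not> v (inverse \<pi>) \<le> v (inverse 1)" using v_inverse_le_iff[of \<pi> 1] \<pi>(2) by simp
        then show ?thesis using that[of "inverse \<pi>"] subfield_inverse[OF K \<pi>(1)] \<pi>(2) by (simp add: not_le)
      qed (use that \<pi> in blast)
      have co: "cofinal_in K (alg_cl F)" by (rule cofinal_in_alg_cl[OF K F(1) \<pi>' vals])
      obtain n h where h: "poly_over F h" "poly h ((frob ^^ n) b) = 0" "poly (pderiv h) ((frob ^^ n) b) \<noteq> 0"
        using frob_separable[OF F(1) b(1)] .
      have w: "(frob ^^ n) b \<in> alg_cl F" "(frob ^^ n) b \<in> henselization v (adjoin F X)"
        using frob_closed[OF C b(1)] frob_closed[OF H(1) b(2)] by (auto simp: H_def)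
      have "(frob ^^ n) b \<in> perf_cl D"
        using separable_mem_perf_cl[OF K F dense' co alg X D(1-3) w h] by blast
      then have "b \<in> perf_cl (perf_cl D)" unfolding perf_cl_def[of "perf_cl D"] by blast
      then have bp: "b \<in> perf_cl D" by (simp add: perf_cl_perf_cl)
      \<comment> \<open>Regarding \<open>b\<close> as an element of the henselization of
        \<open>D(X)\<close> allows the Frobenius power to be removed over \<open>D\<close>.\<close>
      have "H \<subseteq> henselization v (adjoin D X)"
        unfolding H_def by (intro henselization_mono subfield_gen adjoin_mono FD)
      then have "b \<in> D" using henselization_adjoin_perf_cl[OF F(1) X D(1,4) _ b(1) bp] b(2) by blast
      then show ?thesis by (simp add: D_def)
    qed
  qed
qed

end

theorem proposition1p5:
  fixes v :: "'a::alg_closed_field \<Rightarrow> 'g::linordered_ab_group_add extended"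
    and K Khat :: "'a set" and X :: 'a
  assumes "valuation \<Omega> v"
    and "is_completion v K Khat"
    and "ring.transcendental \<Omega> Khat X"
    and "algebraic_closure \<Omega> (adjoin Khat X)"
    and "\<not> valuation_algebraic_type_II v K Khat X"
  shows "generate_field \<Omega> (henselization v Khat \<union> IC v K X) = IC v Khat X"
proof -
  interpret valued v by standard (rule assms(1))
  have c: "subfield K \<Omega>" "subfield Khat \<Omega>" "K \<subseteq> Khat" "dense_in \<Omega> v K Khat"
    using assms(2) by (auto simp: is_completion_def)
  have "x \<in> alg_cl (adjoin Khat X)" for x
    using algebraic_closure.algebraic_extension[OF assms(4), of x] by (simp add: alg_cl_def over_def)
  then have "alg_cl (adjoin Khat X) = UNIV" by blast
  moreover have "X \<notin> alg_cl Khat" using assms(3) by (simp add: alg_cl_def)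
  ultimately show ?thesis by (rule IC_of_dense[OF c])
qed

end
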